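(* Let $k, l, n, n_1, n_2$ be positive integers with $n_1+n_2\leq n$ and $n_1,n_2\geq n/20$. Suppose that $D$ is a strongly $10^7k(k+l)^2 \log(2kl)$-connected digraph of order $n$ with $\delta(D)\geq n-l$. Then there exist two disjoint subsets $V_1, V_2$ of $V(D)$ satisfying the following. (1) $|V_i| = n_i$ for each $i\in \{1,2\}$. (2) Each of $D[V_1]$, $D[V_2]$, and $D[V_1, V_2]$ is strongly $k$-connected. In particular, $V_1$ and $V_2$ form a partition of $V(D)$ when $n_1+n_2=n$.
   Context: Digraphs are finite and simple, i.e. without loops and without multiple arcs; a pair of opposite arcs $xy$ and $yx$ is allowed. The order of $D$ is its number of vertices. $N_D^+(v)$ and $N_D^-(v)$ are the sets of out-neighbors and in-neighbors of $v$, and $\delta(D)=\min_{v\in V(D)}|N_D^+(v)\cup N_D^-(v)|$. The logarithm is to base $2$. A digraph is strongly connected if it has a directed path from $x$ to $y$ for every ordered pair of distinct vertices $x,y$. It is strongly $k$-connected (here $k$ may be a positive real number) if it has at least $k+1$ vertices and remains strongly connected whenever any set of at most $k-1$ vertices is deleted. For $U\subseteq V(D)$, $D[U]$ is the subdigraph of $D$ induced by $U$. For disjoint $A,B\subseteq V(D)$, $D[A,B]$ is the subdigraph of $D$ with vertex set $A\cup B$ whose arcs are exactly all arcs of $D$ (in either direction) between $A$ and $B$. *)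

theory Defs
  imports
    Complex_Main
    "HOL-Library.Disjoint_Sets"
    "Graph_Theory.Digraph_Component"
begin

text \<open>
  Finite simple digraphs are the models of the locale \<^locale>\<open>digraph\<close>: finite, without loops and
  without multiple arcs, opposite arcs being allowed. \<open>D \<restriction> U\<close> is the induced subdigraph $D[U]$.
\<close>

definition out_neighbors :: "('a, 'b) pre_digraph \<Rightarrow> 'a \<Rightarrow> 'a set" where
  "out_neighbors D v = {w. v \<rightarrow>\<^bsub>D\<^esub> w}"

definition in_neighbors :: "('a, 'b) pre_digraph \<Rightarrow> 'a \<Rightarrow> 'a set" where
  "in_neighbors D v = {w. w \<rightarrow>\<^bsub>D\<^esub> v}"

text \<open>Meaningful only for digraphs with at least one vertex, as it is a minimum over the vertices.\<close>

definition min_neighbors :: "('a, 'b) pre_digraph \<Rightarrow> nat" where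
  "min_neighbors D = Min ((\<lambda>v. card (out_neighbors D v \<union> in_neighbors D v)) ` verts D)"

text \<open>
  The parameter is real. \<^const>\<open>strongly_connected\<close> additionally excludes the digraph without
  vertices; this makes no difference here, since at least two vertices remain after the deletion.
\<close>

definition strongly_k_connected :: "real \<Rightarrow> ('a, 'b) pre_digraph \<Rightarrow> bool" where
  "strongly_k_connected k D \<longleftrightarrow>
     real (card (verts D)) \<ge> k + 1 \<and>
     (\<forall>S \<subseteq> verts D. real (card S) \<le> k - 1 \<longrightarrow> strongly_connected (D \<restriction> (verts D - S)))"

text \<open>The subdigraph $D[A,B]$, intended for disjoint $A, B \subseteq V(D)$.\<close>

definition between_subgraph ::
    "('a, 'b) pre_digraph \<Rightarrow> 'a set \<Rightarrow> 'a set \<Rightarrow> ('a, 'b) pre_digraph" where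
  "between_subgraph D A B =
     \<lparr> verts = A \<union> B,
       arcs = {e \<in> arcs D. (tail D e \<in> A \<and> head D e \<in> B) \<or> (tail D e \<in> B \<and> head D e \<in> A)},
       tail = tail D, head = head D \<rparr>"

end

theory Submission
  imports Defs
begin

text \<open>
  Vertices of low in-degree are the hard ones to reach. Starting from \<open>O(k + l)\<close> disjoint arcs between
  vertices of lowest in-degree, one builds gadgets: a source together with two sets of \<open>O(log (kl))\<close>
  vertices, each of which dominates all but few \<open>exceptional\<close> vertices, and which the source also reaches
  by alternating paths when the gadget is properly 2-coloured. Symmetric gadgets are built for out-degrees.
  By Menger's theorem there are many disjoint paths from the sinks of the latter to the sources of the
  former, and the shortest \<open>O(k)\<close> of them use a small part of the vertices only. A third of the resulting
  connectors is put into \<open>V1\<close>, a third into \<open>V2\<close>, and a third is coloured alternately; deleting fewer than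
  \<open>k\<close> vertices leaves a connector of each kind intact.

  It remains to reach the exceptional vertices from both sides. Those dominated by many sources are fine
  once the unused sources are split evenly. The others dominate many sources, so a path meeting many of
  their in-neighbours can be rerouted to end in them; after suitable rerouting each of them keeps many
  in-neighbours off the paths. As their number is comparable to their in-degrees, a random colouring
  leaves enough of these in-neighbours in both parts.
\<close>

section \<open>Linkages and Menger's theorem\<close>

text \<open>Why low in-degrees: halving bounds the vertices missed by a gadget only by a fraction of
  the in-degree of its starting vertices, up to multiples of \<open>l\<close>. Starting from the
  lowest in-degrees turns this into a fraction of every in-degree outside the gadgets. O(log (kl))
  halvings bring the union of all O(k + l) exceptional sets below \<open>\<delta>m / 20\<close>,
  while every remaining vertex has at least \<open>\<delta>m\<close> in-neighbours. The final union
  bound rests on this: the number of bad events is linear in \<open>\<delta>m\<close>, their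
  probability exponentially small in \<open>\<delta>m / k^2\<close>. The obstacle is that one
  colouring has to serve three digraphs: in D[V1] and D[V2] a vertex is entered from its own part,
  in D[V1,V2] from the other one. The reachability conditions therefore ask for \<open>k\<close>
  suitable vertices in both parts, and only the connectors are made for a particular digraph. All
  conditions survive enlarging the parts, so it is enough to colour few vertices; the prescribed
  sizes are reached by distributing the rest arbitrarily. The suffixes \<open>m\<close> and
  \<open>p\<close> mark the in-degree and the out-degree side.\<close>

abbreviation walk :: "('a \<times> 'a) set \<Rightarrow> 'a list \<Rightarrow> bool" where
  "walk E \<equiv> successively (\<lambda>x y. (x, y) \<in> E)"

definition path :: "('a \<times> 'a) set \<Rightarrow> 'a set \<Rightarrow> 'a set \<Rightarrow> 'a list \<Rightarrow> bool" where
  "path E A B p \<longleftrightarrow> p \<noteq> [] \<and> distinct p \<and> walk E p \<and> hd p \<in> A \<and> last p \<in> B"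

definition linkage :: "('a \<times> 'a) set \<Rightarrow> 'a set \<Rightarrow> 'a set \<Rightarrow> 'a list set \<Rightarrow> bool" where
  "linkage E A B P \<longleftrightarrow> finite P \<and> (\<forall>p\<in>P. path E A B p) \<and>
     (\<forall>p\<in>P. \<forall>q\<in>P. p \<noteq> q \<longrightarrow> set p \<inter> set q = {})"

text \<open>Walks give the same notion as paths, since a walk contains a path between its ends, and
  they spare shortening the spliced walks in the proof of Menger's theorem.\<close>

definition separates :: "('a \<times> 'a) set \<Rightarrow> 'a set \<Rightarrow> 'a set \<Rightarrow> 'a set \<Rightarrow> bool" where
  "separates E A B S \<longleftrightarrow>
     (\<forall>p. p \<noteq> [] \<and> walk E p \<and> hd p \<in> A \<and> last p \<in> B \<longrightarrow> set p \<inter> S \<noteq> {})"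

lemma separatesD:
  "separates E A B S \<Longrightarrow> p \<noteq> [] \<Longrightarrow> walk E p \<Longrightarrow> hd p \<in> A \<Longrightarrow> last p \<in> B \<Longrightarrow> \<exists>v\<in>set p. v \<in> S"
  unfolding separates_def by blast

lemma walk_mono: "walk E p \<Longrightarrow> E \<subseteq> F \<Longrightarrow> walk F p"
  by (erule successively_mono) auto

lemma walk_append1: "walk E (p @ [v]) \<longleftrightarrow> walk E p \<and> (p \<noteq> [] \<longrightarrow> (last p, v) \<in> E)"
  by (auto simp: successively_append_iff)

text \<open>Using the arc \<open>(x, y)\<close> means entering \<open>y\<close> after the first
  vertex.\<close>

lemma walk_Diff_tl: "walk E p \<Longrightarrow> y \<notin> set (tl p) \<Longrightarrow> walk (E - {(x, y)}) p"
proof (induction p rule: induct_list012)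
  case (3 a b p)
  then show ?case by (cases p) auto
qed auto

lemma walk_Diff_butlast: "walk E p \<Longrightarrow> x \<notin> set (butlast p) \<Longrightarrow> walk (E - {(x, y)}) p"
proof (induction p rule: induct_list012)
  case (3 a b p)
  then show ?case by (cases p) auto
qed auto

lemma linkage_disjoint:
  "linkage E A B P \<Longrightarrow> p \<in> P \<Longrightarrow> q \<in> P \<Longrightarrow> v \<in> set p \<Longrightarrow> v \<in> set q \<Longrightarrow> p = q"
  unfolding linkage_def by blast

lemma linkage_nonempty: "linkage E A B P \<Longrightarrow> p \<in> P \<Longrightarrow> p \<noteq> []"
  unfolding linkage_def path_def by blast

lemma linkage_path: "linkage E A B P \<Longrightarrow> p \<in> P \<Longrightarrow> path E A B p"
  unfolding linkage_def by blast

lemma linkage_mono: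
  assumes "linkage E A B P" and "E \<subseteq> F" shows "linkage F A B P"
  using assms walk_mono[OF _ assms(2)] unfolding linkage_def path_def by simp

lemma linkage_subset: "linkage E A B P \<Longrightarrow> Q \<subseteq> P \<Longrightarrow> linkage E A B Q"
  unfolding linkage_def by (intro conjI ballI; (elim conjE)?; (metis finite_subset | metis subsetD))

lemma linkage_rev:
  assumes "linkage E A B P" shows "linkage (E\<inverse>) B A (rev ` P)"
  using assms unfolding linkage_def path_def by (simp add: hd_rev last_rev)

text \<open>Every new path stays within its old one, so disjointness is inherited; as the new paths
  are nonempty, no two of them coincide.\<close>

lemma linkage_image:
  assumes P: "linkage E A B P"
    and f: "\<And>p. p \<in> P \<Longrightarrow> path E' A' B' (f p) \<and> set (f p) \<subseteq> set p"
  shows "linkage E' A' B' (f ` P)" and "card (f ` P) = card P"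
proof -
  have ne: "f p \<noteq> []" if "p \<in> P" for p using f[OF that] by (simp add: path_def)
  have *: "p = q" if "p \<in> P" "q \<in> P" "v \<in> set (f p)" "v \<in> set (f q)" for p q v
    using linkage_disjoint[OF P that(1,2)] f that by blast
  show "linkage E' A' B' (f ` P)"
    unfolding linkage_def using P f * by (fastforce simp: linkage_def)
  have "inj_on f P"
    by (rule inj_onI) (metis * ne last_in_set)
  then show "card (f ` P) = card P" by (rule card_image)
qed

text \<open>Induction on the number of arcs. If some \<open>S\<close> of size less than
  \<open>N\<close> separates after the removal of an arc \<open>(x, y)\<close>, then
  \<open>insert x S\<close> and \<open>insert y S\<close> separate in \<open>E\<close> and have
  exactly \<open>N\<close> vertices. The induction hypothesis links \<open>A\<close> to the former
  and the latter to \<open>B\<close> without this arc, and the two linkages are glued along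
  \<open>S\<close> and \<open>(x, y)\<close>.\<close>

theorem menger:
  assumes "finite E" "finite A" "finite B"
    and "\<And>S. finite S \<Longrightarrow> separates E A B S \<Longrightarrow> N \<le> card S"
  shows "\<exists>P. linkage E A B P \<and> card P = N"
  using assms
proof (induction "card E" arbitrary: E A B rule: less_induct)
  case (less E A B)
  show ?case
  proof (cases "E = {}")
    case True
    have "hd p = last p" if "p \<noteq> []" "walk E p" for p :: "'a list"
      using that True by (cases p) (auto simp: successively_Cons)
    then have "separates E A B (A \<inter> B)"
      unfolding separates_def by (metis IntI empty_iff hd_in_set)
    then have "N \<le> card (A \<inter> B)" using less.prems by blast
    then obtain X where X: "X \<subseteq> A \<inter> B" "card X = N" "finite X"
      by (meson obtain_subset_with_card_n)
    have "linkage E A B ((\<lambda>x. [x]) ` X)"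
      using X by (auto simp: linkage_def path_def)
    moreover have "card ((\<lambda>x. [x]) ` X) = N"
      using X by (subst card_image) (auto simp: inj_on_def)
    ultimately show ?thesis by blast
  next
    case False
    then obtain x y where e: "(x, y) \<in> E" by auto
    define E' where "E' = E - {(x, y)}"
    have E': "finite E'" "card E' < card E" "E' \<subseteq> E"
      using e less.prems(1) unfolding E'_def by (auto simp del: card_Diff_insert intro: card_Diff1_less)
    show ?thesis
    proof (cases "\<forall>S. finite S \<longrightarrow> separates E' A B S \<longrightarrow> N \<le> card S")
      case True
      then obtain P where "linkage E' A B P" "card P = N"
        using less.hyps[OF E'(2,1) less.prems(2,3)] by blast
      then show ?thesis using linkage_mono E'(3) by blast
    next
      case False
      then obtain S where S: "finite S" "separates E' A B S" "card S < N" by force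
      have sepX: "separates E A B (insert x S)"
        unfolding separates_def
      proof (intro allI impI, elim conjE)
        fix p assume p: "p \<noteq> []" "walk E p" "hd p \<in> A" "last p \<in> B"
        show "set p \<inter> insert x S \<noteq> {}"
        proof (cases "x \<in> set p")
          case False
          then have "walk E' p" unfolding E'_def using p(2)
            by (intro walk_Diff_butlast) (auto dest: in_set_butlastD)
          then show ?thesis using separatesD[OF S(2) p(1)] p by auto
        qed auto
      qed
      have sepY: "separates E A B (insert y S)"
        unfolding separates_def
      proof (intro allI impI, elim conjE)
        fix p assume p: "p \<noteq> []" "walk E p" "hd p \<in> A" "last p \<in> B"
        show "set p \<inter> insert y S \<noteq> {}"
        proof (cases "y \<in> set p")
          case False
          then have "walk E' p" unfolding E'_def using p(2)
            by (intro walk_Diff_tl) (auto dest: list.set_sel(2)[OF p(1)])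
          then show ?thesis using separatesD[OF S(2) p(1)] p by auto
        qed auto
      qed
      have "N \<le> card (insert x S)" "N \<le> card (insert y S)"
        using less.prems(4) sepX sepY S(1) by auto
      then have xy: "x \<notin> S" "y \<notin> S" "card (insert x S) = N" "card (insert y S) = N"
        using S(1,3) by (auto simp: card_insert_if split: if_splits)
      \<comment> \<open>The part of a walk up to its first vertex in \<open>insert x S\<close> never
        leaves \<open>x\<close> and so avoids the removed arc. Hence \<open>T\<close> separates
        \<open>A\<close> from \<open>B\<close> in \<open>E\<close> as well.\<close>
      have "N \<le> card T" if T: "finite T" "separates E' A (insert x S) T" for T
      proof (rule less.prems(4)[OF T(1)], unfold separates_def, intro allI impI, elim conjE)
        fix p assume p: "p \<noteq> []" "walk E p" "hd p \<in> A" "last p \<in> B"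
        obtain p1 v p2 where v: "p = p1 @ v # p2" "v \<in> insert x S" "\<forall>u\<in>set p1. u \<notin> insert x S"
          using separatesD[OF sepX p] split_list_first_prop[of p "\<lambda>v. v \<in> insert x S"] by blast
        have "walk E (p1 @ [v])" using p(2) unfolding v(1) by (simp add: successively_append_iff)
        then have "walk E' (p1 @ [v])" unfolding E'_def
          using v(3) by (intro walk_Diff_butlast) auto
        then have "\<exists>w\<in>set (p1 @ [v]). w \<in> T"
          using p(3) v(2) unfolding v(1) by (intro separatesD[OF T(2)]) (auto simp: hd_append split: if_splits)
        then show "set p \<inter> T \<noteq> {}" unfolding v(1) by auto
      qed
      then obtain P where P: "linkage E' A (insert x S) P" "card P = N"
        using less.hyps[OF E'(2,1) less.prems(2), of "insert x S"] S(1) by auto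
      have "N \<le> card T" if T: "finite T" "separates E' (insert y S) B T" for T
      proof (rule less.prems(4)[OF T(1)], unfold separates_def, intro allI impI, elim conjE)
        fix p assume p: "p \<noteq> []" "walk E p" "hd p \<in> A" "last p \<in> B"
        obtain p1 v p2 where v: "p = p1 @ v # p2" "v \<in> insert y S" "\<forall>u\<in>set p2. u \<notin> insert y S"
          using separatesD[OF sepY p] split_list_last_prop[of p "\<lambda>v. v \<in> insert y S"] by blast
        have "walk E (v # p2)" using p(2) unfolding v(1) by (simp add: successively_append_iff)
        then have "walk E' (v # p2)" unfolding E'_def
          using v(3) by (intro walk_Diff_tl) auto
        then have "\<exists>w\<in>set (v # p2). w \<in> T"
          using p(4) v(2) unfolding v(1) by (intro separatesD[OF T(2)]) auto
        then show "set p \<inter> T \<noteq> {}" unfolding v(1) by auto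
      qed
      then obtain Q where Q: "linkage E' (insert y S) B Q" "card Q = N"
        using less.hyps[OF E'(2,1) _ less.prems(3), of "insert y S"] S(1) by auto
      have Pne: "p \<noteq> []" "distinct p" "walk E' p" "hd p \<in> A" "last p \<in> insert x S" if "p \<in> P" for p
        using linkage_path[OF P(1) that] by (auto simp: path_def)
      have Qne: "q \<noteq> []" "distinct q" "walk E' q" "hd q \<in> insert y S" "last q \<in> B" if "q \<in> Q" for q
        using linkage_path[OF Q(1) that] by (auto simp: path_def)
      \<comment> \<open>\<open>N\<close> disjoint paths end in a set of \<open>N\<close> vertices,
        so each of these is the end of exactly one path; likewise for the starts of
        \<open>Q\<close>.\<close>
      have injP: "inj_on last P"
        by (rule inj_onI) (metis P(1) Pne(1) last_in_set linkage_disjoint)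
      have injQ: "inj_on hd Q"
        by (rule inj_onI) (metis Q(1) Qne(1) hd_in_set linkage_disjoint)
      have "last ` P = insert x S"
        using Pne(5) S(1) xy(3) P(2) card_image[OF injP] by (intro card_subset_eq) auto
      then have "\<forall>v\<in>insert x S. \<exists>p. p \<in> P \<and> last p = v" by (metis (no_types) imageE)
      then obtain f where f: "\<And>v. v \<in> insert x S \<Longrightarrow> f v \<in> P \<and> last (f v) = v"
        unfolding bchoice_iff by blast
      have "hd ` Q = insert y S"
        using Qne(4) S(1) xy(4) Q(2) card_image[OF injQ] by (intro card_subset_eq) auto
      then have "\<forall>v\<in>insert y S. \<exists>q. q \<in> Q \<and> hd q = v" by (metis (no_types) imageE)
      then obtain g where g: "\<And>v. v \<in> insert y S \<Longrightarrow> g v \<in> Q \<and> hd (g v) = v"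
        unfolding bchoice_iff by blast
      have onlyP: "v = last p" if "p \<in> P" "v \<in> set p" "v \<in> insert x S" for p v
        using f[OF that(3)] linkage_disjoint[OF P(1) that(1), of "f v" v] that(2) Pne(1) last_in_set by metis
      have onlyQ: "v = hd q" if "q \<in> Q" "v \<in> set q" "v \<in> insert y S" for q v
        using g[OF that(3)] linkage_disjoint[OF Q(1) that(1), of "g v" v] that(2) Qne(1) hd_in_set by metis
      \<comment> \<open>Splicing \<open>p\<close> and \<open>q\<close> at \<open>v\<close> gives a
        walk in \<open>E'\<close> from \<open>A\<close> to \<open>B\<close>, which meets
        \<open>S\<close>. As \<open>p\<close> meets \<open>S\<close> only at its end and
        \<open>q\<close> only at its start, it does so at \<open>v\<close>.\<close>
      have cross: "v \<in> S \<and> v = last p \<and> v = hd q" if pq: "p \<in> P" "q \<in> Q" "v \<in> set p" "v \<in> set q" for p q v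
      proof -
        obtain p1 p2 where p: "p = p1 @ v # p2" using pq(3) by (meson split_list)
        obtain q1 q2 where q: "q = q1 @ v # q2" using pq(4) by (meson split_list)
        have "walk E' (p1 @ v # q2)"
          using Pne(3)[OF pq(1)] Qne(3)[OF pq(2)] unfolding p q by (auto simp: successively_append_iff)
        moreover have "hd (p1 @ v # q2) \<in> A" using Pne(4)[OF pq(1)] unfolding p by (cases p1) auto
        moreover have "last (p1 @ v # q2) \<in> B" using Qne(5)[OF pq(2)] unfolding q by auto
        ultimately obtain w where w: "w \<in> set (p1 @ v # q2)" "w \<in> S"
          using separatesD[OF S(2), of "p1 @ v # q2"] by blast
        have "w = v"
        proof (cases "w \<in> set p1")
          case True
          then have "w = last p" using onlyP[OF pq(1), of w] w(2) unfolding p by auto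
          then show ?thesis using Pne(2)[OF pq(1)] True unfolding p by (auto split: if_splits)
        next
          case False
          then have wq: "w \<in> set (v # q2)" using w(1) by auto
          then have "w = hd q" using onlyQ[OF pq(2), of w] w(2) unfolding q by auto
          then show ?thesis using Qne(2)[OF pq(2)] wq unfolding q by (cases q1) (auto)
        qed
        then show ?thesis using onlyP[OF pq(1,3)] onlyQ[OF pq(2,4)] w(2) by auto
      qed
      define h where "h v = (if v = x then f x @ g y else f v @ tl (g v))" for v
      have hset: "set (h v) \<subseteq> set (f v) \<union> set (g (if v = x then y else v))" if "v \<in> insert x S" for v
        using that g[of v] Qne(1) unfolding h_def by (auto dest: list.set_sel(2)[rotated])
      have disj: "v = w" if vw: "v \<in> insert x S" "w \<in> insert x S" and u: "u \<in> set (h v)" "u \<in> set (h w)" for v w u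
      proof -
        let ?y = "\<lambda>v. if v = x then y else v"
        have yv: "?y v \<in> insert y S" "?y w \<in> insert y S" using vw by auto
        consider "u \<in> set (f v)" "u \<in> set (f w)" | "u \<in> set (g (?y v))" "u \<in> set (g (?y w))"
          | "u \<in> set (f v)" "u \<in> set (g (?y w))" | "u \<in> set (g (?y v))" "u \<in> set (f w)"
          using hset vw u by blast
        moreover have fv: "f v \<in> P" "last (f v) = v" and fw: "f w \<in> P" "last (f w) = w"
          using f[OF vw(1)] f[OF vw(2)] by auto
        moreover have gv: "g (?y v) \<in> Q" "hd (g (?y v)) = ?y v"
          and gw: "g (?y w) \<in> Q" "hd (g (?y w)) = ?y w"
          using g[OF yv(1)] g[OF yv(2)] by blast+
        ultimately show ?thesis
        proof cases
          case 1
          have "f v = f w" by (rule linkage_disjoint[OF P(1) fv(1) fw(1) 1])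
          with fv(2) fw(2) show ?thesis by metis
        next
          case 2
          have "g (?y v) = g (?y w)" by (rule linkage_disjoint[OF Q(1) gv(1) gw(1) 2])
          then have "?y v = ?y w" using gv(2) gw(2) by metis
          then show ?thesis using vw xy by (auto split: if_splits)
        next
          case 3
          then have "u \<in> S" "u = v" "u = ?y w" using cross[OF fv(1) gw(1)] fv(2) gw(2) by metis+
          then show ?thesis using xy by (auto split: if_splits)
        next
          case 4
          then have "u \<in> S" "u = w" "u = ?y v" using cross[OF fw(1) gv(1)] fw(2) gv(2) by metis+
          then show ?thesis using xy by (auto split: if_splits)
        qed
      qed
      have hpath: "path E A B (h v)" if v: "v \<in> insert x S" for v
      proof (cases "v = x")
        case True
        have fg: "f x \<in> P" "last (f x) = x" "g y \<in> Q" "hd (g y) = y"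
          using f[of x] g[of y] by auto
        have dis: "set (f x) \<inter> set (g y) = {}"
          using cross[OF fg(1,3)] fg(2) xy(1) by (metis disjoint_iff)
        have "walk E (f x @ g y)"
          using walk_mono[OF Pne(3)[OF fg(1)] E'(3)] walk_mono[OF Qne(3)[OF fg(3)] E'(3)] e fg(2,4)
          by (simp add: successively_append_iff)
        then show ?thesis
          using Pne[OF fg(1)] Qne[OF fg(3)] dis unfolding path_def h_def True by simp
      next
        case False
        then have vS: "v \<in> insert y S" using v by blast
        have fg: "f v \<in> P" "last (f v) = v" "g v \<in> Q" "hd (g v) = v"
          using f[OF v] g[OF vS] by blast+
        obtain q where q: "g v = v # q" using fg(4) Qne(1)[OF fg(3)] by (cases "g v") auto
        have wq: "walk E (v # q)" "distinct (v # q)" "last (v # q) \<in> B"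
          using Qne(2,3,5)[OF fg(3)] E'(3) walk_mono unfolding q by blast+
        have dis: "set (f v) \<inter> set q = {}"
        proof -
          have "u = v" if "u \<in> set (f v)" "u \<in> set q" for u
            using cross[OF fg(1,3) that(1)] that(2) fg(2) unfolding q by simp
          then show ?thesis using wq(2) by auto
        qed
        have "walk E (f v @ q)"
          using walk_mono[OF Pne(3)[OF fg(1)] E'(3)] wq(1) fg(2)
          by (auto simp: successively_append_iff successively_Cons)
        moreover have "last (f v @ q) \<in> B" using wq(3) fg(2) by (cases q) auto
        ultimately show ?thesis
          using Pne[OF fg(1)] wq(2) dis False unfolding path_def h_def q by simp
      qed
      have "inj_on h (insert x S)"
      proof (rule inj_onI)
        fix v w assume vw: "v \<in> insert x S" "w \<in> insert x S" "h v = h w"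
        have "h v \<noteq> []" using hpath[OF vw(1)] by (simp add: path_def)
        then show "v = w" using disj[OF vw(1,2), of "hd (h v)"] vw(3) by (metis hd_in_set)
      qed
      then have "card (h ` insert x S) = N" using card_image xy(3) by metis
      moreover have "linkage E A B (h ` insert x S)"
        unfolding linkage_def
      proof (intro conjI ballI impI)
        fix p q assume "p \<in> h ` insert x S" "q \<in> h ` insert x S" and ne: "p \<noteq> q"
        then obtain v w where v: "v \<in> insert x S" "p = h v" and w: "w \<in> insert x S" "q = h w"
          by (elim imageE)
        show "set p \<inter> set q = {}" using disj[OF v(1) w(1)] ne unfolding v(2) w(2) by (metis disjoint_iff)
      next
        fix p assume "p \<in> h ` insert x S"
        then obtain v where "v \<in> insert x S" "p = h v" by (elim imageE)
        then show "path E A B p" using hpath[of v] by metis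
      next
        show "finite (h ` insert x S)" by (intro finite_imageI finite.insertI S(1))
      qed
      ultimately show ?thesis by metis
    qed
  qed
qed

section \<open>Redirecting linkages\<close>

text \<open>Start at the last visit to \<open>A\<close> and stop at the first visit to
  \<open>B\<close> after it.\<close>

lemma path_trim:
  assumes "path E A B p"
  shows "\<exists>q. path E A B q \<and> set q \<subseteq> set p \<and> set (tl q) \<inter> A = {} \<and> set (butlast q) \<inter> B = {}"
proof -
  have p: "p \<noteq> []" "distinct p" "walk E p" "hd p \<in> A" "last p \<in> B"
    using assms by (auto simp: path_def)
  then have "\<exists>x\<in>set p. x \<in> A" using hd_in_set by metis
  then obtain p1 a p2 where a: "p = p1 @ a # p2" "a \<in> A" "\<forall>x\<in>set p2. x \<notin> A"
    using split_list_last_prop[of p "\<lambda>x. x \<in> A"] by metis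
  have "last (a # p2) \<in> B" using p(5) unfolding a(1) by simp
  then have "\<exists>x\<in>set (a # p2). x \<in> B" using last_in_set by blast
  then obtain q1 b q2 where b: "a # p2 = q1 @ b # q2" "b \<in> B" "\<forall>x\<in>set q1. x \<notin> B"
    using split_list_first_prop[of "a # p2" "\<lambda>x. x \<in> B"] by metis
  have pe: "p = p1 @ q1 @ b # q2" using a(1) b(1) by simp
  have h: "hd (q1 @ [b]) = a" "set (tl (q1 @ [b])) \<subseteq> set p2" using b(1) by (cases q1; auto)+
  have w: "walk E (q1 @ [b])" "distinct (q1 @ [b])"
    using p(2,3) unfolding pe by (auto simp: successively_append_iff)
  have "path E A B (q1 @ [b])" unfolding path_def h(1) using w a(2) b(2) by simp
  moreover have "set (q1 @ [b]) \<subseteq> set p" unfolding pe by auto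
  moreover have "set (tl (q1 @ [b])) \<inter> A = {}" using h(2) a(3) by blast
  moreover have "set (butlast (q1 @ [b])) \<inter> B = {}" using b(3) by auto
  ultimately show ?thesis by metis
qed

lemma linkage_trim:
  assumes P: "linkage E A B P"
  obtains P' where "linkage E A B P'" "card P' = card P" "\<Union>(set ` P') \<subseteq> \<Union>(set ` P)"
    "\<forall>p\<in>P'. set (tl p) \<inter> A = {} \<and> set (butlast p) \<inter> B = {}"
proof -
  have "\<forall>p\<in>P. \<exists>q. path E A B q \<and> set q \<subseteq> set p \<and> set (tl q) \<inter> A = {} \<and> set (butlast q) \<inter> B = {}"
    using path_trim linkage_path[OF P] by blast
  then obtain f where f: "\<And>p. p \<in> P \<Longrightarrow> path E A B (f p) \<and> set (f p) \<subseteq> set p \<and>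
      set (tl (f p)) \<inter> A = {} \<and> set (butlast (f p)) \<inter> B = {}"
    unfolding bchoice_iff by blast
  have "linkage E A B (f ` P)" "card (f ` P) = card P"
    using linkage_image[OF P, of E A B f] f by auto
  moreover have "\<Union>(set ` (f ` P)) \<subseteq> \<Union>(set ` P)" using f by blast
  moreover have "\<forall>p\<in>f ` P. set (tl p) \<inter> A = {} \<and> set (butlast p) \<inter> B = {}" using f by simp
  ultimately show thesis by (rule that)
qed

text \<open>Serial dictatorship: every path picks, among the vertices not picked before, the one it meets
  first.\<close>

lemma serial_dictatorship:
  fixes t :: "'p \<Rightarrow> 'a \<Rightarrow> nat"
  assumes "finite P"
  shows "\<exists>D e. D \<subseteq> P \<and> inj_on e D \<and> (\<forall>p\<in>D. R p (e p)) \<and>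
    (\<forall>p\<in>P. \<forall>y. R p y \<longrightarrow> y \<in> e ` D \<or> p \<in> D \<and> t p (e p) \<le> t p y)"
  using assms
proof induction
  case empty
  show ?case by (intro exI[of _ "{}"]) simp
next
  case (insert p P)
  then obtain D e where D: "D \<subseteq> P" "inj_on e D" "\<forall>p\<in>D. R p (e p)"
    "\<forall>p\<in>P. \<forall>y. R p y \<longrightarrow> y \<in> e ` D \<or> p \<in> D \<and> t p (e p) \<le> t p y" by blast
  show ?case
  proof (cases "\<exists>y. R p y \<and> y \<notin> e ` D")
    case False
    then show ?thesis using D by (intro exI[of _ D] exI[of _ e]) auto
  next
    case True
    then obtain y0 where "R p y0 \<and> y0 \<notin> e ` D" by blast
    from ex_has_least_nat[where P = "\<lambda>y. R p y \<and> y \<notin> e ` D" and m = "t p", OF this]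
    obtain y where y: "R p y" "y \<notin> e ` D" "\<And>z. R p z \<and> z \<notin> e ` D \<Longrightarrow> t p y \<le> t p z"
      by auto
    have p: "p \<notin> D" using insert.hyps D(1) by blast
    define e' where "e' = e(p := y)"
    have e': "e' p = y" "\<And>q. q \<in> D \<Longrightarrow> e' q = e q" using p by (auto simp: e'_def)
    have im: "e' ` insert p D = insert y (e ` D)"
      using e' by auto
    show ?thesis
    proof (intro exI[of _ "insert p D"] exI[of _ e'] conjI ballI allI impI)
      show "insert p D \<subseteq> insert p P" using D(1) by blast
      have "inj_on e' D" using D(2) e'(2) by (metis inj_on_cong)
      moreover have "e' ` D = e ` D" using e'(2) by auto
      ultimately show "inj_on e' (insert p D)"
        using y(2) e'(1) p by (simp add: inj_on_insert)
      show "R q (e' q)" if "q \<in> insert p D" for q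
        using that e'(1) e'(2)[of q] y(1) D(3) by (cases "q = p") auto
      show "z \<in> e' ` insert p D \<or> q \<in> insert p D \<and> t q (e' q) \<le> t q z"
        if q: "q \<in> insert p P" "R q z" for q z
      proof (cases "q = p")
        case True
        then show ?thesis using y(3)[of z] q(2) e'(1) im by auto
      next
        case False
        then have "z \<in> e ` D \<or> q \<in> D \<and> t q (e q) \<le> t q z" using D(4) q by blast
        then show ?thesis using im e'(2) by auto
      qed
    qed
  qed
qed

text \<open>If a path meets many in-neighbours of \<open>y\<close>, it can be redirected to \<open>y\<close> at the first of them, which
  frees the others. Path \<open>p\<close> is redirected to its favourite \<open>e p\<close>, and a path whose old end is needed
  elsewhere is given up. Every \<open>y\<close> to which some path could be redirected thereby gains free
  in-neighbours.\<close>

lemma linkage_redirect: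
  fixes E :: "('a \<times> 'a) set"
  assumes P: "linkage E A B P" and m: "card P = m" and Q: "finite Q" "Q \<subseteq> B"
    and bl: "\<And>p. p \<in> P \<Longrightarrow> set (butlast p) \<inter> Q = {}"
    and X: "\<And>y. y \<in> Q \<Longrightarrow> X y \<subseteq> E\<inverse> `` {y} \<and> finite (X y) \<and> (m + 1) * h \<le> card (X y)" and h: "1 \<le> h"
  obtains P' Y where "linkage E A B P'" "m \<le> 2 * card P'" "Y \<subseteq> Q" "card Y \<le> m"
    "\<Union>(set ` P') \<subseteq> \<Union>(set ` P) \<union> Y"
    "\<forall>y\<in>Q. h \<le> card (X y - \<Union>(set ` P')) + m"
proof -
  \<comment> \<open>The first vertex of \<open>X y\<close> on \<open>p\<close> stays on the path
    when \<open>p\<close> is cut there; the strict bound leaves \<open>h\<close> others behind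
    it.\<close>
  define R where "R p y \<longleftrightarrow> y \<in> Q \<and> h < card (X y \<inter> set p)" for p y
  define t where "t p y = (LEAST i. i < length p \<and> p ! i \<in> X y)" for p y
  have finP: "finite P" using P by (simp add: linkage_def)
  have pp: "p \<noteq> []" "distinct p" "walk E p" "hd p \<in> A" "last p \<in> B" if "p \<in> P" for p
    using linkage_path[OF P that] by (auto simp: path_def)
  have t: "t p y < length p" "p ! t p y \<in> X y" "h \<le> card (X y \<inter> set (drop (Suc (t p y)) p))"
    if "p \<in> P" "R p y" for p y
  proof -
    have "X y \<inter> set p \<noteq> {}" using that(2) unfolding R_def by (auto simp: card_gt_0_iff)
    then have "\<exists>i. i < length p \<and> p ! i \<in> X y" by (auto simp: in_set_conv_nth)
    then show 1: "t p y < length p" "p ! t p y \<in> X y"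
      unfolding t_def by (metis (mono_tags, lifting) LeastI_ex)+
    have "x \<in> insert (p ! t p y) (X y \<inter> set (drop (Suc (t p y)) p))" if x: "x \<in> X y \<inter> set p" for x
    proof -
      obtain i where i: "i < length p" "x = p ! i" using x by (auto simp: in_set_conv_nth)
      then have "t p y \<le> i" unfolding t_def using x by (intro Least_le) auto
      then have "i = t p y \<or> x \<in> set (drop (Suc (t p y)) p)"
        using i by (auto simp: in_set_conv_nth intro!: exI[of _ "i - Suc (t p y)"])
      then show ?thesis using i x by auto
    qed
    then have "card (X y \<inter> set p) \<le> card (insert (p ! t p y) (X y \<inter> set (drop (Suc (t p y)) p)))"
      by (intro card_mono) auto
    also have "\<dots> \<le> Suc (card (X y \<inter> set (drop (Suc (t p y)) p)))" by (simp add: card_insert_if)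
    finally show "h \<le> card (X y \<inter> set (drop (Suc (t p y)) p))" using that(2) unfolding R_def by simp
  qed
  obtain D e where D: "D \<subseteq> P" "inj_on e D" "\<forall>p\<in>D. R p (e p)"
    and De: "\<forall>p\<in>P. \<forall>y. R p y \<longrightarrow> y \<in> e ` D \<or> p \<in> D \<and> t p (e p) \<le> t p y"
    using serial_dictatorship[OF finP, of R t] by (elim exE conjE)
  have finD: "finite D" using D(1) finP finite_subset by blast
  define c where "c p = take (Suc (t p (e p))) p" for p
  have eQ: "e p \<in> Q" if "p \<in> D" for p using D(3) that unfolding R_def by blast
  have cb: "set (c p) \<subseteq> set (butlast p)" if "p \<in> D" for p
  proof -
    have "p \<in> P" "R p (e p)" using that D by auto
    from t(3)[OF this] h have "drop (Suc (t p (e p))) p \<noteq> []" by auto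
    then have "Suc (t p (e p)) \<le> length p - 1" by simp
    then show ?thesis unfolding c_def butlast_conv_take by (intro set_take_subset_set_take)
  qed
  \<comment> \<open>Old ends are distinct, so at most \<open>card D\<close> paths are given up
    against \<open>card D\<close> redirected ones; at least half of the paths remain.\<close>
  define K where "K = {p \<in> P - D. last p \<notin> e ` D}"
  define f where "f p = (if p \<in> D then c p @ [e p] else p)" for p
  have fset: "set (f p) \<subseteq> (if p \<in> D then insert (e p) (set (butlast p)) else set p)" for p
    using cb by (auto simp: f_def)
  have DK: "D \<union> K \<subseteq> P" "D \<inter> K = {}" using D(1) by (auto simp: K_def)
  have fpath: "path E A B (f p)" if p: "p \<in> D \<union> K" for p
  proof (cases "p \<in> D")
    case True
    then have pP: "p \<in> P" and Rp: "R p (e p)" using D by auto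
    have "c p \<noteq> []" using pp(1)[OF pP] by (simp add: c_def)
    moreover have "last (c p) = p ! t p (e p)"
      using t(1)[OF pP Rp] unfolding c_def by (simp add: take_Suc_conv_app_nth)
    then have "(last (c p), e p) \<in> E" using t(2)[OF pP Rp] X[OF eQ[OF True]] by auto
    moreover have "walk E (c p)"
      using pp(3)[OF pP] append_take_drop_id[of "Suc (t p (e p))" p] unfolding c_def
      by (metis successively_append_iff)
    moreover have "distinct (c p)" "hd (c p) = hd p" using pp(2)[OF pP] by (auto simp: c_def)
    moreover have "e p \<notin> set (c p)" using cb[OF True] bl[OF pP] eQ[OF True] by auto
    ultimately show ?thesis
      using pp(4)[OF pP] eQ[OF True] Q(2) True by (auto simp: path_def f_def walk_append1)
  next
    case False
    then show ?thesis using linkage_path[OF P] DK that by (auto simp: f_def)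
  qed
  have disj: "p = q" if p: "p \<in> D \<union> K" and q: "q \<in> D \<union> K" and v: "v \<in> set (f p)" "v \<in> set (f q)" for p q v
  proof -
    have *: "p = q" if "p \<in> D \<union> K" "q \<in> D \<union> K" "p \<in> D" "v = e p" "v \<in> set (f q)" for p q
    proof (cases "q \<in> D")
      case True
      then have "v \<in> set (butlast q) \<or> v = e q" using fset[of q] that(5) by auto
      moreover have "v \<notin> set (butlast q)" using bl[of q] True D(1) eQ[OF that(3)] that(4) by auto
      ultimately show ?thesis using D(2) that True by (auto dest: inj_onD)
    next
      case False
      then have qK: "q \<in> K" "v \<in> set q" using that by (auto simp: f_def)
      have "q \<noteq> []" using qK by auto
      then have "v \<in> set (butlast q) \<or> v = last q" using qK(2)
        by (metis append_butlast_last_id rotate1.simps(2) set_ConsD set_rotate1)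
      moreover have "v \<notin> set (butlast q)" using bl[of q] qK DK eQ[OF that(3)] that(4) by auto
      moreover have "v \<in> e ` D" using that(3,4) by simp
      ultimately show ?thesis using qK(1) by (auto simp: K_def)
    qed
    show ?thesis
    proof (cases "p \<in> D \<and> v = e p \<or> q \<in> D \<and> v = e q")
      case True
      then show ?thesis using *[OF p q] *[OF q p] v by blast
    next
      case False
      then have "v \<in> set p" "v \<in> set q" using fset[of p] fset[of q] v
        by (auto split: if_splits dest: in_set_butlastD)
      then show ?thesis using linkage_disjoint[OF P] p q DK by blast
    qed
  qed
  have inj: "inj_on f (D \<union> K)"
  proof (rule inj_onI)
    fix p q assume pq: "p \<in> D \<union> K" "q \<in> D \<union> K" "f p = f q"
    have "f p \<noteq> []" using fpath[OF pq(1)] by (simp add: path_def)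
    then show "p = q" using disj[OF pq(1,2), of "hd (f p)"] pq(3) by (metis hd_in_set)
  qed
  have "linkage E A B (f ` (D \<union> K))"
    unfolding linkage_def
  proof (intro conjI ballI impI)
    show "finite (f ` (D \<union> K))" using DK(1) finP finite_subset by blast
    show "path E A B p" if "p \<in> f ` (D \<union> K)" for p using that fpath by auto
    show "set p \<inter> set q = {}" if "p \<in> f ` (D \<union> K)" "q \<in> f ` (D \<union> K)" "p \<noteq> q" for p q
      using that disj by blast
  qed
  moreover have "m \<le> 2 * card (f ` (D \<union> K))"
  proof -
    have fins: "finite K" using DK(1) finP finite_subset by blast
    have injl: "inj_on last P"
      by (rule inj_onI) (metis P pp(1) last_in_set linkage_disjoint)
    have "P - D - K \<subseteq> {p\<in>P. last p \<in> e ` D}" by (auto simp: K_def)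
    then have "card (P - D - K) \<le> card {p\<in>P. last p \<in> e ` D}" using finP by (intro card_mono) auto
    also have "\<dots> \<le> card (e ` D)"
      using finD by (intro card_inj_on_le[of last]) (auto intro: inj_on_subset[OF injl])
    also have "\<dots> \<le> card D" by (rule card_image_le[OF finD])
    finally have "card (P - D - K) \<le> card D" .
    moreover have "card (P - D - K) = m - card D - card K"
    proof -
      have "P - D - K = P - (D \<union> K)" by blast
      then show ?thesis using DK finD fins m by (simp add: card_Diff_subset card_Un_disjoint)
    qed
    moreover have "card (f ` (D \<union> K)) = card D + card K"
      using card_image[OF inj] DK(2) finD fins by (simp add: card_Un_disjoint)
    ultimately show ?thesis by linarith
  qed
  moreover have "e ` D \<subseteq> Q" using eQ by blast
  moreover have "card (e ` D) \<le> m"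
    using card_image_le[OF finD, of e] card_mono[OF finP D(1)] m by linarith
  moreover have "\<Union>(set ` (f ` (D \<union> K))) \<subseteq> \<Union>(set ` P) \<union> e ` D"
  proof
    fix v assume "v \<in> \<Union>(set ` (f ` (D \<union> K)))"
    then obtain p where p: "p \<in> D \<union> K" "v \<in> set (f p)" by blast
    then have "v \<in> set p \<or> v \<in> e ` D"
      using fset[of p] by (cases "p \<in> D") (auto dest: in_set_butlastD)
    then show "v \<in> \<Union>(set ` P) \<union> e ` D" using p DK(1) by blast
  qed
  moreover have "\<forall>y\<in>Q. h \<le> card (X y - \<Union>(set ` (f ` (D \<union> K)))) + m"
  proof
    fix y assume y: "y \<in> Q"
    let ?F = "\<Union>(set ` (f ` (D \<union> K)))"
    have cY: "card (e ` D) \<le> m" by fact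
    have fX: "finite (X y)" using X[OF y] by blast
    \<comment> \<open>If no path meets \<open>X y\<close> in more than \<open>h\<close> vertices,
      the \<open>m\<close> paths leave at least \<open>h\<close> of its \<open>(m + 1) * h\<close>
      vertices untouched. Otherwise some path is cut no later than at its first vertex in
      \<open>X y\<close>, and its vertices behind that one become free. Only the at most
      \<open>m\<close> new ends can occupy such vertices again.\<close>
    have "\<exists>Z. Z \<subseteq> X y \<and> h \<le> card Z \<and> Z \<inter> ?F \<subseteq> e ` D"
    proof (cases "\<exists>p\<in>P. R p y")
      case False
      have "card (X y \<inter> \<Union>(set ` P)) = card (\<Union>p\<in>P. X y \<inter> set p)"
        by (simp only: Int_UN_distrib)
      also have "\<dots> \<le> (\<Sum>p\<in>P. card (X y \<inter> set p))" by (rule card_UN_le[OF finP])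
      also have "\<dots> \<le> (\<Sum>p\<in>P. h)" using False y by (intro sum_mono) (simp add: R_def not_less)
      also have "\<dots> = m * h" using m by simp
      finally have "card (X y \<inter> \<Union>(set ` P)) \<le> m * h" .
      moreover have "card (X y) = card (X y \<inter> \<Union>(set ` P)) + card (X y - \<Union>(set ` P))"
        using fX by (metis card_Int_Diff)
      ultimately have "h \<le> card (X y - \<Union>(set ` P))" using X[OF y] by simp
      moreover have "(X y - \<Union>(set ` P)) \<inter> ?F \<subseteq> e ` D"
        using \<open>?F \<subseteq> \<Union>(set ` P) \<union> e ` D\<close> by blast
      ultimately show ?thesis by blast
    next
      case True
      then obtain p where "p \<in> P" "R p y" by blast
      with De have "y \<in> e ` D \<or> p \<in> D \<and> t p (e p) \<le> t p y" by blast
      then obtain p where p: "p \<in> D" "R p y" "t p (e p) \<le> t p y"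
        using \<open>R p y\<close> D(3) by (metis imageE order_refl)
      have pP: "p \<in> P" using p D(1) by blast
      let ?Z = "X y \<inter> set (drop (Suc (t p y)) p)"
      have "?Z \<inter> ?F \<subseteq> e ` D"
      proof
        fix v assume v: "v \<in> ?Z \<inter> ?F"
        then obtain q where q: "q \<in> D \<union> K" "v \<in> set (f q)" by blast
        have vp: "v \<in> set p" using v by (auto dest: in_set_dropD)
        have "set (drop (Suc (t p y)) p) \<subseteq> set (drop (Suc (t p (e p))) p)"
          using p(3) by (intro set_drop_subset_set_drop) simp
        then have "v \<in> set (drop (Suc (t p (e p))) p)" using v by blast
        then have "v \<notin> set (c p)"
          using set_take_disj_set_drop_if_distinct[OF pp(2)[OF pP], of "Suc (t p (e p))" "Suc (t p (e p))"]
          unfolding c_def by blast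
        show "v \<in> e ` D"
        proof (cases "q = p")
          case True
          then show ?thesis using q(2) p(1) \<open>v \<notin> set (c p)\<close> by (auto simp: f_def)
        next
          case False
          then have "v \<notin> set q" using linkage_disjoint[OF P pP _ vp, of q] q(1) DK by blast
          then show ?thesis using q fset[of q] by (cases "q \<in> D") (auto dest: in_set_butlastD)
        qed
      qed
      then show ?thesis using t(3)[OF pP p(2)] by blast
    qed
    then obtain Z where Z: "Z \<subseteq> X y" "h \<le> card Z" "Z \<inter> ?F \<subseteq> e ` D" by blast
    have "Z \<subseteq> (X y - ?F) \<union> e ` D" using Z by blast
    then have "card Z \<le> card ((X y - ?F) \<union> e ` D)" using fX finD by (intro card_mono) auto
    also have "\<dots> \<le> card (X y - ?F) + card (e ` D)" by (rule card_Un_le)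
    finally show "h \<le> card (X y - ?F) + m" using Z(2) cY by linarith
  qed
  ultimately show thesis by (rule that)
qed

section \<open>Choosing subsets and colourings\<close>

lemma lowest_subset:
  fixes f :: "'a \<Rightarrow> nat"
  assumes "finite W" "a \<le> card W"
  obtains L where "L \<subseteq> W" "card L = a" "\<And>x y. x \<in> L \<Longrightarrow> y \<in> W - L \<Longrightarrow> f x \<le> f y"
proof -
  have "\<exists>L\<subseteq>W. card L = a \<and> (\<forall>x\<in>L. \<forall>y\<in>W - L. f x \<le> f y)" using assms(2)
  proof (induction a)
    case 0
    then show ?case by (intro exI[of _ "{}"]) auto
  next
    case (Suc a)
    then obtain L where L: "L \<subseteq> W" "card L = a" "\<forall>x\<in>L. \<forall>y\<in>W - L. f x \<le> f y" by auto
    have "W - L \<noteq> {}"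
    proof
      assume "W - L = {}"
      then have "W = L" using L(1) by blast
      then show False using L(2) Suc.prems by simp
    qed
    then obtain z0 where "z0 \<in> W - L" by blast
    from ex_has_least_nat[where P = "\<lambda>z. z \<in> W - L" and m = f, OF this]
    obtain z where z: "z \<in> W - L" "\<And>y. y \<in> W - L \<Longrightarrow> f z \<le> f y" by blast
    have "finite L" using L(1) assms(1) finite_subset by blast
    then show ?case using L z by (intro exI[of _ "insert z L"]) auto
  qed
  then show thesis using that by blast
qed

text \<open>Comparing \<open>f x\<close> with \<open>f y\<close> over all pairs from
  \<open>L\<close> and \<open>W - L\<close> shows that the average over \<open>L\<close> is at most
  the average over \<open>W\<close>.\<close>

lemma lowest_subset_average:
  fixes f :: "'a \<Rightarrow> nat"
  assumes W: "finite W" "L \<subseteq> W" and low: "\<And>x y. x \<in> L \<Longrightarrow> y \<in> W - L \<Longrightarrow> f x \<le> f y"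
  shows "sum f L * card W \<le> card L * sum f W"
proof -
  have fin: "finite L" "finite (W - L)" using W finite_subset by auto
  have "sum f L * card (W - L) = (\<Sum>x\<in>L. \<Sum>y\<in>W - L. f x)"
    by (simp add: sum_distrib_right mult.commute)
  also have "\<dots> \<le> (\<Sum>x\<in>L. \<Sum>y\<in>W - L. f y)" using low by (intro sum_mono) auto
  also have "\<dots> = card L * sum f (W - L)" by simp
  finally have "sum f L * card (W - L) \<le> card L * sum f (W - L)" .
  moreover have "card W = card L + card (W - L)" "sum f W = sum f L + sum f (W - L)"
    using W fin by (auto simp: card_Diff_subset card_mono sum.subset_diff[of L W])
  ultimately show ?thesis by (simp add: algebra_simps)
qed

text \<open>Greedy choice: the sets chosen so far occupy at most \<open>(card I - 1) * r\<close>
  elements.\<close>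

lemma disjoint_subsets:
  fixes C :: "'i \<Rightarrow> 'a set"
  assumes "finite I" "\<And>i. i \<in> I \<Longrightarrow> finite (C i) \<and> card I * r \<le> card (C i)"
  obtains R where "\<forall>i\<in>I. R i \<subseteq> C i \<and> card (R i) = r"
    "\<forall>i\<in>I. \<forall>j\<in>I. i \<noteq> j \<longrightarrow> R i \<inter> R j = {}"
proof -
  have "\<exists>R. (\<forall>i\<in>J. R i \<subseteq> C i \<and> card (R i) = r) \<and> (\<forall>i\<in>J. \<forall>j\<in>J. i \<noteq> j \<longrightarrow> R i \<inter> R j = {})"
    if "J \<subseteq> I" for J
    using finite_subset[OF that assms(1)] that
  proof (induction J)
    case empty
    show ?case by simp
  next
    case (insert j J)
    then obtain R where R: "\<forall>i\<in>J. R i \<subseteq> C i \<and> card (R i) = r" "\<forall>i\<in>J. \<forall>j\<in>J. i \<noteq> j \<longrightarrow> R i \<inter> R j = {}"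
      by auto
    have "card (\<Union>(R ` J)) \<le> card J * r"
      using card_UN_le[OF insert.hyps(1), of R] R(1) by simp
    moreover have "Suc (card J) \<le> card I"
      using insert.hyps insert.prems assms(1) by (metis card_insert_disjoint card_mono)
    then have "card J * r + r \<le> card I * r" by (metis add.commute mult_Suc mult_le_mono1)
    moreover have fU: "finite (\<Union>(R ` J))"
      using insert.hyps(1) insert.prems R(1) assms(2) by (meson finite_UN_I finite_subset insert_subset subsetD)
    moreover have "card (C j) - card (\<Union>(R ` J)) \<le> card (C j - \<Union>(R ` J))" by (rule diff_card_le_card_Diff[OF fU])
    moreover have "card I * r \<le> card (C j)" using assms(2) insert.prems by blast
    ultimately have "r \<le> card (C j - \<Union>(R ` J))" by linarith
    then obtain S where S: "S \<subseteq> C j - \<Union>(R ` J)" "card S = r" by (meson obtain_subset_with_card_n)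
    have ne: "i \<noteq> j" if "i \<in> J" for i using that insert.hyps by blast
    show ?case
    proof (intro exI[of _ "R(j := S)"] conjI ballI impI)
      fix i assume "i \<in> insert j J"
      then show "(R(j := S)) i \<subseteq> C i" "card ((R(j := S)) i) = r" using R S by auto
      fix i' assume "i' \<in> insert j J" "i \<noteq> i'"
      then show "(R(j := S)) i \<inter> (R(j := S)) i' = {}" using R(2) S(1) \<open>i \<in> insert j J\<close>
        by (cases "i = j"; cases "i' = j") auto
    qed
  qed
  from this[OF order_refl] obtain R where R: "\<forall>i\<in>I. R i \<subseteq> C i \<and> card (R i) = r"
    "\<forall>i\<in>I. \<forall>j\<in>I. i \<noteq> j \<longrightarrow> R i \<inter> R j = {}" by (elim exE conjE)
  show thesis by (rule that[OF R])
qed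

lemma distinct_representatives:
  assumes "finite I" "\<And>i. i \<in> I \<Longrightarrow> finite (C i) \<and> card I \<le> card (C i)"
  obtains f where "\<And>i. i \<in> I \<Longrightarrow> f i \<in> C i" "inj_on f I"
proof -
  obtain R where R: "\<forall>i\<in>I. R i \<subseteq> C i \<and> card (R i) = 1"
    "\<forall>i\<in>I. \<forall>j\<in>I. i \<noteq> j \<longrightarrow> R i \<inter> R j = {}"
    using disjoint_subsets[OF assms(1), of C 1] assms(2) by auto
  have "\<forall>i\<in>I. \<exists>x. R i = {x}" using R(1) card_1_singletonE by metis
  then obtain f where f: "\<And>i. i \<in> I \<Longrightarrow> R i = {f i}" unfolding bchoice_iff by blast
  show thesis
  proof (rule that[of f])
    show "f i \<in> C i" if "i \<in> I" for i using bspec[OF R(1) that] f[OF that] by simp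
    show "inj_on f I" using R(2) f by (fastforce simp: inj_on_def)
  qed
qed

lemma two_disjoint_supersets:
  assumes "finite V" "W1 \<subseteq> V" "W2 \<subseteq> V" "W1 \<inter> W2 = {}" "card W1 \<le> n1" "card W2 \<le> n2" "n1 + n2 \<le> card V"
  obtains V1 V2 where "W1 \<subseteq> V1" "W2 \<subseteq> V2" "V1 \<subseteq> V" "V2 \<subseteq> V" "V1 \<inter> V2 = {}" "card V1 = n1" "card V2 = n2"
proof -
  have fin: "finite W1" "finite W2"
    using finite_subset[OF assms(2,1)] finite_subset[OF assms(3,1)] by auto
  have c: "card (V - W1 - W2) = card V - card W1 - card W2"
  proof -
    have "W2 \<subseteq> V - W1" using assms(3,4) by blast
    then show ?thesis using fin assms(2) by (simp add: card_Diff_subset)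
  qed
  have "n1 - card W1 \<le> card (V - W1 - W2)" unfolding c using assms(5-7) by linarith
  then obtain A where A: "A \<subseteq> V - W1 - W2" "card A = n1 - card W1" by (meson obtain_subset_with_card_n)
  have fA: "finite A" using A assms(1) finite_subset by (metis finite_Diff)
  have "card (V - W1 - W2 - A) = card V - card W1 - card W2 - (n1 - card W1)"
    using A c fA by (simp add: card_Diff_subset)
  then have "n2 - card W2 \<le> card (V - W1 - W2 - A)" using assms(5-7) by linarith
  then obtain B where B: "B \<subseteq> V - W1 - W2 - A" "card B = n2 - card W2" by (meson obtain_subset_with_card_n)
  have fB: "finite B" using B assms(1) finite_subset by (metis finite_Diff)
  show thesis
  proof (rule that[of "W1 \<union> A" "W2 \<union> B"])
    show "card (W1 \<union> A) = n1" using A fA fin assms(5) by (subst card_Un_disjoint) auto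
    show "card (W2 \<union> B) = n2" using B fB fin assms(6) by (subst card_Un_disjoint) auto
  qed (use A B assms in auto)
qed

text \<open>Colour the points one by one, never increasing the expected number of pairs of a block and a colour
  missing in it.\<close>

lemma polychromatic_aux:
  fixes B :: "'i \<Rightarrow> 'a set" and c :: "'i \<Rightarrow> nat" and q :: nat
  defines "r \<equiv> 1 - 1 / real q"
  assumes "finite U" "finite J" "\<And>j. j \<in> J \<Longrightarrow> B j \<subseteq> U \<and> c j < q" "(\<Sum>j\<in>J. r ^ card (B j)) < 1" "q > 0"
  shows "\<exists>f. (\<forall>x. f x < q) \<and> (\<forall>j\<in>J. \<exists>x\<in>B j. f x = c j)"
  using assms(2-)
proof (induction U arbitrary: J B)
  case empty
  then have "real (card J) < 1" by simp
  then have "J = {}" using empty.prems(1) by simp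
  then show ?case using empty.prems by (intro exI[of _ "\<lambda>_. 0"]) auto
next
  case (insert x U)
  \<comment> \<open>An index stands for a block together with a demanded colour; \<open>J' d\<close>
    collects the demands that stay open once \<open>x\<close> has the colour
    \<open>d\<close>.\<close>
  define J' where "J' d = {j\<in>J. \<not> (x \<in> B j \<and> c j = d)}" for d
  have finB: "finite (B j)" if "j \<in> J" for j
    using insert.prems(2)[OF that] insert.hyps(1) by (meson finite.insertI finite_subset)
  have "(\<Sum>d<q. \<Sum>j\<in>J' d. r ^ card (B j - {x})) =
      (\<Sum>d<q. \<Sum>j\<in>J. if x \<in> B j \<and> c j = d then 0 else r ^ card (B j - {x}))"
    unfolding J'_def using insert.prems(1) by (intro sum.cong refl sum.mono_neutral_cong_left) auto
  also have "\<dots> = (\<Sum>j\<in>J. \<Sum>d<q. if x \<in> B j \<and> c j = d then 0 else r ^ card (B j - {x}))"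
    by (rule sum.swap)
  also have "\<dots> = (\<Sum>j\<in>J. real q * r ^ card (B j))"
  proof (rule sum.cong[OF refl])
    fix j assume j: "j \<in> J"
    show "(\<Sum>d<q. if x \<in> B j \<and> c j = d then 0 else r ^ card (B j - {x})) = real q * r ^ card (B j)"
    proof (cases "x \<in> B j")
      case True
      \<comment> \<open>All but one of the \<open>q\<close> colours for \<open>x\<close> leave the
        demand open, and \<open>q - 1 = q * r\<close> makes up for the smaller exponent.\<close>
      have "(\<Sum>d<q. if x \<in> B j \<and> c j = d then 0 else r ^ card (B j - {x})) =
        (\<Sum>d\<in>{..<q} - {c j}. r ^ card (B j - {x}))"
        using True by (intro sum.mono_neutral_cong_right) auto
      also have "\<dots> = real (q - 1) * r ^ card (B j - {x})"
        using insert.prems(2)[OF j] by simp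
      also have "real (q - 1) = real q * r" using insert.prems(4) by (simp add: r_def field_simps of_nat_diff)
      also have "real q * r * r ^ card (B j - {x}) = real q * r ^ card (B j)"
        using card_Suc_Diff1[OF finB[OF j] True] by (metis mult.assoc power_Suc)
      finally show ?thesis .
    next
      case False
      then show ?thesis by simp
    qed
  qed
  also have "\<dots> = real q * (\<Sum>j\<in>J. r ^ card (B j))" by (simp add: sum_distrib_left)
  also have "\<dots> < real q * 1" using insert.prems(3,4) by (intro mult_strict_left_mono) auto
  finally have "(\<Sum>d<q. \<Sum>j\<in>J' d. r ^ card (B j - {x})) < (\<Sum>d<q. 1)" by simp
  then obtain d where d: "d < q" "(\<Sum>j\<in>J' d. r ^ card (B j - {x})) < 1"
    by (meson lessThan_iff not_le sum_mono)
  have "finite (J' d)" unfolding J'_def using insert.prems(1) by simp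
  moreover have "B j - {x} \<subseteq> U \<and> c j < q" if "j \<in> J' d" for j
    using insert.prems(2)[of j] that unfolding J'_def by auto
  ultimately obtain f where f: "\<forall>x. f x < q" "\<forall>j\<in>J' d. \<exists>y\<in>B j - {x}. f y = c j"
    using insert.IH[of "J' d" "\<lambda>j. B j - {x}"] d(2) insert.prems(4) by auto
  show ?case
  proof (intro exI[of _ "f(x := d)"] conjI allI ballI)
    show "(f(x := d)) y < q" for y using f(1) d(1) by simp
    show "\<exists>y\<in>B j. (f(x := d)) y = c j" if j: "j \<in> J" for j
    proof (cases "j \<in> J' d")
      case True
      then obtain y where "y \<in> B j - {x}" "f y = c j" using f(2) by blast
      then show ?thesis by (intro bexI[of _ y]) auto
    next
      case False
      then have "x \<in> B j" "c j = d" using j unfolding J'_def by auto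
      then show ?thesis by (intro bexI[of _ x]) auto
    qed
  qed
qed

lemma polychromatic:
  fixes B :: "'i \<Rightarrow> 'a set" and q :: nat
  assumes "finite U" "finite I" "\<And>i. i \<in> I \<Longrightarrow> B i \<subseteq> U" "q > 0"
    and "real q * (\<Sum>i\<in>I. (1 - 1 / real q) ^ card (B i)) < 1"
  shows "\<exists>f. (\<forall>x. f x < q) \<and> (\<forall>i\<in>I. \<forall>d<q. \<exists>x\<in>B i. f x = d)"
proof -
  have "(\<Sum>j\<in>I \<times> {..<q}. (1 - 1 / real q) ^ card (B (fst j))) = real q * (\<Sum>i\<in>I. (1 - 1 / real q) ^ card (B i))"
    by (simp add: sum.cartesian_product' sum_distrib_left)
  then have "\<exists>f. (\<forall>x. f x < q) \<and> (\<forall>j\<in>I \<times> {..<q}. \<exists>x\<in>B (fst j). f x = snd j)"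
    using assms(1,2,4,5) by (intro polychromatic_aux[of U]) (use assms(3) in \<open>auto simp: subset_iff\<close>)
  then show ?thesis by (simp add: lessThan_def)
qed

text \<open>Each of \<open>q + 2\<close> colour classes hits all blocks. Among any
  \<open>q + 1\<close> of them one has at most the average size, and after it is set aside there are
  still \<open>q + 1\<close> classes from which to take the second.\<close>

lemma two_hitting_sets:
  fixes B :: "'i \<Rightarrow> 'a set" and q :: nat
  assumes "finite U" "finite I" "\<And>i. i \<in> I \<Longrightarrow> B i \<subseteq> U"
    and "real (q + 2) * (\<Sum>i\<in>I. (1 - 1 / real (q + 2)) ^ card (B i)) < 1"
  obtains F G where "F \<subseteq> U" "G \<subseteq> U" "F \<inter> G = {}" "(q + 1) * card F \<le> card U" "(q + 1) * card G \<le> card U"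
    "\<And>i. i \<in> I \<Longrightarrow> B i \<inter> F \<noteq> {} \<and> B i \<inter> G \<noteq> {}"
proof -
  obtain f where f: "\<forall>x. f x < q + 2" "\<forall>i\<in>I. \<forall>d<q + 2. \<exists>x\<in>B i. f x = d"
    using polychromatic[OF assms(1-3) _ assms(4)] by auto
  define cl where "cl d = {x\<in>U. f x = d}" for d
  have small: "\<exists>d\<in>D. (q + 1) * card (cl d) \<le> card U" if D: "D \<subseteq> {..<q + 2}" "card D = q + 1" for D
  proof (rule ccontr)
    assume "\<not> ?thesis"
    then have "(\<Sum>d\<in>D. card U) < (\<Sum>d\<in>D. (q + 1) * card (cl d))"
      using D finite_subset[OF D(1)] by (intro sum_strict_mono) (auto simp: not_le)
    also have "\<dots> = (q + 1) * (\<Sum>d\<in>D. card (cl d))" by (rule sum_distrib_left[symmetric])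
    also have "(\<Sum>d\<in>D. card (cl d)) = card (\<Union>d\<in>D. cl d)"
      using finite_subset[OF D(1)] assms(1) by (intro card_UN_disjoint[symmetric]) (auto simp: cl_def)
    finally have "(q + 1) * card U < (q + 1) * card (\<Union>d\<in>D. cl d)" using D(2) by simp
    moreover have "card (\<Union>d\<in>D. cl d) \<le> card U" using assms(1) by (intro card_mono) (auto simp: cl_def)
    ultimately show False by (metis mult_le_mono2 not_le)
  qed
  have "\<exists>d\<in>{..<q + 1}. (q + 1) * card (cl d) \<le> card U" by (rule small) auto
  then obtain d where d0: "d \<in> {..<q + 1}" and d2: "(q + 1) * card (cl d) \<le> card U" by (elim bexE)
  then have d: "d < q + 2" by simp
  have "\<exists>e\<in>{..<q + 2} - {d}. (q + 1) * card (cl e) \<le> card U" using d by (intro small) auto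
  then obtain e where e: "e < q + 2" "e \<noteq> d" "(q + 1) * card (cl e) \<le> card U" by auto
  have hit: "B i \<inter> cl a \<noteq> {}" if "i \<in> I" "a < q + 2" for i a
  proof -
    have "\<exists>x\<in>B i. f x = a" using f(2) that by simp
    then obtain x where "x \<in> B i" "f x = a" by (elim bexE)
    then have "x \<in> B i \<inter> cl a" using assms(3)[OF that(1)] unfolding cl_def by auto
    then show ?thesis by blast
  qed
  show thesis
  proof (rule that[of "cl d" "cl e"])
    show "cl d \<subseteq> U" "cl e \<subseteq> U" "cl d \<inter> cl e = {}" using e(2) by (auto simp: cl_def)
    show "(q + 1) * card (cl d) \<le> card U" "(q + 1) * card (cl e) \<le> card U" by (fact d2, fact e(3))
    show "B i \<inter> cl d \<noteq> {} \<and> B i \<inter> cl e \<noteq> {}" if "i \<in> I" for i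
      using hit[OF that d] hit[OF that e(1)] by (rule conjI)
  qed
qed

text \<open>Pick \<open>k\<close> disjoint pieces of size \<open>s i\<close> in every
  \<open>X i\<close>; hitting each piece gives \<open>k\<close> different elements.\<close>

lemma two_multiply_hitting_sets:
  fixes X :: "'i \<Rightarrow> 'a set" and q :: nat
  assumes "finite U" "finite I" and X: "\<And>i. i \<in> I \<Longrightarrow> X i \<subseteq> U \<and> k * s i \<le> card (X i)"
    and "real (q + 2) * (\<Sum>i\<in>I. real k * (1 - 1 / real (q + 2)) ^ s i) < 1"
  obtains F G where "F \<subseteq> U" "G \<subseteq> U" "F \<inter> G = {}" "(q + 1) * card F \<le> card U" "(q + 1) * card G \<le> card U"
    "\<forall>i\<in>I. k \<le> card (X i \<inter> F) \<and> k \<le> card (X i \<inter> G)"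
proof -
  have "\<forall>i\<in>I. \<exists>R. (\<forall>j<k. R j \<subseteq> X i \<and> card (R j) = s i) \<and> (\<forall>j<k. \<forall>j'<k. j \<noteq> j' \<longrightarrow> R j \<inter> R j' = {})"
  proof
    fix i assume i: "i \<in> I"
    have "finite (X i)" using X[OF i] assms(1) finite_subset by blast
    then show "\<exists>R. (\<forall>j<k. R j \<subseteq> X i \<and> card (R j) = s i) \<and> (\<forall>j<k. \<forall>j'<k. j \<noteq> j' \<longrightarrow> R j \<inter> R j' = {})"
      using disjoint_subsets[of "{..<k}" "\<lambda>_. X i" "s i"] X[OF i] by (metis card_lessThan finite_lessThan lessThan_iff)
  qed
  then obtain R where R: "\<And>i j. i \<in> I \<Longrightarrow> j < k \<Longrightarrow> R i j \<subseteq> X i \<and> card (R i j) = s i"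
    "\<And>i j j'. i \<in> I \<Longrightarrow> j < k \<Longrightarrow> j' < k \<Longrightarrow> j \<noteq> j' \<Longrightarrow> R i j \<inter> R i j' = {}"
    unfolding bchoice_iff by metis
  have "(\<Sum>p\<in>I \<times> {..<k}. (1 - 1 / real (q + 2)) ^ card (R (fst p) (snd p))) =
      (\<Sum>p\<in>I \<times> {..<k}. (1 - 1 / real (q + 2)) ^ s (fst p))"
    using R(1) by (intro sum.cong) auto
  also have "\<dots> = (\<Sum>i\<in>I. real k * (1 - 1 / real (q + 2)) ^ s i)"
    by (simp add: sum.cartesian_product')
  finally have w: "real (q + 2) * (\<Sum>p\<in>I \<times> {..<k}. (1 - 1 / real (q + 2)) ^ card (R (fst p) (snd p))) < 1"
    using assms(4) by simp
  have sub: "R (fst p) (snd p) \<subseteq> U" if "p \<in> I \<times> {..<k}" for p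
  proof -
    have "fst p \<in> I" "snd p < k" using that by auto
    then show ?thesis using R(1)[of "fst p" "snd p"] X[of "fst p"] by blast
  qed
  obtain F G where FG: "F \<subseteq> U" "G \<subseteq> U" "F \<inter> G = {}" "(q + 1) * card F \<le> card U" "(q + 1) * card G \<le> card U"
    "\<And>p. p \<in> I \<times> {..<k} \<Longrightarrow> R (fst p) (snd p) \<inter> F \<noteq> {} \<and> R (fst p) (snd p) \<inter> G \<noteq> {}"
    using two_hitting_sets[OF assms(1) _ sub w] assms(2) by (metis finite_SigmaI finite_lessThan)
  have hit: "k \<le> card (X i \<inter> H)" if i: "i \<in> I" and H: "H \<subseteq> U" "\<And>j. j < k \<Longrightarrow> R i j \<inter> H \<noteq> {}" for i H
  proof -
    have "\<forall>j\<in>{..<k}. \<exists>x. x \<in> R i j \<inter> H" using H(2) by blast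
    then obtain g where g: "\<And>j. j < k \<Longrightarrow> g j \<in> R i j \<inter> H" unfolding bchoice_iff by auto
    have "inj_on g {..<k}" using g R(2)[OF i] by (intro inj_onI) (metis IntD1 disjoint_iff lessThan_iff)
    moreover have "g ` {..<k} \<subseteq> X i \<inter> H" using g R(1)[OF i] by blast
    moreover have "finite (X i \<inter> H)" using H(1) assms(1) finite_subset by blast
    ultimately show ?thesis using card_inj_on_le[of g "{..<k}" "X i \<inter> H"] by simp
  qed
  show thesis
  proof (rule that[OF FG(1-5)], intro ballI)
    fix i assume i: "i \<in> I"
    show "k \<le> card (X i \<inter> F) \<and> k \<le> card (X i \<inter> G)"
      using hit[OF i FG(1)] hit[OF i FG(2)] FG(6)[of "(i, _)"] i by auto
  qed
qed

section \<open>Dominating gadgets\<close>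

text \<open>A vertex counts among its own non-neighbours in \<open>nonadj\<close>, which is exactly
  what the lower bound \<open>n - l\<close> on the number of neighbours yields.\<close>

locale near_semicomplete =
  fixes V :: "'a set" and E :: "('a \<times> 'a) set" and l :: nat
  assumes finV: "finite V" and EV: "E \<subseteq> V \<times> V" and irr: "\<And>v. (v, v) \<notin> E"
    and nonadj: "\<And>v. v \<in> V \<Longrightarrow> card {w \<in> V. (v, w) \<notin> E \<and> (w, v) \<notin> E} \<le> l"
begin

lemma converse: "near_semicomplete V (E\<inverse>) l"
  by standard (use finV EV irr nonadj in \<open>auto simp: conj_commute\<close>)

lemma nonadj_subset:
  assumes "v \<in> V" "W \<subseteq> V" "\<And>w. w \<in> W \<Longrightarrow> (v, w) \<notin> E \<and> (w, v) \<notin> E"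
  shows "card W \<le> l"
  by (rule order_trans[OF card_mono nonadj[OF assms(1)]]) (use assms finV in auto)

text \<open>In- and out-degrees inside \<open>U\<close> have the same sum, so some vertex has at
  least as many out- as in-neighbours there, and it is non-adjacent to at most \<open>l\<close>
  vertices.\<close>

lemma ex_balanced:
  assumes "U \<subseteq> V" "U \<noteq> {}"
  obtains v where "v \<in> U" "2 * card {w \<in> U. (v, w) \<notin> E} \<le> card U + l"
proof -
  have fin: "finite U" using assms finV finite_subset by blast
  have "\<exists>v\<in>U. card {w \<in> U. (w, v) \<in> E} \<le> card {w \<in> U. (v, w) \<in> E}"
  proof (rule ccontr)
    assume "\<not> ?thesis"
    then have "(\<Sum>v\<in>U. card {w \<in> U. (v, w) \<in> E}) < (\<Sum>v\<in>U. card {w \<in> U. (w, v) \<in> E})"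
      using fin assms(2) by (intro sum_strict_mono) (auto simp: not_le)
    moreover have "(\<Sum>v\<in>U. card {w \<in> U. (v, w) \<in> E}) = (\<Sum>v\<in>U. \<Sum>w\<in>U. if (v, w) \<in> E then 1 else 0)"
      using fin by (simp add: sum.If_cases Int_def)
    moreover have "(\<Sum>v\<in>U. card {w \<in> U. (w, v) \<in> E}) = (\<Sum>v\<in>U. \<Sum>w\<in>U. if (w, v) \<in> E then 1 else 0)"
      using fin by (simp add: sum.If_cases Int_def)
    ultimately show False using sum.swap[of "\<lambda>v w. if (v, w) \<in> E then 1 else 0 :: nat" U U] by simp
  qed
  then obtain v where v: "v \<in> U" "card {w \<in> U. (w, v) \<in> E} \<le> card {w \<in> U. (v, w) \<in> E}" by blast
  have "card {w \<in> U. (v, w) \<notin> E} \<le> card ({w \<in> U. (w, v) \<in> E} \<union> {w \<in> U. (v, w) \<notin> E \<and> (w, v) \<notin> E})"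
    using fin by (intro card_mono) auto
  also have "\<dots> \<le> card {w \<in> U. (w, v) \<in> E} + card {w \<in> U. (v, w) \<notin> E \<and> (w, v) \<notin> E}"
    by (rule card_Un_le)
  also have "card {w \<in> U. (v, w) \<notin> E \<and> (w, v) \<notin> E} \<le> l"
    using v(1) assms(1) by (intro nonadj_subset[of v]) auto
  finally have "card {w \<in> U. (v, w) \<notin> E} \<le> card {w \<in> U. (v, w) \<in> E} + l" using v(2) by linarith
  moreover have "card U = card {w \<in> U. (v, w) \<in> E} + card {w \<in> U. (v, w) \<notin> E}"
    using fin by (subst card_Un_disjoint[symmetric]) (auto intro: arg_cong[of _ _ card])
  ultimately show thesis using that[OF v(1)] by linarith
qed

text \<open>The in-neighbour \<open>u\<close> is the fallback for \<open>s\<close> when the halving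
  in \<open>ex_dominating_set\<close> stops early. If a balanced \<open>v\<close> has no
  in-neighbour in \<open>U\<close>, it dominates all but \<open>l\<close> vertices, and a balanced
  vertex of its out-neighbourhood has the in-neighbour \<open>v\<close>.\<close>

lemma ex_dominating:
  assumes U: "U \<subseteq> V" "l < card U"
  obtains v u where "v \<in> U" "u \<in> U" "(u, v) \<in> E" "2 * card {w \<in> U. (v, w) \<notin> E} \<le> card U + 2 * l"
proof -
  have fin: "finite U" using U finV finite_subset by blast
  have "U \<noteq> {}" using U by auto
  from ex_balanced[OF U(1) this] obtain v where v: "v \<in> U" "2 * card {w \<in> U. (v, w) \<notin> E} \<le> card U + l" .
  show thesis
  proof (cases "\<exists>u\<in>U. (u, v) \<in> E")
    case True
    then obtain u where "u \<in> U" "(u, v) \<in> E" by blast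
    then show thesis using that[of v u] v by linarith
  next
    case False
    define U' where "U' = {w \<in> U. (v, w) \<in> E}"
    have rest: "card {w \<in> U. (v, w) \<notin> E} \<le> l"
      using v(1) U(1) False by (intro nonadj_subset[of v]) auto
    have split: "card U = card U' + card {w \<in> U. (v, w) \<notin> E}"
      unfolding U'_def using fin by (subst card_Un_disjoint[symmetric]) (auto intro: arg_cong[of _ _ card])
    then have "U' \<noteq> {}" using rest U(2) by auto
    moreover have "U' \<subseteq> V" using U(1) by (auto simp: U'_def)
    ultimately obtain u where u: "u \<in> U'" "2 * card {w \<in> U'. (u, w) \<notin> E} \<le> card U' + l"
      using ex_balanced by metis
    have "card {w \<in> U. (u, w) \<notin> E} \<le> card ({w \<in> U'. (u, w) \<notin> E} \<union> {w \<in> U. (v, w) \<notin> E})"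
      using fin by (intro card_mono) (auto simp: U'_def)
    also have "\<dots> \<le> card {w \<in> U'. (u, w) \<notin> E} + card {w \<in> U. (v, w) \<notin> E}" by (rule card_Un_le)
    finally have "2 * card {w \<in> U. (u, w) \<notin> E} \<le> card U + 2 * l" using u(2) split rest by linarith
    then show thesis using that[of u v] u(1) v(1) by (auto simp: U'_def)
  qed
qed

text \<open>Halve the undominated part repeatedly, staying inside the common in-neighbourhood of the vertices
  chosen so far, so that a vertex dominating all of them remains.\<close>

lemma ex_dominating_set:
  assumes "U \<subseteq> V" "U \<noteq> {}"
  shows "\<exists>s B. s \<in> U \<and> B \<subseteq> U \<and> s \<notin> B \<and> card B \<le> j \<and> (\<forall>b\<in>B. (s, b) \<in> E) \<and>
    2 ^ j * card {w \<in> U. \<forall>b\<in>B. (b, w) \<notin> E} \<le> card U + 2 ^ j * (2 * l * (j + 1))"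
  using assms
proof (induction j arbitrary: U)
  case 0
  then show ?case by (auto intro!: exI[of _ "{}"])
next
  case (Suc j)
  have fin: "finite U" using Suc.prems finV finite_subset by blast
  show ?case
  proof (cases "card U \<le> l")
    case True
    \<comment> \<open>The additive term already covers all of \<open>U\<close>, so
      \<open>B = {}\<close> will do.\<close>
    then have "card U \<le> 2 * l * (Suc j + 1)" by simp
    then have "2 ^ Suc j * card U \<le> 2 ^ Suc j * (2 * l * (Suc j + 1))" by (rule mult_le_mono2)
    moreover obtain s where "s \<in> U" using Suc.prems(2) by blast
    ultimately show ?thesis by (intro exI[of _ s] exI[of _ "{}"]) (simp add: trans_le_add2)
  next
    case False
    then have "l < card U" by simp
    from ex_dominating[OF Suc.prems(1) this] obtain v u
      where v: "v \<in> U" "u \<in> U" "(u, v) \<in> E" "2 * card {w \<in> U. (v, w) \<notin> E} \<le> card U + 2 * l" .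
    define U' where "U' = {w \<in> U. (w, v) \<in> E \<and> (v, w) \<notin> E}"
    define A where "A = {w \<in> U. (w, v) \<notin> E \<and> (v, w) \<notin> E}"
    have A: "card A \<le> l" unfolding A_def using v(1) Suc.prems(1) by (intro nonadj_subset[of v]) auto
    have finA: "finite A" "finite U'" using fin by (auto simp: A_def U'_def)
    show ?thesis
    proof (cases "U' = {}")
      case True
      \<comment> \<open>No vertex is left to continue with; the in-neighbour \<open>u\<close> takes
        the role of \<open>s\<close>.\<close>
      then have "{w \<in> U. \<forall>b\<in>{v}. (b, w) \<notin> E} = A" by (auto simp: U'_def A_def)
      moreover have "2 ^ Suc j * card A \<le> 2 ^ Suc j * (2 * l * (Suc j + 1))"
        using A by (intro mult_le_mono2) simp
      ultimately show ?thesis using v irr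
        by (intro exI[of _ u] exI[of _ "{v}"]) (auto simp: trans_le_add2)
    next
      case False
      have U': "U' \<subseteq> V" using Suc.prems(1) by (auto simp: U'_def)
      obtain s B where s: "s \<in> U'" "B \<subseteq> U'" "s \<notin> B" "card B \<le> j" "\<forall>b\<in>B. (s, b) \<in> E"
        and und: "2 ^ j * card {w \<in> U'. \<forall>b\<in>B. (b, w) \<notin> E} \<le> card U' + 2 ^ j * (2 * l * (j + 1))"
        using Suc.IH[OF U' False] by (elim exE conjE)
      have "card {w \<in> U. \<forall>b\<in>insert v B. (b, w) \<notin> E} \<le> card (A \<union> {w \<in> U'. \<forall>b\<in>B. (b, w) \<notin> E})"
        using finA by (intro card_mono) (auto simp: A_def U'_def fin)
      also have "\<dots> \<le> card A + card {w \<in> U'. \<forall>b\<in>B. (b, w) \<notin> E}" by (rule card_Un_le)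
      finally have 1: "card {w \<in> U. \<forall>b\<in>insert v B. (b, w) \<notin> E} \<le> l + card {w \<in> U'. \<forall>b\<in>B. (b, w) \<notin> E}"
        using A by linarith
      have "2 * card U' \<le> 2 * card {w \<in> U. (v, w) \<notin> E}"
        using fin by (intro mult_le_mono2 card_mono) (auto simp: U'_def)
      then have 2: "2 * card U' \<le> card U + 2 * l" using v(4) by linarith
      have "2 ^ Suc j * card {w \<in> U. \<forall>b\<in>insert v B. (b, w) \<notin> E}
          \<le> 2 ^ Suc j * (l + card {w \<in> U'. \<forall>b\<in>B. (b, w) \<notin> E})" using 1 by (rule mult_le_mono2)
      also have "\<dots> = 2 ^ Suc j * l + 2 * (2 ^ j * card {w \<in> U'. \<forall>b\<in>B. (b, w) \<notin> E})"
        by (simp add: algebra_simps)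
      also have "\<dots> \<le> 2 ^ Suc j * l + (card U + 2 * l + 2 * (2 ^ j * (2 * l * (j + 1))))"
        using und 2 by linarith
      also have "\<dots> \<le> card U + 2 ^ Suc j * (2 * l * (Suc j + 1))"
      proof -
        have "2 * l \<le> 2 ^ Suc j * l" by simp
        then show ?thesis by (simp add: algebra_simps)
      qed
      finally have "2 ^ Suc j * card {w \<in> U. \<forall>b\<in>insert v B. (b, w) \<notin> E} \<le> card U + 2 ^ Suc j * (2 * l * (Suc j + 1))" .
      moreover have "card (insert v B) \<le> Suc j"
        using s(2,4) finA finite_subset[OF s(2)] by (auto simp: card_insert_if)
      moreover have "s \<in> U" "insert v B \<subseteq> U" "s \<notin> insert v B" "\<forall>b\<in>insert v B. (s, b) \<in> E"
        using s v irr by (auto simp: U'_def)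
      ultimately show ?thesis by (intro exI[of _ s] exI[of _ "insert v B"]) simp
    qed
  qed
qed

text \<open>More than \<open>l\<close> vertices always span an arc; pick one, delete both of its
  ends and repeat.\<close>

lemma ex_matching:
  assumes "L \<subseteq> V" "2 * N + l \<le> card L"
  shows "\<exists>M. M \<subseteq> E \<inter> L \<times> L \<and> finite M \<and> card M = N \<and>
    (\<forall>e\<in>M. \<forall>f\<in>M. e \<noteq> f \<longrightarrow> {fst e, snd e} \<inter> {fst f, snd f} = {})"
  using assms
proof (induction N arbitrary: L)
  case 0
  show ?case by (intro exI[of _ "{}"]) simp
next
  case (Suc N)
  have fin: "finite L" using Suc.prems(1) finV finite_subset by blast
  have "\<exists>e\<in>E \<inter> L \<times> L. True"
  proof (rule ccontr)
    assume no: "\<not> ?thesis"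
    have "L \<noteq> {}" using Suc.prems(2) by auto
    then obtain v where "v \<in> L" by blast
    then have "card L \<le> l" using no Suc.prems(1) by (intro nonadj_subset[of v]) auto
    then show False using Suc.prems(2) by simp
  qed
  then obtain u v where e: "(u, v) \<in> E" "u \<in> L" "v \<in> L" by auto
  have "u \<noteq> v" using e irr by auto
  then have "card (L - {u, v}) = card L - 2" using e fin by (simp add: card_Diff_subset)
  then have "2 * N + l \<le> card (L - {u, v})" using Suc.prems(2) by simp
  then obtain M where M: "M \<subseteq> E \<inter> (L - {u, v}) \<times> (L - {u, v})" "finite M" "card M = N"
    "\<forall>e\<in>M. \<forall>f\<in>M. e \<noteq> f \<longrightarrow> {fst e, snd e} \<inter> {fst f, snd f} = {}"
    using Suc.IH[of "L - {u, v}"] Suc.prems(1) by auto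
  have new: "(u, v) \<notin> M" using M(1) by auto
  have d: "{u, v} \<inter> {fst f, snd f} = {}" if "f \<in> M" for f using M(1) that by auto
  show ?case
  proof (intro exI[of _ "insert (u, v) M"] conjI ballI impI)
    show "insert (u, v) M \<subseteq> E \<inter> L \<times> L" using M(1) e by auto
    show "card (insert (u, v) M) = Suc N" using M new by simp
    show "finite (insert (u, v) M)" using M by simp
    fix e f assume ef: "e \<in> insert (u, v) M" "f \<in> insert (u, v) M" "e \<noteq> f"
    show "{fst e, snd e} \<inter> {fst f, snd f} = {}"
    proof (cases "e = (u, v)")
      case True
      then show ?thesis using d[of f] ef by auto
    next
      case False
      then have "e \<in> M" using ef by blast
      then show ?thesis using d[of e] M(4) ef by (cases "f = (u, v)") auto
    qed
  qed
qed

end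

text \<open>The source \<open>s\<close> reaches \<open>B\<close> directly and \<open>B'\<close> through \<open>B\<close>; all but few vertices are dominated by both
  \<open>B\<close> and \<open>B'\<close>. Colouring \<open>s\<close> and \<open>B'\<close> alike and \<open>B\<close> differently, \<open>s\<close> reaches these vertices by alternating
  paths whatever their colour.\<close>

definition gadget :: "('a \<times> 'a) set \<Rightarrow> 'a \<Rightarrow> 'a set \<Rightarrow> 'a set \<Rightarrow> bool" where
  "gadget E s B B' \<longleftrightarrow> s \<notin> B \<union> B' \<and> B \<inter> B' = {} \<and> (\<forall>b\<in>B. (s, b) \<in> E) \<and> (\<forall>b'\<in>B'. \<exists>b\<in>B. (b, b') \<in> E)"

definition exceptional :: "('a \<times> 'a) set \<Rightarrow> 'a set \<Rightarrow> 'a set \<Rightarrow> 'a set \<Rightarrow> 'a set" where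
  "exceptional E W B B' = {w \<in> W. (\<forall>b\<in>B. (b, w) \<notin> E) \<or> (\<forall>b\<in>B'. (b, w) \<notin> E)}"

section \<open>Building gadgets from arcs between vertices of low in-degree\<close>

context near_semicomplete
begin

text \<open>Apart from at most \<open>l\<close> non-neighbours, a vertex missed by \<open>b\<close>
  is an in-neighbour of \<open>b\<close>. Hence \<open>B\<close> has to care only for the
  in-neighbourhood of \<open>b\<close>, which is where a low in-degree pays off.\<close>

lemma undominated_insert:
  assumes "b \<in> V" "W \<subseteq> V"
  shows "card {w \<in> W. \<forall>x\<in>insert b B. (x, w) \<notin> E} \<le> l + card {w \<in> E\<inverse> `` {b} \<inter> W. \<forall>x\<in>B. (x, w) \<notin> E}"
proof -
  have fin: "finite W" using assms finV finite_subset by blast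
  have "card {w \<in> W. \<forall>x\<in>insert b B. (x, w) \<notin> E} \<le>
      card ({w \<in> W. (b, w) \<notin> E \<and> (w, b) \<notin> E} \<union> {w \<in> E\<inverse> `` {b} \<inter> W. \<forall>x\<in>B. (x, w) \<notin> E})"
    using fin by (intro card_mono) auto
  also have "\<dots> \<le> card {w \<in> W. (b, w) \<notin> E \<and> (w, b) \<notin> E} + card {w \<in> E\<inverse> `` {b} \<inter> W. \<forall>x\<in>B. (x, w) \<notin> E}"
    by (rule card_Un_le)
  also have "card {w \<in> W. (b, w) \<notin> E \<and> (w, b) \<notin> E} \<le> l"
    using assms by (intro nonadj_subset[of b]) auto
  finally show ?thesis by linarith
qed

text \<open>\<open>B\<close> consists of \<open>b\<close> and a set dominating most of its
  in-neighbourhood, with a common in-neighbour \<open>s\<close>; \<open>B'\<close> arises likewise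
  from \<open>b'\<close>. Each of them misses at most \<open>\<delta> / 2 ^ c\<close> vertices, up
  to a multiple of \<open>l * (c + 1)\<close>.\<close>

lemma ex_gadget:
  assumes F: "F \<subseteq> V" "b \<in> F" "b' \<in> F" "(b, b') \<in> E"
    and d: "card (E\<inverse> `` {b}) \<le> \<delta>" "card (E\<inverse> `` {b'}) \<le> \<delta>" "card F < card (E\<inverse> `` {b})"
  shows "\<exists>s B B'. s \<in> V - F \<and> B \<subseteq> V \<and> B' \<subseteq> V \<and> B \<inter> F = {b} \<and> B' \<inter> F = {b'} \<and> gadget E s B B' \<and>
    card (insert s (B \<union> B') - F) \<le> 2 * c + 1 \<and>
    2 ^ c * card (exceptional E (V - F - insert s (B \<union> B')) B B') \<le> 2 * \<delta> + 2 ^ c * (6 * l * (c + 1))"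
proof -
  have inV: "E\<inverse> `` {v} \<subseteq> V" for v using EV by auto
  have finin: "finite (E\<inverse> `` {v})" for v using inV finV finite_subset by blast
  have finF: "finite F" using F(1) finV finite_subset by blast
  have bV: "b \<in> V" "b' \<in> V" using F by auto
  define U where "U = E\<inverse> `` {b} - F"
  have Une: "U \<noteq> {}" using d(3) card_mono[OF finF, of "E\<inverse> `` {b}"] unfolding U_def by auto
  have UV: "U \<subseteq> V" using inV unfolding U_def by blast
  obtain s B where s: "s \<in> U" "B \<subseteq> U" "s \<notin> B" "card B \<le> c" "\<forall>x\<in>B. (s, x) \<in> E"
    and und: "2 ^ c * card {w \<in> U. \<forall>x\<in>B. (x, w) \<notin> E} \<le> card U + 2 ^ c * (2 * l * (c + 1))"
    using ex_dominating_set[OF UV Une, of c] by (elim exE conjE)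
  have "card U \<le> \<delta>" using card_mono[OF finin, of U b] d(1) unfolding U_def by auto
  define X where "X = {w \<in> V - F. \<forall>x\<in>insert b B. (x, w) \<notin> E}"
  have "E\<inverse> `` {b} \<inter> (V - F) = U" using inV unfolding U_def by blast
  then have "card X \<le> l + card {w \<in> U. \<forall>x\<in>B. (x, w) \<notin> E}"
    using undominated_insert[OF bV(1), of "V - F" B] unfolding X_def by simp
  then have "2 ^ c * card X \<le> 2 ^ c * (l + card {w \<in> U. \<forall>x\<in>B. (x, w) \<notin> E})" by (rule mult_le_mono2)
  then have X: "2 ^ c * card X \<le> \<delta> + 2 ^ c * (3 * l * (c + 1))"
    using und \<open>card U \<le> \<delta>\<close> by (simp add: algebra_simps)
  \<comment> \<open>Keeping \<open>B'\<close> away from \<open>X\<close>, the vertices missed by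
    \<open>B\<close>, ensures that every vertex of \<open>B'\<close> has an in-neighbour in
    \<open>B\<close>; for \<open>b'\<close> this is the given arc.\<close>
  define F' where "F' = F \<union> B \<union> {s} \<union> X"
  define U' where "U' = E\<inverse> `` {b'} - F'"
  have U'V: "U' \<subseteq> V" using inV unfolding U'_def by blast
  have "\<exists>B'. B' \<subseteq> U' \<and> card B' \<le> c \<and>
    2 ^ c * card {w \<in> U'. \<forall>x\<in>B'. (x, w) \<notin> E} \<le> card U' + 2 ^ c * (2 * l * (c + 1))"
  proof (cases "U' = {}")
    case False
    then show ?thesis using ex_dominating_set[OF U'V False, of c] by (elim exE conjE) (intro exI conjI)
  qed (auto intro!: exI[of _ "{}"])
  then obtain B' where B': "B' \<subseteq> U'" "card B' \<le> c"
    and und': "2 ^ c * card {w \<in> U'. \<forall>x\<in>B'. (x, w) \<notin> E} \<le> card U' + 2 ^ c * (2 * l * (c + 1))"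
    by (elim exE conjE)
  have "card U' \<le> \<delta>" using card_mono[OF finin, of U' b'] d(2) unfolding U'_def by auto
  define X' where "X' = {w \<in> V - F'. \<forall>x\<in>insert b' B'. (x, w) \<notin> E}"
  have "E\<inverse> `` {b'} \<inter> (V - F') = U'" using inV unfolding U'_def by blast
  then have "card X' \<le> l + card {w \<in> U'. \<forall>x\<in>B'. (x, w) \<notin> E}"
    using undominated_insert[OF bV(2), of "V - F'" B'] unfolding X'_def by simp
  then have "2 ^ c * card X' \<le> 2 ^ c * (l + card {w \<in> U'. \<forall>x\<in>B'. (x, w) \<notin> E})" by (rule mult_le_mono2)
  then have X': "2 ^ c * card X' \<le> \<delta> + 2 ^ c * (3 * l * (c + 1))"
    using und' \<open>card U' \<le> \<delta>\<close> by (simp add: algebra_simps)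
  have fin: "finite X" "finite X'" "finite B" "finite B'"
    using finV finite_subset[OF B'(1)] finite_subset[OF s(2)] finin
    unfolding X_def X'_def U_def U'_def by auto
  have bb: "b \<noteq> b'" using F(4) irr by auto
  show ?thesis
  proof (rule exI[of _ s], rule exI[of _ "insert b B"], rule exI[of _ "insert b' B'"], intro conjI)
    show "s \<in> V - F" using s(1) UV unfolding U_def by auto
    show "insert b B \<subseteq> V" "insert b' B' \<subseteq> V" using bV s(2) UV B'(1) U'V by auto
    show "insert b B \<inter> F = {b}" "insert b' B' \<inter> F = {b'}"
      using F s(2) B'(1) unfolding U_def U'_def F'_def by auto
    have "\<exists>y\<in>insert b B. (y, x) \<in> E" if "x \<in> insert b' B'" for x
    proof (cases "x = b'")
      case True
      then show ?thesis using F(4) by auto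
    next
      case False
      then have "x \<in> U'" using that B'(1) by auto
      then have "x \<in> V - F" "x \<notin> X" using U'V unfolding U'_def F'_def by auto
      then show ?thesis unfolding X_def by blast
    qed
    moreover have "s \<notin> insert b B \<union> insert b' B'"
      using s B'(1) F(2,3) irr unfolding U_def U'_def F'_def by auto
    moreover have "insert b B \<inter> insert b' B' = {}"
      using bb s(2) B'(1) F(2,3) unfolding U_def U'_def F'_def by auto
    moreover have "\<forall>x\<in>insert b B. (s, x) \<in> E" using s(1,5) unfolding U_def by auto
    ultimately show "gadget E s (insert b B) (insert b' B')" unfolding gadget_def by simp
    have "card (insert s (insert b B \<union> insert b' B') - F) \<le> card (insert s (B \<union> B'))"
      using F fin by (intro card_mono) auto
    also have "\<dots> \<le> Suc (card (B \<union> B'))" using fin by (simp add: card_insert_if)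
    also have "card (B \<union> B') \<le> card B + card B'" by (rule card_Un_le)
    finally show "card (insert s (insert b B \<union> insert b' B') - F) \<le> 2 * c + 1"
      using s(4) B'(2) by linarith
    have "card (exceptional E (V - F - insert s (insert b B \<union> insert b' B')) (insert b B) (insert b' B'))
        \<le> card (X \<union> X')"
      using fin by (intro card_mono) (auto simp: exceptional_def X_def X'_def F'_def)
    also have "\<dots> \<le> card X + card X'" by (rule card_Un_le)
    finally have "2 ^ c * card (exceptional E (V - F - insert s (insert b B \<union> insert b' B')) (insert b B) (insert b' B'))
        \<le> 2 ^ c * (card X + card X')" by (rule mult_le_mono2)
    then show "2 ^ c * card (exceptional E (V - F - insert s (insert b B \<union> insert b' B')) (insert b B) (insert b' B'))
        \<le> 2 * \<delta> + 2 ^ c * (6 * l * (c + 1))"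
      using X X' by (simp add: algebra_simps)
  qed
qed

text \<open>Each gadget is built with \<open>F\<close> and all earlier gadgets forbidden, except for
  its own arc. As the arcs of \<open>M\<close> lie in \<open>F\<close>, no gadget touches the arc of
  another. Exceptional vertices are counted outside \<open>F\<close> and \<open>T\<close>, so their
  number only drops as \<open>T\<close> grows.\<close>

lemma ex_gadgets:
  assumes F: "F \<subseteq> V" and M: "finite M" "M \<subseteq> E \<inter> F \<times> F"
    "\<forall>e\<in>M. \<forall>f\<in>M. e \<noteq> f \<longrightarrow> {fst e, snd e} \<inter> {fst f, snd f} = {}"
    and d: "\<And>e. e \<in> M \<Longrightarrow> card (E\<inverse> `` {fst e}) \<le> \<delta> \<and> card (E\<inverse> `` {snd e}) \<le> \<delta> \<and>
      card F + card M * (2 * c + 1) < card (E\<inverse> `` {fst e})"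
  shows "\<exists>Z B B' T. Z \<subseteq> V - F \<and> card Z = card M \<and> T = (\<Union>z\<in>Z. insert z (B z \<union> B' z)) \<and> T \<subseteq> V \<and>
    T \<inter> F \<subseteq> fst ` M \<union> snd ` M \<and> card (T - F) \<le> card M * (2 * c + 1) \<and>
    (\<forall>z\<in>Z. gadget E z (B z) (B' z) \<and>
      2 ^ c * card (exceptional E (V - F - T) (B z) (B' z)) \<le> 2 * \<delta> + 2 ^ c * (6 * l * (c + 1))) \<and>
    (\<forall>z\<in>Z. \<forall>y\<in>Z. y \<noteq> z \<longrightarrow> insert z (B z \<union> B' z) \<inter> insert y (B y \<union> B' y) = {})"
  using M d
proof (induction M)
  case empty
  show ?case by (intro exI[of _ "{}"]) simp
next
  case (insert e M)
  let ?\<Delta> = "2 * \<delta> + 2 ^ c * (6 * l * (c + 1))"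
  have "card M \<le> card (insert e M)" using insert.hyps by (simp add: card_insert_if)
  then have "card F + card M * (2 * c + 1) < card (E\<inverse> `` {fst f})" if "f \<in> M" for f
    using insert.prems(3)[of f] that insert.hyps by (auto intro: le_less_trans[rotated])
  then obtain Z B B' T where Z: "Z \<subseteq> V - F" "card Z = card M" "T = (\<Union>z\<in>Z. insert z (B z \<union> B' z))" "T \<subseteq> V"
    "T \<inter> F \<subseteq> fst ` M \<union> snd ` M" "card (T - F) \<le> card M * (2 * c + 1)"
    and gad: "\<forall>z\<in>Z. gadget E z (B z) (B' z) \<and> 2 ^ c * card (exceptional E (V - F - T) (B z) (B' z)) \<le> ?\<Delta>"
    and dis: "\<forall>z\<in>Z. \<forall>y\<in>Z. y \<noteq> z \<longrightarrow> insert z (B z \<union> B' z) \<inter> insert y (B y \<union> B' y) = {}"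
    using insert.IH insert.prems by (auto simp del: Un_insert_left Un_insert_right) 
  obtain b b' where e: "e = (b, b')" by (cases e)
  have fin: "finite F" "finite T" "finite Z" using F Z(1,4) finV by (auto intro: finite_subset)
  have "card (F \<union> T) = card F + card (T - F)"
    using fin by (metis Un_Diff_cancel card_Un_disjoint Diff_disjoint finite_Diff)
  also have "\<dots> < card (E\<inverse> `` {b})"
    using Z(6) insert.prems(3)[of e] insert.hyps e by auto
  finally have small: "card (F \<union> T) < card (E\<inverse> `` {b})" .
  have bF: "b \<in> F" "b' \<in> F" "(b, b') \<in> E" using insert.prems(1) e by auto
  have dd: "card (E\<inverse> `` {b}) \<le> \<delta>" "card (E\<inverse> `` {b'}) \<le> \<delta>" using insert.prems(3)[of e] e by auto
  obtain s A A' where s: "s \<in> V - (F \<union> T)" "A \<subseteq> V" "A' \<subseteq> V" "A \<inter> (F \<union> T) = {b}" "A' \<inter> (F \<union> T) = {b'}"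
    "gadget E s A A'" "card (insert s (A \<union> A') - (F \<union> T)) \<le> 2 * c + 1"
    and ex: "2 ^ c * card (exceptional E (V - (F \<union> T) - insert s (A \<union> A')) A A') \<le> ?\<Delta>"
    using ex_gadget[OF Un_least[OF F Z(4)] UnI1[OF bF(1)] UnI1[OF bF(2)] bF(3) dd small, of c]
    by (elim exE conjE)
  have bM: "b \<notin> fst ` M \<union> snd ` M" "b' \<notin> fst ` M \<union> snd ` M"
  proof -
    have "{b, b'} \<inter> {fst f, snd f} = {}" if "f \<in> M" for f
      using insert.prems(2) insert.hyps(2) that e by (metis fst_conv snd_conv insertI1 insertI2)
    then show "b \<notin> fst ` M \<union> snd ` M" "b' \<notin> fst ` M \<union> snd ` M" by auto
  qed
  then have bT: "b \<notin> T" "b' \<notin> T" using Z(5) bF by auto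
  have sZ: "s \<notin> Z" using s(1) Z(3) by auto
  let ?S = "insert s (A \<union> A')"
  have ST: "?S \<inter> T = {}" using s(1,4,5) bT by auto
  let ?B = "B(s := A)" and ?B' = "B'(s := A')" and ?T = "T \<union> ?S"
  have eqB: "?B z = B z" "?B' z = B' z" if "z \<in> Z" for z using that sZ by auto
  have sub: "2 ^ c * card (exceptional E (V - F - ?T) P Q) \<le> 2 ^ c * card (exceptional E W P Q)"
    if "V - F - ?T \<subseteq> W" "W \<subseteq> V" for P Q W
    using that finV by (intro mult_le_mono2 card_mono) (auto simp: exceptional_def intro: finite_subset)
  show ?case
  proof (rule exI[of _ "insert s Z"], rule exI[of _ ?B], rule exI[of _ ?B'], rule exI[of _ ?T], intro conjI)
    show "insert s Z \<subseteq> V - F" using Z(1) s(1) by blast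
    show "card (insert s Z) = card (insert e M)" using Z(2) insert.hyps sZ fin by simp
    show "?T = (\<Union>z\<in>insert s Z. insert z (?B z \<union> ?B' z))"
      using eqB Z(3) by auto
    show "?T \<subseteq> V" using Z(4) s(1-3) by blast
    show "?T \<inter> F \<subseteq> fst ` insert e M \<union> snd ` insert e M" using Z(5) s(1,4,5) e by auto
    have "card (?T - F) \<le> card ((T - F) \<union> (?S - (F \<union> T)))"
      using fin s(2,3) finV by (intro card_mono) (auto intro: finite_subset)
    also have "\<dots> \<le> card (T - F) + card (?S - (F \<union> T))" by (rule card_Un_le)
    finally show "card (?T - F) \<le> card (insert e M) * (2 * c + 1)"
      using Z(6) s(7) insert.hyps by simp
    show "\<forall>z\<in>insert s Z. gadget E z (?B z) (?B' z) \<and>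
       2 ^ c * card (exceptional E (V - F - ?T) (?B z) (?B' z)) \<le> ?\<Delta>"
    proof
      fix z assume z: "z \<in> insert s Z"
      show "gadget E z (?B z) (?B' z) \<and> 2 ^ c * card (exceptional E (V - F - ?T) (?B z) (?B' z)) \<le> ?\<Delta>"
      proof (cases "z = s")
        case True
        have "V - F - ?T \<subseteq> V - (F \<union> T) - ?S" "V - (F \<union> T) - ?S \<subseteq> V" by blast+
        from order_trans[OF sub[OF this] ex] s(6) show ?thesis
          unfolding True by (simp only: fun_upd_same simp_thms)
      next
        case False
        then have zZ: "z \<in> Z" using z by blast
        have "V - F - ?T \<subseteq> V - F - T" "V - F - T \<subseteq> V" by blast+
        from order_trans[OF sub[OF this]] gad zZ show ?thesis
          unfolding eqB[OF zZ] by simp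
      qed
    qed
    show "\<forall>z\<in>insert s Z. \<forall>y\<in>insert s Z. y \<noteq> z \<longrightarrow>
      insert z (?B z \<union> ?B' z) \<inter> insert y (?B y \<union> ?B' y) = {}"
    proof (intro ballI impI)
      fix z y assume zy: "z \<in> insert s Z" "y \<in> insert s Z" "y \<noteq> z"
      have new: "?S \<inter> insert x (B x \<union> B' x) = {}" if "x \<in> Z" for x
      proof -
        have "insert x (B x \<union> B' x) \<subseteq> T" using that unfolding Z(3) by blast
        then show ?thesis using ST by blast
      qed
      consider "z = s" "y \<in> Z" | "y = s" "z \<in> Z" | "z \<in> Z" "y \<in> Z" using zy by blast
      then show "insert z (?B z \<union> ?B' z) \<inter> insert y (?B y \<union> ?B' y) = {}"
      proof cases
        case 1
        then show ?thesis using new[of y] eqB[of y] by (simp only: fun_upd_same)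
      next
        case 2
        then show ?thesis using new[of z] eqB[of z] by (simp only: fun_upd_same Int_commute)
      next
        case 3
        then show ?thesis using dis zy(3) eqB by simp
      qed
    qed
  qed
qed

end

section \<open>Robust reachability and connectors\<close>

definition strong :: "nat \<Rightarrow> 'a set \<Rightarrow> ('a \<times> 'a) set \<Rightarrow> bool" where
  "strong k W H \<longleftrightarrow> k + 1 \<le> card W \<and> (\<forall>S\<subseteq>W. card S < k \<longrightarrow>
     (\<forall>x\<in>W - S. \<forall>y\<in>W - S. (x, y) \<in> (H \<inter> (W - S) \<times> (W - S))\<^sup>*))"

text \<open>The vertices that can be reached, avoiding any fewer than \<open>k\<close> vertices, once those of \<open>U\<close> can be
  reached, no matter whether the arcs have to come from \<open>V1\<close> or from \<open>V2\<close>.\<close>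

inductive_set robust_closure :: "('a \<times> 'a) set \<Rightarrow> nat \<Rightarrow> 'a set \<Rightarrow> 'a set \<Rightarrow> 'a set \<Rightarrow> 'a set"
  for E k V1 V2 U where
  base: "y \<in> U \<Longrightarrow> y \<in> robust_closure E k V1 V2 U"
| step: "\<lbrakk>A1 \<subseteq> V1; A2 \<subseteq> V2; k \<le> card A1; k \<le> card A2;
    \<forall>x\<in>A1 \<union> A2. (x, y) \<in> E \<and> x \<in> robust_closure E k V1 V2 U\<rbrakk> \<Longrightarrow> y \<in> robust_closure E k V1 V2 U"

text \<open>A vertex is entered from its own part in D[V1] and D[V2] and from the other part in
  D[V1,V2]. In each case \<open>H\<close> contains all arcs to it from one whole part, so one
  closure serves all three digraphs.\<close>

definition contains_side :: "('a \<times> 'a) set \<Rightarrow> ('a \<times> 'a) set \<Rightarrow> 'a set \<Rightarrow> 'a set \<Rightarrow> 'a set \<Rightarrow> bool" where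
  "contains_side E H W V1 V2 \<longleftrightarrow>
    (\<forall>y\<in>W. \<exists>X\<in>{V1, V2}. X \<subseteq> W \<and> (\<forall>x\<in>X. (x, y) \<in> E \<longrightarrow> (x, y) \<in> H))"

text \<open>Each closure step offers \<open>k\<close> in-neighbours in whichever part
  \<open>H\<close> uses at \<open>y\<close>, and fewer than \<open>k\<close> vertices are
  deleted.\<close>

lemma robust_closure_reachable:
  assumes side: "contains_side E H W V1 V2" and S: "finite S" "card S < k"
    and U: "\<And>y. y \<in> U \<Longrightarrow> y \<in> W - S \<Longrightarrow> (s, y) \<in> (H \<inter> (W - S) \<times> (W - S))\<^sup>*"
    and y: "y \<in> robust_closure E k V1 V2 U" "y \<in> W - S"
  shows "(s, y) \<in> (H \<inter> (W - S) \<times> (W - S))\<^sup>*"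
  using y
proof induction
  case (base y)
  then show ?case using U by blast
next
  case (step A1 A2 y)
  have *: "\<exists>x\<in>A. x \<notin> S" if "k \<le> card A" for A
  proof (rule ccontr)
    assume "\<not> ?thesis"
    then have "card A \<le> card S" using S(1) by (intro card_mono) auto
    then show False using S(2) that by linarith
  qed
  obtain X where X: "X = V1 \<or> X = V2" "X \<subseteq> W" "\<forall>x\<in>X. (x, y) \<in> E \<longrightarrow> (x, y) \<in> H"
  proof -
    have "\<exists>X\<in>{V1, V2}. X \<subseteq> W \<and> (\<forall>x\<in>X. (x, y) \<in> E \<longrightarrow> (x, y) \<in> H)"
      using side step.prems unfolding contains_side_def by simp
    then show thesis by (elim bexE conjE) (rule that, simp_all)
  qed
  obtain x1 x2 where "x1 \<in> A1" "x1 \<notin> S" "x2 \<in> A2" "x2 \<notin> S"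
    using *[OF step.hyps(3)] *[OF step.hyps(4)] by blast
  then have "\<exists>x\<in>A1 \<union> A2. x \<in> X \<and> x \<notin> S"
    using X(1) step.hyps(1,2) by auto
  then obtain x where x: "x \<in> A1 \<union> A2" "x \<in> X" "x \<notin> S" by blast
  have xW: "x \<in> W - S" using x X(2) by blast
  note IHx = bspec[OF step.IH x(1)]
  have IH: "(s, x) \<in> (H \<inter> (W - S) \<times> (W - S))\<^sup>*" using IHx xW by simp
  have "(x, y) \<in> E" using IHx by simp
  then have "(x, y) \<in> H" using X(3) x(2) by simp
  then have "(x, y) \<in> H \<inter> (W - S) \<times> (W - S)" using xW step.prems by simp
  with IH show ?case by (rule rtrancl_into_rtrancl)
qed

text \<open>Only the final arc may leave \<open>C\<close>; so a deleted set disjoint from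
  \<open>C\<close> cannot spoil the way to any remaining vertex of \<open>Um\<close>, or from any
  remaining vertex of \<open>Up\<close>.\<close>

definition connector :: "('a \<times> 'a) set \<Rightarrow> 'a set \<Rightarrow> 'a set \<Rightarrow> 'a set \<Rightarrow> bool" where
  "connector H C Up Um \<longleftrightarrow> (\<exists>t s. (t, s) \<in> (H \<inter> C \<times> C)\<^sup>* \<and>
    (\<forall>y\<in>Um. \<exists>c\<in>C. (s, c) \<in> (H \<inter> C \<times> C)\<^sup>* \<and> (c, y) \<in> H) \<and>
    (\<forall>x\<in>Up. \<exists>c\<in>C. (c, t) \<in> (H \<inter> C \<times> C)\<^sup>* \<and> (x, c) \<in> H))"

text \<open>Fewer than \<open>k\<close> deleted vertices miss one of the disjoint connectors.
  Through it every remaining vertex of \<open>Up\<close> reaches every remaining vertex of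
  \<open>Um\<close>, and the two closures extend this to all of \<open>W\<close>.\<close>

lemma strongI:
  assumes W: "finite W" "k + 1 \<le> card W"
    and side: "contains_side E H W V1 V2" "contains_side (E\<inverse>) (H\<inverse>) W V1 V2"
    and robust_closure: "W \<subseteq> robust_closure E k V1 V2 Um" "W \<subseteq> robust_closure (E\<inverse>) k V1 V2 Up"
    and J: "finite J" "k \<le> card J" and C: "\<And>j. j \<in> J \<Longrightarrow> C j \<subseteq> W \<and> connector H (C j) (Up \<inter> W) (Um \<inter> W)"
    and disj: "\<And>i j. i \<in> J \<Longrightarrow> j \<in> J \<Longrightarrow> i \<noteq> j \<Longrightarrow> C i \<inter> C j = {}"
  shows "strong k W H"
  unfolding strong_def
proof (intro conjI allI impI ballI)
  show "k + 1 \<le> card W" by (rule W)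
  fix S x y assume S: "S \<subseteq> W" "card S < k" and x: "x \<in> W - S" and y: "y \<in> W - S"
  have finS: "finite S" using S W finite_subset by blast
  have "\<exists>j\<in>J. C j \<inter> S = {}"
  proof (rule ccontr)
    assume "\<not> ?thesis"
    then have "\<forall>j\<in>J. \<exists>x. x \<in> C j \<inter> S" by blast
    then obtain f where f: "\<And>j. j \<in> J \<Longrightarrow> f j \<in> C j \<inter> S" unfolding bchoice_iff by blast
    have "inj_on f J"
    proof (rule inj_onI)
      fix i j assume ij: "i \<in> J" "j \<in> J" "f i = f j"
      then have "f i \<in> C i \<inter> C j" using f[OF ij(1)] f[OF ij(2)] by auto
      then show "i = j" using disj[OF ij(1,2)] by auto
    qed
    then have "card J \<le> card S" using f finS by (intro card_inj_on_le[of f]) auto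
    then show False using J S(2) by linarith
  qed
  then obtain j where j: "j \<in> J" "C j \<inter> S = {}" by blast
  let ?H = "H \<inter> (W - S) \<times> (W - S)"
  have CW: "C j \<subseteq> W - S" using C[OF j(1)] j(2) by blast
  have mono: "(H \<inter> C j \<times> C j)\<^sup>* \<subseteq> ?H\<^sup>*" using CW by (intro rtrancl_mono) blast
  obtain t s where ts: "(t, s) \<in> (H \<inter> C j \<times> C j)\<^sup>*"
    and s: "\<forall>y\<in>Um \<inter> W. \<exists>c\<in>C j. (s, c) \<in> (H \<inter> C j \<times> C j)\<^sup>* \<and> (c, y) \<in> H"
    and t: "\<forall>x\<in>Up \<inter> W. \<exists>c\<in>C j. (c, t) \<in> (H \<inter> C j \<times> C j)\<^sup>* \<and> (x, c) \<in> H"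
    using C[OF j(1)] unfolding connector_def by (elim conjE exE)
  have "(s, y) \<in> ?H\<^sup>*"
  proof (rule robust_closure_reachable[OF side(1) finS S(2) _ _ y])
    show "y \<in> robust_closure E k V1 V2 Um" using robust_closure(1) y by blast
    fix z assume z: "z \<in> Um" "z \<in> W - S"
    then obtain c where c: "c \<in> C j" "(s, c) \<in> (H \<inter> C j \<times> C j)\<^sup>*" "(c, z) \<in> H" using s by blast
    then have "(s, c) \<in> ?H\<^sup>*" "(c, z) \<in> ?H" using mono CW z by auto
    then show "(s, z) \<in> ?H\<^sup>*" by (rule rtrancl_into_rtrancl)
  qed
  moreover have "(t, x) \<in> (H\<inverse> \<inter> (W - S) \<times> (W - S))\<^sup>*"
  proof (rule robust_closure_reachable[OF side(2) finS S(2) _ _ x])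
    show "x \<in> robust_closure (E\<inverse>) k V1 V2 Up" using robust_closure(2) x by blast
    fix z assume z: "z \<in> Up" "z \<in> W - S"
    then obtain c where c: "c \<in> C j" "(c, t) \<in> (H \<inter> C j \<times> C j)\<^sup>*" "(z, c) \<in> H" using t by blast
    then have "(c, t) \<in> ?H\<^sup>*" "(z, c) \<in> ?H" using mono CW z by auto
    then have "(z, t) \<in> ?H\<^sup>*" by (rule converse_rtrancl_into_rtrancl[rotated])
    then have "(t, z) \<in> (?H\<inverse>)\<^sup>*" by (rule rtrancl_converseI)
    then show "(t, z) \<in> (H\<inverse> \<inter> (W - S) \<times> (W - S))\<^sup>*" by (simp add: converse_Int converse_Times)
  qed
  then have "(t, x) \<in> (?H\<inverse>)\<^sup>*" by (simp add: converse_Int converse_Times)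
  then have "(x, t) \<in> ?H\<^sup>*" by (rule rtrancl_converseD)
  moreover have "(t, s) \<in> ?H\<^sup>*" using ts mono by blast
  ultimately show "(x, y) \<in> ?H\<^sup>*" by (meson rtrancl_trans)
qed

lemma walk_rtrancl:
  assumes "walk H p" "p \<noteq> []" "set p \<subseteq> C"
  shows "(hd p, last p) \<in> (H \<inter> C \<times> C)\<^sup>*"
  using assms
proof (induction p rule: induct_list012)
  case (3 x y p)
  then have "(y, last (y # p)) \<in> (H \<inter> C \<times> C)\<^sup>*" by auto
  moreover have "(x, y) \<in> H \<inter> C \<times> C" using 3 by auto
  ultimately show ?case by (auto intro: converse_rtrancl_into_rtrancl)
qed auto

definition serves :: "('a \<times> 'a) set \<Rightarrow> 'a set \<Rightarrow> 'a \<Rightarrow> 'a set \<Rightarrow> bool" where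
  "serves H C s U \<longleftrightarrow> (\<forall>y\<in>U. \<exists>c\<in>C. (s, c) \<in> (H \<inter> C \<times> C)\<^sup>* \<and> (c, y) \<in> H)"

lemma connector_walk:
  assumes p: "walk H p" "p \<noteq> []" "set p \<subseteq> C"
    and s: "serves H C (last p) Um" and t: "serves (H\<inverse>) C (hd p) Up"
  shows "connector H C Up Um"
  unfolding connector_def
proof (intro exI conjI)
  show "(hd p, last p) \<in> (H \<inter> C \<times> C)\<^sup>*" using walk_rtrancl p .
  show "\<forall>y\<in>Um. \<exists>c\<in>C. (last p, c) \<in> (H \<inter> C \<times> C)\<^sup>* \<and> (c, y) \<in> H" using s unfolding serves_def .
  show "\<forall>x\<in>Up. \<exists>c\<in>C. (c, hd p) \<in> (H \<inter> C \<times> C)\<^sup>* \<and> (x, c) \<in> H"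
  proof
    fix x assume "x \<in> Up"
    then obtain c where c: "c \<in> C" "(hd p, c) \<in> (H\<inverse> \<inter> C \<times> C)\<^sup>*" "(c, x) \<in> H\<inverse>"
      using t unfolding serves_def by blast
    have "(hd p, c) \<in> ((H \<inter> C \<times> C)\<inverse>)\<^sup>*" using c(2) by (simp add: converse_Int converse_Times)
    then have "(c, hd p) \<in> (H \<inter> C \<times> C)\<^sup>*" by (rule rtrancl_converseD)
    then show "\<exists>c\<in>C. (c, hd p) \<in> (H \<inter> C \<times> C)\<^sup>* \<and> (x, c) \<in> H" using c by blast
  qed
qed

lemma serves_gadget:
  assumes g: "\<forall>b\<in>B. (s, b) \<in> E"
    and C: "s \<in> C" "B \<subseteq> C" and U: "\<And>y. y \<in> U \<Longrightarrow> \<exists>b\<in>B. (b, y) \<in> E"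
    and H: "E \<inter> C \<times> C \<subseteq> H" "E \<inter> C \<times> U \<subseteq> H"
  shows "serves H C s U"
  unfolding serves_def
proof
  fix y assume y: "y \<in> U"
  then obtain b where b: "b \<in> B" "(b, y) \<in> E" using U by blast
  then have "(s, b) \<in> H \<inter> C \<times> C" "(b, y) \<in> H" using g C H y by auto
  then show "\<exists>c\<in>C. (s, c) \<in> (H \<inter> C \<times> C)\<^sup>* \<and> (c, y) \<in> H" by blast
qed

lemma serves_gadget_alternating:
  assumes g: "\<forall>b\<in>B. (s, b) \<in> E" "\<forall>b'\<in>B'. \<exists>b\<in>B. (b, b') \<in> E"
    and C: "s \<in> C" "B \<subseteq> C" "B' \<subseteq> C"
    and U: "\<And>y. y \<in> U \<Longrightarrow> (\<exists>b\<in>B. (b, y) \<in> E) \<and> (\<exists>b\<in>B'. (b, y) \<in> E)"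
    and col: "\<And>b. b \<in> B \<Longrightarrow> \<chi> b \<noteq> \<chi> s" "\<And>b. b \<in> B' \<Longrightarrow> \<chi> b = (\<chi> s :: bool)"
    and H: "\<And>x y. x \<in> C \<Longrightarrow> y \<in> C \<union> U \<Longrightarrow> (x, y) \<in> E \<Longrightarrow> \<chi> x \<noteq> \<chi> y \<Longrightarrow> (x, y) \<in> H"
  shows "serves H C s U"
  unfolding serves_def
proof
  fix y assume y: "y \<in> U"
  have sb: "(s, b) \<in> H \<inter> C \<times> C" if "b \<in> B" for b
    using that g(1) C col(1)[OF that] by (auto intro!: H)
  show "\<exists>c\<in>C. (s, c) \<in> (H \<inter> C \<times> C)\<^sup>* \<and> (c, y) \<in> H"
  proof (cases "\<chi> y = \<chi> s")
    case True
    obtain b where b: "b \<in> B" "(b, y) \<in> E" using U y by blast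
    then have "(b, y) \<in> H" using C y True col(1)[OF b(1)] by (auto intro!: H)
    then show ?thesis using sb[OF b(1)] by blast
  next
    case False
    obtain b' where b': "b' \<in> B'" "(b', y) \<in> E" using U y by blast
    obtain b where b: "b \<in> B" "(b, b') \<in> E" using g(2) b' by blast
    have "(b', y) \<in> H" using C y False col(2)[OF b'(1)] b' by (auto intro!: H)
    moreover have "(b, b') \<in> H \<inter> C \<times> C"
      using C b b'(1) col(1)[OF b(1)] col(2)[OF b'(1)] by (auto intro!: H)
    ultimately show ?thesis using sb[OF b(1)] by (meson IntD2 SigmaD2 converse_rtrancl_into_rtrancl r_into_rtrancl)
  qed
qed

section \<open>Systems of short paths\<close>

lemma linkage_codomain:
  assumes "linkage E A B P" "A \<subseteq> A'" "B \<subseteq> B'"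
  shows "linkage E A' B' P"
  using assms unfolding linkage_def path_def by auto

text \<open>A path ending outside \<open>Z\<close> receives one more arc to a private vertex of
  \<open>Z\<close>. Of the \<open>2 * M\<close> candidates at most \<open>M\<close> are ends
  already, and the others suffice for distinct representatives.\<close>

lemma linkage_extend:
  assumes P: "linkage E A (Z \<union> Q) P" "card P \<le> M" and Z: "finite Z" "A \<inter> Z = {}"
    and bl: "\<And>p. p \<in> P \<Longrightarrow> set (butlast p) \<inter> Z = {}"
    and Q: "\<And>y. y \<in> Q \<Longrightarrow> 2 * M \<le> card (E `` {y} \<inter> Z)"
  obtains P' where "linkage E A Z P'" "card P' = card P" "\<forall>p'\<in>P'. set (butlast p') \<inter> Z = {}"
    "\<forall>p'\<in>P'. \<exists>p\<in>P. p' = p \<or> (\<exists>z\<in>Z. p' = p @ [z])"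
proof -
  have finP: "finite P" using P by (simp add: linkage_def)
  have pp: "p \<noteq> []" "distinct p" "walk E p" "hd p \<in> A" "last p \<in> Z \<union> Q" if "p \<in> P" for p
    using linkage_path[OF P(1) that] by (auto simp: path_def)
  define J where "J = {p \<in> P. last p \<notin> Z}"
  define C where "C p = E `` {last p} \<inter> Z - last ` P" for p
  have "finite (C p) \<and> card J \<le> card (C p)" if "p \<in> J" for p
  proof -
    have "card J \<le> M" using P(2) card_mono[OF finP, of J] by (auto simp: J_def)
    moreover have "2 * M \<le> card (E `` {last p} \<inter> Z)" using that pp(5)[of p] Q by (auto simp: J_def)
    moreover have "card (last ` P) \<le> M" using card_image_le[OF finP, of last] P(2) by linarith
    moreover have "card (E `` {last p} \<inter> Z) - card (last ` P) \<le> card (C p)"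
      unfolding C_def using finP by (intro diff_card_le_card_Diff) simp
    ultimately show ?thesis using Z unfolding C_def by auto
  qed
  moreover have "finite J" using finP by (simp add: J_def)
  ultimately obtain f where f: "\<And>p. p \<in> J \<Longrightarrow> f p \<in> C p" and injf: "inj_on f J"
    using distinct_representatives[of J C] by blast
  have fZ: "f p \<in> Z" "(last p, f p) \<in> E" "f p \<notin> last ` P" if "p \<in> J" for p
    using f[OF that] by (auto simp: C_def)
  define g where "g p = (if p \<in> J then p @ [f p] else p)" for p
  have noZ: "set p \<inter> Z = {}" if "p \<in> J" for p
  proof -
    have "p \<in> P" "last p \<notin> Z" using that by (auto simp: J_def)
    moreover have "set p = insert (last p) (set (butlast p))"
      using pp(1)[OF \<open>p \<in> P\<close>] by (metis append_butlast_last_id list.simps(15) rotate1.simps(2) set_rotate1)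
    ultimately show ?thesis using bl[of p] by auto
  qed
  have onlyZ: "x = last p" if "p \<in> P" "x \<in> set p" "x \<in> Z" for p x
  proof -
    have "set p = insert (last p) (set (butlast p))"
      using pp(1)[OF that(1)] by (metis append_butlast_last_id list.simps(15) rotate1.simps(2) set_rotate1)
    then show ?thesis using bl[OF that(1)] that by auto
  qed
  have gp: "path E A Z (g p) \<and> set (butlast (g p)) \<inter> Z = {}" if p: "p \<in> P" for p
  proof (cases "p \<in> J")
    case True
    then show ?thesis using pp(1-4)[OF p] fZ[OF True] noZ[OF True]
      by (auto simp: path_def g_def walk_append1)
  next
    case False
    then show ?thesis using pp[OF p] bl[OF p] p by (auto simp: path_def g_def J_def)
  qed
  have disj: "p = q" if p: "p \<in> P" and q: "q \<in> P" and v: "v \<in> set (g p)" "v \<in> set (g q)" for p q v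
  proof -
    have *: "p = q" if "p \<in> P" "q \<in> P" "p \<in> J" "v = f p" "v \<in> set (g q)" for p q
    proof (cases "q \<in> J \<and> v = f q")
      case True
      then show ?thesis using injf that by (auto dest: inj_onD)
    next
      case False
      then have "v \<in> set q" using that by (auto simp: g_def split: if_splits)
      then have "v = last q" using onlyZ[OF that(2)] fZ(1)[OF that(3)] that(4) by simp
      then show ?thesis using fZ(3)[OF that(3)] that by auto
    qed
    show ?thesis
    proof (cases "p \<in> J \<and> v = f p \<or> q \<in> J \<and> v = f q")
      case True
      then show ?thesis using *[OF p q] *[OF q p] v by blast
    next
      case False
      then have "v \<in> set p" "v \<in> set q" using v by (auto simp: g_def split: if_splits)
      then show ?thesis using linkage_disjoint[OF P(1)] p q by blast
    qed
  qed
  have inj: "inj_on g P"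
  proof (rule inj_onI)
    fix p q assume pq: "p \<in> P" "q \<in> P" "g p = g q"
    have "g p \<noteq> []" using gp[OF pq(1)] by (simp add: path_def)
    then show "p = q" using disj[OF pq(1,2), of "hd (g p)"] pq(3) by (metis hd_in_set)
  qed
  show thesis
  proof (rule that[of "g ` P"])
    show "linkage E A Z (g ` P)"
      unfolding linkage_def
    proof (intro conjI ballI impI)
      show "finite (g ` P)" using finP by simp
      show "path E A Z p" if "p \<in> g ` P" for p using that gp by auto
      show "set p \<inter> set q = {}" if pq: "p \<in> g ` P" "q \<in> g ` P" "p \<noteq> q" for p q
      proof -
        obtain p' q' where "p' \<in> P" "p = g p'" "q' \<in> P" "q = g q'" using pq by (elim imageE)
        then show ?thesis using disj[of p' q'] pq(3) by (metis disjoint_iff)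
      qed
    qed
    show "card (g ` P) = card P" using inj by (rule card_image)
    show "\<forall>p'\<in>g ` P. set (butlast p') \<inter> Z = {}" using gp by simp
    show "\<forall>p'\<in>g ` P. \<exists>p\<in>P. p' = p \<or> (\<exists>z\<in>Z. p' = p @ [z])"
      using fZ(1) unfolding g_def by auto
  qed
qed

text \<open>Passing from \<open>P\<close> to \<open>P'\<close> costs at most the vertices of
  \<open>Y\<close>, because \<open>X\<close> avoids \<open>D\<close>.\<close>

lemma card_Diff_bound:
  assumes "h \<le> card (X - P) + m" "P' - P \<subseteq> Y \<union> D" "X \<inter> D = {}" "finite X" "finite Y" "card Y \<le> m'"
  shows "h \<le> card (X - P') + (m + m')"
proof -
  have "card (X - P) \<le> card ((X - P') \<union> Y)" using assms(2-5) by (intro card_mono) auto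
  also have "\<dots> \<le> card (X - P') + card Y" by (rule card_Un_le)
  finally show ?thesis using assms(1,6) by linarith
qed

text \<open>Disjoint paths have at most \<open>card V\<close> vertices altogether, and the
  \<open>m\<close> shortest have at most their average share.\<close>

lemma linkage_shortest:
  assumes P: "linkage E A B P" "card P = N" "m \<le> N" and V: "finite V" "\<Union>(set ` P) \<subseteq> V"
  obtains P' where "linkage E A B P'" "P' \<subseteq> P" "card P' = m" "N * card (\<Union>(set ` P')) \<le> m * card V"
proof -
  have fin: "finite P" using P by (simp add: linkage_def)
  obtain L where L: "L \<subseteq> P" "card L = m" "\<And>x y. x \<in> L \<Longrightarrow> y \<in> P - L \<Longrightarrow> length x \<le> length y"
    using lowest_subset[OF fin, of m length] P(2,3) by blast
  have len: "card (set p) = length p" if "p \<in> P" for p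
    using linkage_path[OF P(1) that] by (auto simp: path_def distinct_card)
  have "card (\<Union>(set ` L)) \<le> (\<Sum>p\<in>L. card (set p))"
    using finite_subset[OF L(1) fin] by (rule card_UN_le)
  also have "\<dots> = sum length L" using L(1) len by (intro sum.cong) auto
  finally have "N * card (\<Union>(set ` L)) \<le> N * sum length L" by (rule mult_le_mono2)
  also have "\<dots> \<le> m * sum length P"
    using lowest_subset_average[OF fin L(1,3)] L(2) P(2) by (simp add: mult.commute)
  also have "sum length P = (\<Sum>p\<in>P. card (set p))" using len by (intro sum.cong) auto
  also have "\<dots> = card (\<Union>p\<in>P. set p)"
    using fin P(1) unfolding linkage_def by (intro card_UN_disjoint[symmetric]) auto
  also have "m * \<dots> \<le> m * card V" using V by (intro mult_le_mono2 card_mono) auto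
  finally show thesis using that[OF linkage_subset[OF P(1) L(1)] L(1,2)] by blast
qed

lemma path_system:
  fixes E :: "('a \<times> 'a) set" and M hm hp N :: nat
  assumes V: "finite V" and Z: "Zp \<subseteq> C" "Zm \<subseteq> C" "Zp \<inter> Zm = {}" "C \<subseteq> V"
    and Q: "Qp \<subseteq> V - C" "Qm \<subseteq> V - C" and R: "R \<inter> C = {}"
    and P: "linkage E Zp Zm P" "card P = N" "4 * M \<le> N" "\<Union>(set ` P) \<subseteq> (V - C - R) \<union> Zp \<union> Zm"
    and X: "\<And>y. y \<in> Qm \<Longrightarrow> Xm y \<subseteq> E\<inverse> `` {y} \<and> Xm y \<subseteq> V - C \<and> (4 * M + 1) * hm \<le> card (Xm y)"
      "\<And>y. y \<in> Qp \<Longrightarrow> Xp y \<subseteq> E `` {y} \<and> Xp y \<subseteq> V - C \<and> (4 * M + 1) * hp \<le> card (Xp y)"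
    and D: "\<And>y. y \<in> Qm \<Longrightarrow> 2 * M \<le> card (E `` {y} \<inter> Zm)"
      "\<And>y. y \<in> Qp \<Longrightarrow> 2 * M \<le> card (E\<inverse> `` {y} \<inter> Zp)"
    and h: "1 \<le> hm" "1 \<le> hp"
  obtains P' where "linkage E Zp Zm P'" "card P' = M"
    "\<forall>p\<in>P'. set p \<inter> C \<subseteq> {hd p, last p}" "\<Union>(set ` P') \<subseteq> V"
    "N * card (\<Union>(set ` P') - C) \<le> 4 * M * card V + N * (8 * M)"
    "card (\<Union>(set ` P') \<inter> R) \<le> 8 * M"
    "\<forall>y\<in>Qm. hm \<le> card (Xm y - \<Union>(set ` P')) + 8 * M"
    "\<forall>y\<in>Qp. hp \<le> card (Xp y - \<Union>(set ` P')) + 8 * M"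
proof -
  let ?U = "\<lambda>P. \<Union>(set ` P)"
  let ?A = "Zp \<union> Qp" and ?B = "Zm \<union> Qm"
  have fin: "finite Qp" "finite Qm" "finite Zp" "finite Zm"
    using Q Z V by (meson finite_Diff finite_subset)+
  obtain P1 where P1: "linkage E Zp Zm P1" "P1 \<subseteq> P" "card P1 = 4 * M" "N * card (?U P1) \<le> 4 * M * card V"
  proof -
    have "?U P \<subseteq> V" using P(4) Z by blast
    from linkage_shortest[OF P(1-3) V this] show thesis using that .
  qed
  \<comment> \<open>Trimming for the enlarged end sets keeps \<open>Qm\<close> off all but the last
    vertices of the paths, as \<open>linkage_redirect\<close> demands.\<close>
  have "linkage E ?A ?B P1" using linkage_codomain[OF P1(1)] by blast
  from linkage_trim[OF this] obtain P2 where P2: "linkage E ?A ?B P2" "card P2 = card P1" "?U P2 \<subseteq> ?U P1"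
    "\<forall>p\<in>P2. set (tl p) \<inter> ?A = {} \<and> set (butlast p) \<inter> ?B = {}" .
  have X1: "Xm y \<subseteq> E\<inverse> `` {y} \<and> finite (Xm y) \<and> (4 * M + 1) * hm \<le> card (Xm y)" if "y \<in> Qm" for y
    using X(1)[OF that] V by (auto intro: finite_subset)
  have X2: "Xp y \<subseteq> (E\<inverse>)\<inverse> `` {y} \<and> finite (Xp y) \<and> (2 * M + 1) * hp \<le> card (Xp y)" if "y \<in> Qp" for y
  proof -
    have "(2 * M + 1) * hp \<le> (4 * M + 1) * hp" by (rule mult_le_mono1) simp
    also have "\<dots> \<le> card (Xp y)" using X(2)[OF that] by blast
    finally show ?thesis using X(2)[OF that] V by (auto intro: finite_subset)
  qed
  have bl2: "set (butlast p) \<inter> Qm = {}" if "p \<in> P2" for p using P2(4) that by blast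
  from linkage_redirect[OF P2(1) trans[OF P2(2) P1(3)] fin(2) Un_upper2 bl2 X1 h(1)]
  obtain P3 Y1 where P3: "linkage E ?A ?B P3" "4 * M \<le> 2 * card P3" "Y1 \<subseteq> Qm" "card Y1 \<le> 4 * M"
    "?U P3 \<subseteq> ?U P2 \<union> Y1" "\<forall>y\<in>Qm. hm \<le> card (Xm y - ?U P3) + 4 * M" .
  from linkage_trim[OF P3(1)] obtain P4 where P4: "linkage E ?A ?B P4" "card P4 = card P3" "?U P4 \<subseteq> ?U P3"
    "\<forall>p\<in>P4. set (tl p) \<inter> ?A = {} \<and> set (butlast p) \<inter> ?B = {}" .
  obtain P5 where P5: "P5 \<subseteq> P4" "card P5 = 2 * M"
    using obtain_subset_with_card_n[of "2 * M" P4] P3(2) P4(2) by auto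
  \<comment> \<open>Reversal exchanges starts and ends, so the same redirection now frees
    out-neighbours of \<open>Qp\<close>.\<close>
  have P5': "linkage (E\<inverse>) ?B ?A (rev ` P5)" by (rule linkage_rev[OF linkage_subset[OF P4(1) P5(1)]])
  have cP5: "card (rev ` P5) = 2 * M" using P5(2) by (subst card_image) (auto simp: inj_on_def)
  have bl5: "set (butlast p) \<inter> Qp = {}" if p: "p \<in> rev ` P5" for p
  proof -
    obtain q where q: "q \<in> P5" "p = rev q" using p by (elim imageE)
    have "set (butlast (rev q)) = set (tl q)" by (cases q) (auto simp: butlast_append)
    then show ?thesis using P4(4) q P5(1) by auto
  qed
  from linkage_redirect[OF P5' cP5 fin(1) Un_upper2 bl5 X2 h(2)]
  obtain P6 Y2 where P6: "linkage (E\<inverse>) ?B ?A P6" "2 * M \<le> 2 * card P6" "Y2 \<subseteq> Qp" "card Y2 \<le> 2 * M"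
    "?U P6 \<subseteq> ?U (rev ` P5) \<union> Y2" "\<forall>y\<in>Qp. hp \<le> card (Xp y - ?U P6) + 2 * M" .
  from linkage_trim[OF P6(1)] obtain P7 where P7: "linkage (E\<inverse>) ?B ?A P7" "card P7 = card P6" "?U P7 \<subseteq> ?U P6"
    "\<forall>p\<in>P7. set (tl p) \<inter> ?B = {} \<and> set (butlast p) \<inter> ?A = {}" .
  obtain P8 where P8: "P8 \<subseteq> P7" "card P8 = M"
    using obtain_subset_with_card_n[of M P7] P6(2) P7(2) by auto
  have l8: "linkage (E\<inverse>) ?B (Zp \<union> Qp) P8" by (rule linkage_subset[OF P7(1) P8(1)])
  have dB: "?B \<inter> Zp = {}" using Z Q by blast
  have bl8: "set (butlast p) \<inter> Zp = {}" if "p \<in> P8" for p using P7(4) that P8(1) by blast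
  from linkage_extend[OF l8 eq_imp_le[OF P8(2)] fin(3) dB bl8 D(2)]
  obtain P9 where P9: "linkage (E\<inverse>) ?B Zp P9" "card P9 = card P8" "\<forall>p'\<in>P9. set (butlast p') \<inter> Zp = {}"
    "\<forall>p'\<in>P9. \<exists>p\<in>P8. p' = p \<or> (\<exists>z\<in>Zp. p' = p @ [z])" .
  have l10: "linkage E Zp (Zm \<union> Qm) (rev ` P9)" using linkage_rev[OF P9(1)] by simp
  have c10: "card (rev ` P9) = M" using P9(2) P8(2) by (subst card_image) (auto simp: inj_on_def)
  have tl10: "set (tl p) \<inter> Zp = {} \<and> set (butlast p) \<inter> Zm = {}" if p: "p \<in> rev ` P9" for p
  proof -
    obtain q where q: "q \<in> P9" "p = rev q" using p by (elim imageE)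
    obtain r where r: "r \<in> P8" "q = r \<or> (\<exists>z\<in>Zp. q = r @ [z])" using P9(4)[rule_format, OF q(1)] by blast
    have rne: "r \<noteq> []" using linkage_nonempty[OF l8 r(1)] .
    have 1: "set (tl (rev q)) = set (butlast q)" by (cases q rule: rev_cases) auto
    have 2: "set (butlast (rev q)) = set (tl q)" by (cases q) (auto simp: butlast_append)
    have "set (tl q) \<subseteq> set (tl r) \<union> Zp" using r(2) rne by (cases r) auto
    moreover have "set (tl r) \<inter> Zm = {}" using P7(4) r(1) P8(1) by blast
    ultimately have "set (tl q) \<inter> Zm = {}" using Z(3) by blast
    then show ?thesis using 1 2 q(2) P9(3)[rule_format, OF q(1)] by simp
  qed
  have bl10: "set (butlast p) \<inter> Zm = {}" if "p \<in> rev ` P9" for p using tl10[OF that] by blast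
  from linkage_extend[OF l10 eq_imp_le[OF c10] fin(4) Z(3) bl10 D(1)]
  obtain P' where P': "linkage E Zp Zm P'" "card P' = card (rev ` P9)" "\<forall>p'\<in>P'. set (butlast p') \<inter> Zm = {}"
    "\<forall>p'\<in>P'. \<exists>p\<in>rev ` P9. p' = p \<or> (\<exists>z\<in>Zm. p' = p @ [z])" .
  have U9: "?U P9 \<subseteq> ?U P8 \<union> Zp"
  proof
    fix v assume "v \<in> ?U P9"
    then obtain q where q: "q \<in> P9" "v \<in> set q" by blast
    obtain r where "r \<in> P8" "q = r \<or> (\<exists>z\<in>Zp. q = r @ [z])" using P9(4)[rule_format, OF q(1)] by blast
    then show "v \<in> ?U P8 \<union> Zp" using q(2) by auto
  qed
  have U': "?U P' \<subseteq> ?U P9 \<union> Zm"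
  proof
    fix v assume "v \<in> ?U P'"
    then obtain q where q: "q \<in> P'" "v \<in> set q" by blast
    obtain r where "r \<in> P9" "q = rev r \<or> (\<exists>z\<in>Zm. q = rev r @ [z])" using P'(4)[rule_format, OF q(1)] by blast
    then show "v \<in> ?U P9 \<union> Zm" using q(2) by auto
  qed
  define u where "u P = ?U P" for P :: "'a list set"
  note uf = P2(3) P3(5) P4(3) P6(5) P7(3) U9 U'
  note uf = uf[folded u_def]
  have "u P8 \<subseteq> u P7" "u (rev ` P5) \<subseteq> u P4" using P8(1) P5(1) by (auto simp: u_def)
  then have U8: "?U P8 \<subseteq> ?U P6" and U6: "?U P6 \<subseteq> ?U P3 \<union> Y2"
    and Ubase: "?U P' \<subseteq> ?U P1 \<union> Y1 \<union> Y2 \<union> Zp \<union> Zm"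
    unfolding u_def[symmetric] using uf by blast+
  have U1: "?U P1 \<subseteq> (V - C - R) \<union> Zp \<union> Zm" using P1(2) P(4) by blast
  have finY: "finite Y1" "finite Y2" using P3(3) P6(3) fin finite_subset by blast+
  have fin1: "finite (?U P1)" using U1 V fin finite_subset by (metis finite_Diff finite_UnI)
  show thesis
  proof (rule that[OF P'(1)])
    show "card P' = M" using P'(2) c10 by simp
    have all: "?U P' \<subseteq> (V - C) \<union> Zp \<union> Zm"
      using Ubase[folded u_def] U1[folded u_def] P3(3) P6(3) Q unfolding u_def[symmetric] by blast
    then show "?U P' \<subseteq> V" using Z unfolding u_def[symmetric] by blast
    have "set p \<inter> C \<subseteq> {hd p, last p}" if p: "p \<in> P'" for p
    proof
      fix v assume v: "v \<in> set p \<inter> C"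
      have pne: "p \<noteq> []" using linkage_nonempty[OF P'(1) p] .
      have "v \<in> ?U P'" using v p by blast
      then have "v \<in> Zp \<union> Zm" using all v by blast
      moreover have "v = hd p \<or> v \<in> set (tl p)" using v pne by (cases p) auto
      moreover have "v = last p \<or> v \<in> set (butlast p)" using v pne by (cases p rule: rev_cases) auto
      moreover have "set (tl p) \<inter> Zp = {}"
      proof -
        obtain q where q: "q \<in> rev ` P9" "p = q \<or> (\<exists>z\<in>Zm. p = q @ [z])" using P'(4)[rule_format, OF p] by blast
        have "q \<noteq> []" using linkage_nonempty[OF l10 q(1)] .
        then have "set (tl p) \<subseteq> set (tl q) \<union> Zm" using q(2) by (cases q) auto
        then show ?thesis using tl10[OF q(1)] Z(3) by blast
      qed
      ultimately show "v \<in> {hd p, last p}" using P'(3)[rule_format, OF p] by blast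
    qed
    then show "\<forall>p\<in>P'. set p \<inter> C \<subseteq> {hd p, last p}" by simp
    have "card (?U P' - C) \<le> card (?U P1 \<union> Y1 \<union> Y2)"
      using Ubase Z fin1 finY by (intro card_mono) auto
    also have "\<dots> \<le> card (?U P1) + card Y1 + card Y2"
      by (meson add_le_mono1 card_Un_le le_trans)
    also have "\<dots> \<le> card (?U P1) + 8 * M" using P3(4) P6(4) by simp
    finally have "N * card (?U P' - C) \<le> N * (card (?U P1) + 8 * M)" by (rule mult_le_mono2)
    then show "N * card (?U P' - C) \<le> 4 * M * card V + N * (8 * M)"
      using P1(4) by (simp add: algebra_simps)
    \<comment> \<open>The original paths avoid \<open>R\<close>; only redirected ends can lie in
      it.\<close>
    have "?U P' \<inter> R \<subseteq> Y1 \<union> Y2"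
      using Ubase[folded u_def] U1[folded u_def] R Z unfolding u_def[symmetric] by blast
    then have "card (?U P' \<inter> R) \<le> card (Y1 \<union> Y2)" using finY by (intro card_mono) auto
    also have "\<dots> \<le> card Y1 + card Y2" by (rule card_Un_le)
    finally show "card (?U P' \<inter> R) \<le> 8 * M" using P3(4) P6(4) by simp
    have "hm \<le> card (Xm y - ?U P') + 8 * M" if "y \<in> Qm" for y
    proof -
      \<comment> \<open>The second redirection comes after \<open>Xm y\<close> was freed and may
        occupy up to \<open>2 * M\<close> of its vertices again.\<close>
      have "u P' - u P3 \<subseteq> Y2 \<union> C" using U'[folded u_def] U9[folded u_def] U8[folded u_def] U6[folded u_def] Z(1,2) by blast
      moreover have "Xm y \<inter> C = {}" using X(1)[OF that] by blast
      ultimately have "hm \<le> card (Xm y - ?U P') + (4 * M + 2 * M)"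
        using card_Diff_bound[OF P3(6)[rule_format, OF that] _ _ _ finY(2) P6(4)] X1[OF that]
        unfolding u_def by blast
      then show ?thesis by simp
    qed
    then show "\<forall>y\<in>Qm. hm \<le> card (Xm y - ?U P') + 8 * M" by simp
    have "hp \<le> card (Xp y - ?U P') + 8 * M" if "y \<in> Qp" for y
    proof -
      have "u P' - u P6 \<subseteq> {} \<union> C" using U'[folded u_def] U9[folded u_def] U8[folded u_def] Z(1,2) by blast
      moreover have "Xp y \<inter> C = {}" using X(2)[OF that] by blast
      ultimately have "hp \<le> card (Xp y - ?U P') + (2 * M + 0)"
        using card_Diff_bound[OF P6(6)[rule_format, OF that], of _ "{}" C 0] X2[OF that]
        unfolding u_def by simp
      then show ?thesis by simp
    qed
    then show "\<forall>y\<in>Qp. hp \<le> card (Xp y - ?U P') + 8 * M" by simp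
  qed
qed

section \<open>Colouring a configuration\<close>

text \<open>The order matters: \<open>Z\<close> enters the closure first, from reserved neighbours
  outside \<open>X\<close>; then \<open>X\<close>, from \<open>Z\<close> or from neighbours outside
  \<open>C\<close> and \<open>X\<close>; the rest of \<open>C\<close> comes last, from reserved
  neighbours that may lie in \<open>X\<close>.\<close>

lemma (in near_semicomplete) robust_closure_side:
  assumes X: "X \<subseteq> V - C" and Z: "Z \<subseteq> C"
    and R: "\<And>v. v \<in> C \<Longrightarrow> \<exists>A1 A2. A1 \<subseteq> W1 \<and> A2 \<subseteq> W2 \<and> k \<le> card A1 \<and> k \<le> card A2 \<and>
      A1 \<union> A2 \<subseteq> E\<inverse> `` {v} - C \<and> (v \<in> Z \<longrightarrow> (A1 \<union> A2) \<inter> X = {})"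
    and Zc: "m + l + k \<le> card (Z \<inter> W1)" "m + l + k \<le> card (Z \<inter> W2)" and CV: "C \<subseteq> V"
    and Q: "\<And>y. y \<in> X \<Longrightarrow> card (E `` {y} \<inter> Z) < m \<or>
      k \<le> card (E\<inverse> `` {y} \<inter> (V - C - X) \<inter> W1) \<and> k \<le> card (E\<inverse> `` {y} \<inter> (V - C - X) \<inter> W2)"
  shows "V \<subseteq> robust_closure E k W1 W2 (V - C - X)"
proof -
  let ?h = "robust_closure E k W1 W2 (V - C - X)"
  have inV: "E\<inverse> `` {v} \<subseteq> V" for v using EV by auto
  have U: "V - C - X \<subseteq> ?h" by (auto intro: robust_closure.base)
  have stepI: "y \<in> ?h" if "A1 \<subseteq> W1" "A2 \<subseteq> W2" "k \<le> card A1" "k \<le> card A2" "A1 \<union> A2 \<subseteq> E\<inverse> `` {y}" "A1 \<union> A2 \<subseteq> ?h" for y A1 A2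
    by (rule robust_closure.step[OF that(1-4)]) (use that(5,6) in auto)
  have Zh: "Z \<subseteq> ?h"
  proof
    fix v assume v: "v \<in> Z"
    then have "v \<in> C" using Z by blast
    then obtain A1 A2 where A: "A1 \<subseteq> W1" "A2 \<subseteq> W2" "k \<le> card A1" "k \<le> card A2"
      "A1 \<union> A2 \<subseteq> E\<inverse> `` {v} - C" "v \<in> Z \<longrightarrow> (A1 \<union> A2) \<inter> X = {}" using R[OF \<open>v \<in> C\<close>] by (elim exE conjE)
    have "A1 \<union> A2 \<subseteq> V - C - X" using A(5,6) v inV by blast
    then show "v \<in> ?h" using stepI[OF A(1-4)] A(5) U by blast
  qed
  have Xh: "X \<subseteq> ?h"
  proof
    fix y assume y: "y \<in> X"
    show "y \<in> ?h"
    proof (cases "card (E `` {y} \<inter> Z) < m")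
      case True
      \<comment> \<open>Fewer than \<open>m\<close> vertices of \<open>Z\<close> are out-neighbours
        of \<open>y\<close> and at most \<open>l\<close> are non-adjacent to it; all others dominate
        \<open>y\<close>.\<close>
      have big: "k \<le> card (E\<inverse> `` {y} \<inter> (Z \<inter> W))" if "m + l + k \<le> card (Z \<inter> W)" for W
      proof -
        have fZ: "finite Z" using Z CV finV by (meson finite_subset)
        have "card (Z \<inter> W) \<le> card ((E\<inverse> `` {y} \<inter> (Z \<inter> W)) \<union> (E `` {y} \<inter> Z) \<union> {w \<in> Z. (y, w) \<notin> E \<and> (w, y) \<notin> E})"
          using fZ by (intro card_mono) auto
        also have "\<dots> \<le> card (E\<inverse> `` {y} \<inter> (Z \<inter> W)) + card (E `` {y} \<inter> Z) + card {w \<in> Z. (y, w) \<notin> E \<and> (w, y) \<notin> E}"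
          by (meson add_le_mono1 card_Un_le le_trans)
        also have "card {w \<in> Z. (y, w) \<notin> E \<and> (w, y) \<notin> E} \<le> l"
          using y X Z CV by (intro nonadj_subset[of y]) auto
        finally show ?thesis using that True by linarith
      qed
      show ?thesis
        by (rule stepI[OF _ _ big[OF Zc(1)] big[OF Zc(2)]]) (use Zh in auto)
    next
      case False
      then have "k \<le> card (E\<inverse> `` {y} \<inter> (V - C - X) \<inter> W1)" "k \<le> card (E\<inverse> `` {y} \<inter> (V - C - X) \<inter> W2)"
        using Q[OF y] by auto
      then show ?thesis by (rule stepI[rotated 2]) (use U in auto)
    qed
  qed
  have "C \<subseteq> ?h"
  proof
    fix v assume v: "v \<in> C"
    then obtain A1 A2 where A: "A1 \<subseteq> W1" "A2 \<subseteq> W2" "k \<le> card A1" "k \<le> card A2"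
      "A1 \<union> A2 \<subseteq> E\<inverse> `` {v} - C" using R[OF v] by (elim exE conjE)
    have "A1 \<union> A2 \<subseteq> V - C" using A(5) inV by blast
    then have "A1 \<union> A2 \<subseteq> ?h" using U Xh by blast
    then show "v \<in> ?h" using stepI[OF A(1-4)] A(5) by blast
  qed
  then show ?thesis using U Xh by blast
qed

lemma ex_alternating_colouring:
  assumes "distinct p"
  shows "\<exists>\<chi> :: 'a \<Rightarrow> bool. successively (\<lambda>x y. \<chi> x \<noteq> \<chi> y) p"
  using assms
proof (induction p rule: induct_list012)
  case (3 x y p)
  then obtain \<chi> :: "'a \<Rightarrow> bool" where \<chi>: "successively (\<lambda>x y. \<chi> x \<noteq> \<chi> y) (y # p)" by auto
  have "successively (\<lambda>a b. (\<chi>(x := \<not> \<chi> y)) a \<noteq> (\<chi>(x := \<not> \<chi> y)) b) (y # p)"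
    using \<chi> by (rule successively_cong[THEN iffD1, rotated -1]) (use 3 in auto)
  then show ?case using 3 by (intro exI[of _ "\<chi>(x := \<not> \<chi> y)"]) auto
qed auto

text \<open>\<open>P\<close> consists of \<open>k\<close> paths for each of the three kinds of connectors; rerouting adds at most \<open>24 * k\<close> new
  ends to them, so that of the \<open>26 * k\<close> reserved neighbours of a vertex of \<open>C\<close>, \<open>k\<close> can still be given to each
  part. A vertex \<open>y\<close> outside \<open>C\<close> with fewer than \<open>6 * k\<close> arcs to \<open>Zm\<close> is dominated by all but \<open>6 * k + l\<close> vertices
  of \<open>Zm\<close>; hence the bound on \<open>card Zm\<close>, which leaves \<open>7 * k + l\<close> unused sources for each part.\<close>

locale configuration = near_semicomplete V E l for V :: "'a set" and E l +
  fixes k :: nat and C Zp Zm Xp Xm F1 F2 :: "'a set" and Bp Bp' Bm Bm' Rp Rm :: "'a \<Rightarrow> 'a set" and P :: "'a list set"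
  assumes CV: "C \<subseteq> V" "Zp \<subseteq> C" "Zm \<subseteq> C" "Zp \<inter> Zm = {}" "Xp \<subseteq> V - C" "Xm \<subseteq> V - C"
    and gm: "\<And>z. z \<in> Zm \<Longrightarrow> gadget E z (Bm z) (Bm' z) \<and> Bm z \<union> Bm' z \<subseteq> C"
    and gp: "\<And>z. z \<in> Zp \<Longrightarrow> gadget (E\<inverse>) z (Bp z) (Bp' z) \<and> Bp z \<union> Bp' z \<subseteq> C"
    and domm: "\<And>z y. z \<in> Zm \<Longrightarrow> y \<in> V - C - Xm \<Longrightarrow> (\<exists>b\<in>Bm z. (b, y) \<in> E) \<and> (\<exists>b\<in>Bm' z. (b, y) \<in> E)"
    and domp: "\<And>z y. z \<in> Zp \<Longrightarrow> y \<in> V - C - Xp \<Longrightarrow> (\<exists>b\<in>Bp z. (y, b) \<in> E) \<and> (\<exists>b\<in>Bp' z. (y, b) \<in> E)"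
    and dism: "\<And>y z. y \<in> Zm \<Longrightarrow> z \<in> Zm \<Longrightarrow> y \<noteq> z \<Longrightarrow> insert y (Bm y \<union> Bm' y) \<inter> insert z (Bm z \<union> Bm' z) = {}"
    and disp: "\<And>y z. y \<in> Zp \<Longrightarrow> z \<in> Zp \<Longrightarrow> y \<noteq> z \<Longrightarrow> insert y (Bp y \<union> Bp' y) \<inter> insert z (Bp z \<union> Bp' z) = {}"
    and dispm: "\<And>y z. y \<in> Zp \<Longrightarrow> z \<in> Zm \<Longrightarrow> insert y (Bp y \<union> Bp' y) \<inter> insert z (Bm z \<union> Bm' z) = {}"
    and cardZ: "17 * k + 2 * l \<le> card Zp" "17 * k + 2 * l \<le> card Zm"
    and Rm: "\<And>v. v \<in> C \<Longrightarrow> Rm v \<subseteq> E\<inverse> `` {v} - C \<and> card (Rm v) = 26 * k \<and> (v \<in> Zm \<longrightarrow> Rm v \<inter> Xm = {})"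
    and Rp: "\<And>v. v \<in> C \<Longrightarrow> Rp v \<subseteq> E `` {v} - C \<and> card (Rp v) = 26 * k \<and> (v \<in> Zp \<longrightarrow> Rp v \<inter> Xp = {})"
    and Rdis: "\<And>u v. u \<in> C \<Longrightarrow> v \<in> C \<Longrightarrow> u \<noteq> v \<Longrightarrow> Rm u \<inter> Rm v = {} \<and> Rp u \<inter> Rp v = {}"
      "\<And>u v. u \<in> C \<Longrightarrow> v \<in> C \<Longrightarrow> Rp u \<inter> Rm v = {}"
    and P: "linkage E Zp Zm P" "card P = 3 * k" "\<And>p. p \<in> P \<Longrightarrow> set p \<inter> C \<subseteq> {hd p, last p}" "\<Union>(set ` P) \<subseteq> V"
      "card (\<Union>(set ` P) \<inter> (\<Union>v\<in>C. Rp v \<union> Rm v)) \<le> 24 * k"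
    and F: "F1 \<inter> F2 = {}" "F1 \<union> F2 \<subseteq> V - C - (\<Union>v\<in>C. Rp v \<union> Rm v) - \<Union>(set ` P)"
    and Qm: "\<And>y. y \<in> Xm \<Longrightarrow> card (E `` {y} \<inter> Zm) < 6 * k \<or>
      k \<le> card (E\<inverse> `` {y} \<inter> (V - C - Xm) \<inter> F1) \<and> k \<le> card (E\<inverse> `` {y} \<inter> (V - C - Xm) \<inter> F2)"
    and Qp: "\<And>y. y \<in> Xp \<Longrightarrow> card (E\<inverse> `` {y} \<inter> Zp) < 6 * k \<or>
      k \<le> card (E `` {y} \<inter> (V - C - Xp) \<inter> F1) \<and> k \<le> card (E `` {y} \<inter> (V - C - Xp) \<inter> F2)"
    and kpos: "k > 0"
begin

definition "Tm p = insert (last p) (Bm (last p) \<union> Bm' (last p))"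
definition "Tp p = insert (hd p) (Bp (hd p) \<union> Bp' (hd p))"
definition "K p = set p \<union> Tp p \<union> Tm p"
definition "RR = (\<Union>v\<in>C. Rp v \<union> Rm v)"
definition "PP = \<Union>(set ` P)"

lemma pathP:
  assumes "p \<in> P"
  shows "p \<noteq> []" "distinct p" "walk E p" "hd p \<in> Zp" "last p \<in> Zm"
  using linkage_path[OF P(1) assms] by (auto simp: path_def)

lemma T_subset:
  assumes "p \<in> P" shows "Tm p \<subseteq> C" "Tp p \<subseteq> C" "K p \<inter> C = Tp p \<union> Tm p" "K p \<subseteq> V"
proof -
  show 1: "Tm p \<subseteq> C" "Tp p \<subseteq> C"
    using gm[OF pathP(5)[OF assms]] gp[OF pathP(4)[OF assms]] pathP(4,5)[OF assms] CV(2,3)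
    unfolding Tm_def Tp_def by auto
  have "{hd p, last p} \<subseteq> Tp p \<union> Tm p" by (auto simp: Tm_def Tp_def)
  then show "K p \<inter> C = Tp p \<union> Tm p" using 1 P(3)[OF assms] unfolding K_def by blast
  have "set p \<subseteq> V" using P(4) assms by blast
  then show "K p \<subseteq> V" using 1 CV(1) unfolding K_def by blast
qed

lemma K_disjoint:
  assumes "p \<in> P" "q \<in> P" "p \<noteq> q" shows "K p \<inter> K q = {}"
proof -
  have pq: "set p \<inter> set q = {}" using linkage_disjoint[OF P(1) assms(1,2)] assms(3) by blast
  then have ne: "hd p \<noteq> hd q" "last p \<noteq> last q"
    using pathP(1)[OF assms(1)] pathP(1)[OF assms(2)] by (metis disjoint_iff hd_in_set last_in_set)+
  have T: "(Tp p \<union> Tm p) \<inter> (Tp q \<union> Tm q) = {}"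
    using disp[OF pathP(4)[OF assms(1)] pathP(4)[OF assms(2)] ne(1)]
      dism[OF pathP(5)[OF assms(1)] pathP(5)[OF assms(2)] ne(2)]
      dispm[OF pathP(4)[OF assms(1)] pathP(5)[OF assms(2)]]
      dispm[OF pathP(4)[OF assms(2)] pathP(5)[OF assms(1)]]
    unfolding Tp_def[symmetric] Tm_def[symmetric] by (simp add: Int_Un_distrib Int_Un_distrib2 Int_commute)
  have "v \<notin> K q" if "v \<in> K p" for v
  proof (cases "v \<in> C")
    case True
    then show ?thesis using T T_subset(3)[OF assms(1)] T_subset(3)[OF assms(2)] that by blast
  next
    case False
    then have "v \<in> set p" using that T_subset(1,2)[OF assms(1)] unfolding K_def by blast
    then show ?thesis using pq False T_subset(1,2)[OF assms(2)] unfolding K_def by blast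
  qed
  then show ?thesis by blast
qed

text \<open>The path meets \<open>C\<close> only in its two ends, while the sets of its gadgets lie
  in \<open>C\<close> and contain neither end. So the gadgets can be recoloured without touching the
  path.\<close>

lemma ex_gadget_colouring:
  assumes p: "p \<in> P"
  shows "\<exists>\<chi> :: 'a \<Rightarrow> bool. successively (\<lambda>x y. \<chi> x \<noteq> \<chi> y) p \<and>
    (\<forall>b\<in>Bm (last p). \<chi> b \<noteq> \<chi> (last p)) \<and> (\<forall>b\<in>Bm' (last p). \<chi> b = \<chi> (last p)) \<and>
    (\<forall>b\<in>Bp (hd p). \<chi> b \<noteq> \<chi> (hd p)) \<and> (\<forall>b\<in>Bp' (hd p). \<chi> b = \<chi> (hd p))"
proof -
  note pp = pathP[OF p]
  let ?s = "last p" and ?t = "hd p"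
  obtain \<chi> :: "'a \<Rightarrow> bool" where \<chi>: "successively (\<lambda>x y. \<chi> x \<noteq> \<chi> y) p"
    using ex_alternating_colouring[OF pp(2)] by blast
  define \<psi> where "\<psi> x = (if x \<in> Bm ?s then \<not> \<chi> ?s else if x \<in> Bm' ?s then \<chi> ?s
    else if x \<in> Bp ?t then \<not> \<chi> ?t else if x \<in> Bp' ?t then \<chi> ?t else \<chi> x)" for x
  have g: "?s \<notin> Bm ?s \<union> Bm' ?s" "Bm ?s \<inter> Bm' ?s = {}" "?t \<notin> Bp ?t \<union> Bp' ?t" "Bp ?t \<inter> Bp' ?t = {}"
    using gm[OF pp(5)] gp[OF pp(4)] unfolding gadget_def by auto
  have d: "insert ?t (Bp ?t \<union> Bp' ?t) \<inter> insert ?s (Bm ?s \<union> Bm' ?s) = {}" by (rule dispm[OF pp(4,5)])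
  have onp: "\<psi> x = \<chi> x" if "x \<in> set p" for x
  proof (cases "x \<in> C")
    case True
    then have "x = ?t \<or> x = ?s" using P(3)[OF p] that by blast
    then show ?thesis using g d unfolding \<psi>_def by auto
  next
    case False
    then show ?thesis using gm[OF pp(5)] gp[OF pp(4)] unfolding \<psi>_def by auto
  qed
  have "successively (\<lambda>x y. \<psi> x \<noteq> \<psi> y) p"
    using \<chi> by (rule successively_cong[THEN iffD1, rotated -1]) (use onp in auto)
  moreover have "\<psi> ?s = \<chi> ?s" "\<psi> ?t = \<chi> ?t" using onp pp(1) by auto
  ultimately show ?thesis
    using g d by (intro exI[of _ \<psi>]) (auto simp: \<psi>_def)
qed

lemma connector_mono:
  assumes p: "p \<in> P"
  shows "connector E (K p) ((V - C - Xp) \<inter> W) ((V - C - Xm) \<inter> W)"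
proof (rule connector_walk)
  note pp = pathP[OF p]
  show "walk E p" "p \<noteq> []" "set p \<subseteq> K p" using pp by (auto simp: K_def)
  show "serves E (K p) (last p) ((V - C - Xm) \<inter> W)"
    by (rule serves_gadget[of "Bm (last p)" _ E])
      (use gm[OF pp(5)] domm[OF pp(5)] in \<open>auto simp: gadget_def K_def Tm_def\<close>)
  show "serves (E\<inverse>) (K p) (hd p) ((V - C - Xp) \<inter> W)"
    by (rule serves_gadget[of "Bp (hd p)" _ "E\<inverse>"])
      (use gp[OF pp(4)] domp[OF pp(4)] in \<open>auto simp: gadget_def K_def Tp_def\<close>)
qed

definition alternates :: "('a \<Rightarrow> bool) \<Rightarrow> 'a list \<Rightarrow> bool" where
  "alternates \<chi> p \<longleftrightarrow> successively (\<lambda>x y. \<chi> x \<noteq> \<chi> y) p \<and>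
    (\<forall>b\<in>Bm (last p). \<chi> b \<noteq> \<chi> (last p)) \<and> (\<forall>b\<in>Bm' (last p). \<chi> b = \<chi> (last p)) \<and>
    (\<forall>b\<in>Bp (hd p). \<chi> b \<noteq> \<chi> (hd p)) \<and> (\<forall>b\<in>Bp' (hd p). \<chi> b = \<chi> (hd p))"

text \<open>Only the colours on \<open>K p\<close> matter, so alternation survives both the passage
  from a colouring to a part and the enlargement of that part.\<close>

lemma alternates_cong:
  assumes "p \<in> P" "\<And>x. x \<in> K p \<Longrightarrow> \<chi> x = \<psi> x" "alternates \<chi> p"
  shows "alternates \<psi> p"
proof -
  note pp = pathP[OF assms(1)]
  have sub: "set p \<subseteq> K p" "last p \<in> K p" "hd p \<in> K p" "Bm (last p) \<subseteq> K p" "Bm' (last p) \<subseteq> K p"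
    "Bp (hd p) \<subseteq> K p" "Bp' (hd p) \<subseteq> K p"
    using pp(1) by (auto simp: K_def Tm_def Tp_def)
  have suc: "successively (\<lambda>x y. \<psi> x \<noteq> \<psi> y) p"
    using assms(3)[unfolded alternates_def, THEN conjunct1]
    by (rule successively_cong[THEN iffD1, rotated -1]) (use assms(2) sub(1) in auto)
  note eq = assms(2)[symmetric]
  show ?thesis
    unfolding alternates_def eq[OF sub(2)] eq[OF sub(3)]
    using suc assms(3) eq[OF subsetD[OF sub(4)]] eq[OF subsetD[OF sub(5)]] eq[OF subsetD[OF sub(6)]] eq[OF subsetD[OF sub(7)]]
    by (simp add: alternates_def)
qed

lemma connector_alternating:
  assumes p: "p \<in> P" "K p \<subseteq> V1 \<union> V2" and V12: "V1 \<inter> V2 = {}" and alt: "alternates (\<lambda>x. x \<in> V1) p"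
  defines "H \<equiv> E \<inter> (V1 \<times> V2 \<union> V2 \<times> V1)"
  shows "connector H (K p) ((V - C - Xp) \<inter> (V1 \<union> V2)) ((V - C - Xm) \<inter> (V1 \<union> V2))"
proof (rule connector_walk)
  note pp = pathP[OF p(1)]
  let ?\<chi> = "\<lambda>x. x \<in> V1"
  have a: "successively (\<lambda>x y. ?\<chi> x \<noteq> ?\<chi> y) p" "\<And>b. b \<in> Bm (last p) \<Longrightarrow> ?\<chi> b \<noteq> ?\<chi> (last p)"
    "\<And>b. b \<in> Bm' (last p) \<Longrightarrow> ?\<chi> b = ?\<chi> (last p)" "\<And>b. b \<in> Bp (hd p) \<Longrightarrow> ?\<chi> b \<noteq> ?\<chi> (hd p)"
    "\<And>b. b \<in> Bp' (hd p) \<Longrightarrow> ?\<chi> b = ?\<chi> (hd p)"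
    using alt unfolding alternates_def by blast+
  have H: "(x, y) \<in> H" if "x \<in> V1 \<union> V2" "y \<in> V1 \<union> V2" "(x, y) \<in> E" "?\<chi> x \<noteq> ?\<chi> y" for x y
    using that V12 unfolding H_def by auto
  have "set p \<subseteq> V1 \<union> V2" using p(2) by (auto simp: K_def)
  with pp(3) a(1) show "walk H p"
    by (induction p rule: induct_list012) (auto intro: H)
  show "p \<noteq> []" "set p \<subseteq> K p" using pp by (auto simp: K_def)
  show "serves H (K p) (last p) ((V - C - Xm) \<inter> (V1 \<union> V2))"
  proof (rule serves_gadget_alternating[of "Bm (last p)" _ E "Bm' (last p)" _ _ ?\<chi>])
    show "\<forall>b\<in>Bm (last p). (last p, b) \<in> E" "\<forall>b'\<in>Bm' (last p). \<exists>b\<in>Bm (last p). (b, b') \<in> E"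
      using gm[OF pp(5)] by (auto simp: gadget_def)
    show "last p \<in> K p" "Bm (last p) \<subseteq> K p" "Bm' (last p) \<subseteq> K p" by (auto simp: K_def Tm_def)
    show "(x, y) \<in> H" if "x \<in> K p" "y \<in> K p \<union> (V - C - Xm) \<inter> (V1 \<union> V2)" "(x, y) \<in> E" "?\<chi> x \<noteq> ?\<chi> y" for x y
      using that p(2) by (intro H) auto
  qed (use domm[OF pp(5)] a in auto)
  show "serves (H\<inverse>) (K p) (hd p) ((V - C - Xp) \<inter> (V1 \<union> V2))"
  proof (rule serves_gadget_alternating[of "Bp (hd p)" _ "E\<inverse>" "Bp' (hd p)" _ _ ?\<chi>])
    show "\<forall>b\<in>Bp (hd p). (hd p, b) \<in> E\<inverse>" "\<forall>b'\<in>Bp' (hd p). \<exists>b\<in>Bp (hd p). (b, b') \<in> E\<inverse>"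
      using gp[OF pp(4)] by (auto simp: gadget_def)
    show "hd p \<in> K p" "Bp (hd p) \<subseteq> K p" "Bp' (hd p) \<subseteq> K p" by (auto simp: K_def Tp_def)
    show "(x, y) \<in> H\<inverse>" if "x \<in> K p" "y \<in> K p \<union> (V - C - Xp) \<inter> (V1 \<union> V2)" "(x, y) \<in> E\<inverse>" "?\<chi> x \<noteq> ?\<chi> y" for x y
      using that p(2) by (auto intro!: H)
  qed (use domp[OF pp(4)] a in auto)
qed

lemma ex_two_subsets:
  fixes X :: "'b set"
  assumes "2 * a \<le> card X" "finite X"
  shows "\<exists>A B. A \<subseteq> X \<and> B \<subseteq> X \<and> A \<inter> B = {} \<and> card A = a \<and> card B = a"
proof -
  have "a \<le> card X" using assms(1) by simp
  then obtain A where A: "A \<subseteq> X" "card A = a" by (meson obtain_subset_with_card_n)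
  have "card (X - A) = card X - a" using A assms(2) finite_subset by (metis card_Diff_subset)
  then have "a \<le> card (X - A)" using assms(1) by simp
  then obtain B where "B \<subseteq> X - A" "card B = a" by (meson obtain_subset_with_card_n)
  then show ?thesis using A by (intro exI[of _ A] exI[of _ B]) auto
qed

text \<open>Only what the closures and connectors need is coloured, so that both sets stay small
  enough for the prescribed sizes.\<close>

lemma ex_coloured_parts:
  obtains W1 W2 PP1 PP2 PPH Rm1 Rm2 Rp1 Rp2 where
    "W1 \<subseteq> V" "W2 \<subseteq> V" "W1 \<inter> W2 = {}"
    "card W1 \<le> card C + card (PP - C) + card C * (2 * k) + card F1"
    "card W2 \<le> card C + card (PP - C) + card C * (2 * k) + card F2"
    "PP1 \<subseteq> P" "PP2 \<subseteq> P" "PPH \<subseteq> P" "card PP1 = k" "card PP2 = k" "card PPH = k"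
    "\<forall>p\<in>PP1. K p \<subseteq> W1" "\<forall>p\<in>PP2. K p \<subseteq> W2"
    "\<forall>p\<in>PPH. K p \<subseteq> W1 \<union> W2 \<and> alternates (\<lambda>x. x \<in> W1) p"
    "7 * k + l \<le> card (Zm \<inter> W1)" "7 * k + l \<le> card (Zm \<inter> W2)"
    "7 * k + l \<le> card (Zp \<inter> W1)" "7 * k + l \<le> card (Zp \<inter> W2)"
    "F1 \<subseteq> W1" "F2 \<subseteq> W2"
    "\<forall>v\<in>C. Rm1 v \<subseteq> Rm v \<inter> W1 \<and> Rm2 v \<subseteq> Rm v \<inter> W2 \<and> card (Rm1 v) = k \<and> card (Rm2 v) = k"
    "\<forall>v\<in>C. Rp1 v \<subseteq> Rp v \<inter> W1 \<and> Rp2 v \<subseteq> Rp v \<inter> W2 \<and> card (Rp1 v) = k \<and> card (Rp2 v) = k"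
proof -
  have finP: "finite P" using P(1) by (simp add: linkage_def)
  have finC: "finite C" using CV(1) finV finite_subset by blast
  have finPP: "finite PP" using P(4) finV finite_subset unfolding PP_def by blast
  have RRV: "RR \<subseteq> V - C" using Rm Rp EV unfolding RR_def by fast
  have finR: "finite (Rm v)" "finite (Rp v)" if "v \<in> C" for v
    using Rm[OF that] Rp[OF that] kpos by (auto intro: card_ge_0_finite)
  obtain P1 where P1: "P1 \<subseteq> P" "card P1 = k"
    using obtain_subset_with_card_n[of k P] P(2) by auto
  have "card (P - P1) = 2 * k" using P1 P(2) finP finite_subset[OF P1(1) finP] by (simp add: card_Diff_subset)
  then obtain P2 where P2: "P2 \<subseteq> P - P1" "card P2 = k"
    using obtain_subset_with_card_n[of k "P - P1"] by auto
  define PH where "PH = P - P1 - P2"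
  have PH: "card PH = k" using \<open>card (P - P1) = 2 * k\<close> P2 finP unfolding PH_def
    by (subst card_Diff_subset) (auto intro: finite_subset)
  have "\<forall>p\<in>P. \<exists>\<chi>. alternates \<chi> p" using ex_gadget_colouring unfolding alternates_def by blast
  then obtain \<chi> where \<chi>: "\<And>p. p \<in> P \<Longrightarrow> alternates (\<chi> p) p" unfolding bchoice_iff by blast
  have Zs: "\<exists>A B. A \<subseteq> Z - f ` P \<and> B \<subseteq> Z - f ` P \<and> A \<inter> B = {} \<and> card A = 7 * k + l \<and> card B = 7 * k + l"
    if "17 * k + 2 * l \<le> card Z" "Z \<subseteq> C" for Z and f :: "'a list \<Rightarrow> 'a"
  proof (rule ex_two_subsets)
    have "card (f ` P) \<le> 3 * k" using card_image_le[OF finP, of f] P(2) by simp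
    moreover have "card Z - card (f ` P) \<le> card (Z - f ` P)" using finP by (intro diff_card_le_card_Diff) simp
    ultimately show "2 * (7 * k + l) \<le> card (Z - f ` P)" using that(1) by simp
    show "finite (Z - f ` P)" using that(2) finC finite_subset by blast
  qed
  obtain Zm1 Zm2 where Zm: "Zm1 \<subseteq> Zm - last ` P" "Zm2 \<subseteq> Zm - last ` P" "Zm1 \<inter> Zm2 = {}"
    "card Zm1 = 7 * k + l" "card Zm2 = 7 * k + l"
    using Zs[OF cardZ(2) CV(3), of last] by (elim exE conjE)
  obtain Zp1 Zp2 where Zp: "Zp1 \<subseteq> Zp - hd ` P" "Zp2 \<subseteq> Zp - hd ` P" "Zp1 \<inter> Zp2 = {}"
    "card Zp1 = 7 * k + l" "card Zp2 = 7 * k + l"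
    using Zs[OF cardZ(1) CV(2), of hd] by (elim exE conjE)
  have Rs: "\<exists>A B. A \<subseteq> X - PP \<and> B \<subseteq> X - PP \<and> A \<inter> B = {} \<and> card A = k \<and> card B = k"
    if "card X = 26 * k" "finite X" "X \<subseteq> RR" for X
  proof (rule ex_two_subsets)
    have "card (X \<inter> PP) \<le> card (PP \<inter> RR)" using that finPP by (intro card_mono) auto
    then have "card (X \<inter> PP) \<le> 24 * k" using P(5) unfolding PP_def RR_def by linarith
    moreover have "card X = card (X \<inter> PP) + card (X - PP)" using that(2) by (rule card_Int_Diff)
    ultimately show "2 * k \<le> card (X - PP)" using that(1) by linarith
  qed (use that in simp)
  have "\<exists>A B. A \<subseteq> Rm v - PP \<and> B \<subseteq> Rm v - PP \<and> A \<inter> B = {} \<and> card A = k \<and> card B = k" if v: "v \<in> C" for v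
  proof (rule Rs)
    show "card (Rm v) = 26 * k" using Rm[OF v] by blast
    show "finite (Rm v)" by (rule finR(1)[OF v])
    show "Rm v \<subseteq> RR" using v unfolding RR_def by blast
  qed
  then have "\<forall>v\<in>C. \<exists>A B. A \<subseteq> Rm v - PP \<and> B \<subseteq> Rm v - PP \<and> A \<inter> B = {} \<and> card A = k \<and> card B = k"
    by (rule ballI)
  then obtain Rm1 Rm2 where Rm12: "\<And>v. v \<in> C \<Longrightarrow> Rm1 v \<subseteq> Rm v - PP \<and> Rm2 v \<subseteq> Rm v - PP \<and>
      Rm1 v \<inter> Rm2 v = {} \<and> card (Rm1 v) = k \<and> card (Rm2 v) = k"
    unfolding bchoice_iff by metis
  have "\<exists>A B. A \<subseteq> Rp v - PP \<and> B \<subseteq> Rp v - PP \<and> A \<inter> B = {} \<and> card A = k \<and> card B = k" if v: "v \<in> C" for v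
  proof (rule Rs)
    show "card (Rp v) = 26 * k" using Rp[OF v] by blast
    show "finite (Rp v)" by (rule finR(2)[OF v])
    show "Rp v \<subseteq> RR" using v unfolding RR_def by blast
  qed
  then have "\<forall>v\<in>C. \<exists>A B. A \<subseteq> Rp v - PP \<and> B \<subseteq> Rp v - PP \<and> A \<inter> B = {} \<and> card A = k \<and> card B = k"
    by (rule ballI)
  then obtain Rp1 Rp2 where Rp12: "\<And>v. v \<in> C \<Longrightarrow> Rp1 v \<subseteq> Rp v - PP \<and> Rp2 v \<subseteq> Rp v - PP \<and>
      Rp1 v \<inter> Rp2 v = {} \<and> card (Rp1 v) = k \<and> card (Rp2 v) = k"
    unfolding bchoice_iff by metis
  define core1 where "core1 = \<Union>(K ` P1) \<union> (\<Union>p\<in>PH. {x \<in> K p. \<chi> p x})"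
  define core2 where "core2 = \<Union>(K ` P2) \<union> (\<Union>p\<in>PH. {x \<in> K p. \<not> \<chi> p x})"
  define R1 where "R1 = (\<Union>v\<in>C. Rm1 v \<union> Rp1 v)"
  define R2 where "R2 = (\<Union>v\<in>C. Rm2 v \<union> Rp2 v)"
  define W1 where "W1 = core1 \<union> (Zm1 \<union> Zp1) \<union> R1 \<union> F1"
  define W2 where "W2 = core2 \<union> (Zm2 \<union> Zp2) \<union> R2 \<union> F2"
  have KP: "K p \<subseteq> C \<union> (PP - C)" if "p \<in> P" for p
    using T_subset(1,2)[OF that] that unfolding K_def PP_def by blast
  have PHP: "PH \<subseteq> P" "P1 \<inter> P2 = {}" "P1 \<inter> PH = {}" "P2 \<inter> PH = {}" "P2 \<subseteq> P"
    using P1 P2 unfolding PH_def by auto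
  have core: "core1 \<subseteq> C \<union> (PP - C)" "core2 \<subseteq> C \<union> (PP - C)"
    using KP P1 PHP unfolding core1_def core2_def by blast+
  have core12: "core1 \<inter> core2 = {}"
  proof -
    have "False" if x: "x \<in> core1" "x \<in> core2" for x
    proof -
      obtain p where p: "p \<in> P1 \<or> p \<in> PH \<and> \<chi> p x" "x \<in> K p" using x(1) unfolding core1_def by blast
      obtain q where q: "q \<in> P2 \<or> q \<in> PH \<and> \<not> \<chi> q x" "x \<in> K q" using x(2) unfolding core2_def by blast
      have "p \<in> P" "q \<in> P" using p q P1 PHP by auto
      then have "p = q" using K_disjoint p(2) q(2) by blast
      then show False using p q PHP by blast
    qed
    then show ?thesis by blast
  qed
  have unused: "z \<notin> K p" if "p \<in> P" "z \<in> (Zm - last ` P) \<union> (Zp - hd ` P)" for z p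
  proof
    assume z: "z \<in> K p"
    have "z \<in> C" using that(2) CV(2,3) by blast
    then have zT: "z \<in> Tp p \<union> Tm p" using z T_subset(3)[OF that(1)] by blast
    note pp = pathP[OF that(1)]
    show False
    proof (cases "z \<in> Zm - last ` P")
      case True
      then have ne: "z \<noteq> last p" "z \<in> Zm" using that(1) by auto
      show False using dism[OF ne(2) pp(5) ne(1)] dispm[OF pp(4) ne(2)] zT unfolding Tp_def Tm_def by blast
    next
      case False
      then have ne: "z \<noteq> hd p" "z \<in> Zp" using that by auto
      show False using disp[OF ne(2) pp(4) ne(1)] dispm[OF ne(2) pp(5)] zT unfolding Tp_def Tm_def by blast
    qed
  qed
  have coreZ: "(core1 \<union> core2) \<inter> (Zm1 \<union> Zm2 \<union> Zp1 \<union> Zp2) = {}"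
  proof -
    have "\<exists>p\<in>P. x \<in> K p" if "x \<in> core1 \<union> core2" for x
      using that P1(1) PHP(1,5) unfolding core1_def core2_def by auto
    moreover have "x \<in> (Zm - last ` P) \<union> (Zp - hd ` P)" if "x \<in> Zm1 \<union> Zm2 \<union> Zp1 \<union> Zp2" for x
      using that Zm(1,2) Zp(1,2) by auto
    ultimately show ?thesis using unused by (metis disjoint_iff)
  qed
  have ZC: "Zm1 \<union> Zm2 \<union> Zp1 \<union> Zp2 \<subseteq> C" using Zm(1,2) Zp(1,2) CV(2,3) by auto
  have Z12: "(Zm1 \<union> Zp1) \<inter> (Zm2 \<union> Zp2) = {}" 
  proof -
    have "x \<notin> Zm2 \<union> Zp2" if "x \<in> Zm1 \<union> Zp1" for x
      using that Zm(1-3) Zp(1-3) CV(4) by auto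
    then show ?thesis by (metis disjoint_iff)
  qed
  have Rm': "Rm1 v \<subseteq> Rm v - PP" "Rm2 v \<subseteq> Rm v - PP" "Rm1 v \<inter> Rm2 v = {}" if "v \<in> C" for v
    using Rm12[OF that] by simp_all
  have Rp': "Rp1 v \<subseteq> Rp v - PP" "Rp2 v \<subseteq> Rp v - PP" "Rp1 v \<inter> Rp2 v = {}" if "v \<in> C" for v
    using Rp12[OF that] by simp_all
  have R12: "R1 \<inter> R2 = {}"
  proof -
    have "False" if x: "x \<in> R1" "x \<in> R2" for x
    proof -
      obtain u where u: "u \<in> C" "x \<in> Rm1 u \<or> x \<in> Rp1 u" using x(1) unfolding R1_def by blast
      obtain v where v: "v \<in> C" "x \<in> Rm2 v \<or> x \<in> Rp2 v" using x(2) unfolding R2_def by blast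
      show False
      proof (cases "u = v")
        case True
        then show False using u(2) v(2) Rm'[OF u(1)] Rp'[OF u(1)] Rdis(2)[OF u(1) u(1)] by blast
      next
        case False
        then show False
          using u(2) v(2) Rm'(1)[OF u(1)] Rp'(1)[OF u(1)] Rm'(2)[OF v(1)] Rp'(2)[OF v(1)] Rdis(1)[OF u(1) v(1)]
            Rdis(2)[OF u(1) v(1)] Rdis(2)[OF v(1) u(1)] by blast
      qed
    qed
    then show ?thesis by blast
  qed
  have RRR: "R1 \<union> R2 \<subseteq> RR - PP"
  proof
    fix x assume "x \<in> R1 \<union> R2"
    then obtain v where v: "v \<in> C" "x \<in> Rm1 v \<union> Rp1 v \<union> Rm2 v \<union> Rp2 v" unfolding R1_def R2_def by auto
    then have "x \<in> Rp v \<union> Rm v" "x \<notin> PP" using Rm'[OF v(1)] Rp'[OF v(1)] by auto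
    then show "x \<in> RR - PP" using v(1) unfolding RR_def by auto
  qed
  have Fs: "F1 \<inter> F2 = {}" "F1 \<union> F2 \<subseteq> V - C - RR - PP" using F unfolding RR_def PP_def by auto
  have PPV: "PP \<subseteq> V" using P(4) unfolding PP_def .
  have cR: "card R \<le> card C * (2 * k)" if R: "R = (\<Union>v\<in>C. f v \<union> g v)" "\<And>v. v \<in> C \<Longrightarrow> card (f v) = k \<and> card (g v) = k"
    for R and f g :: "'a \<Rightarrow> 'a set"
  proof -
    have "card R \<le> (\<Sum>v\<in>C. card (f v \<union> g v))" unfolding R(1) by (rule card_UN_le[OF finC])
    also have "\<dots> \<le> (\<Sum>v\<in>C. 2 * k)"
    proof (rule sum_mono)
      fix v assume "v \<in> C"
      then show "card (f v \<union> g v) \<le> 2 * k" using R(2)[of v] card_Un_le[of "f v" "g v"] by simp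
    qed
    finally show ?thesis by simp
  qed
  have cW: "card W \<le> card C + card (PP - C) + card C * (2 * k) + card F"
    if "W \<subseteq> C \<union> (PP - C) \<union> R \<union> F" "card R \<le> card C * (2 * k)" "R \<subseteq> V" "F \<subseteq> V" for W R F
  proof -
    have "card W \<le> card (C \<union> (PP - C) \<union> R \<union> F)"
      using that finC finPP finV by (intro card_mono) (auto intro: finite_subset)
    also have "\<dots> \<le> card C + card (PP - C) + card R + card F"
      by (meson add_le_mono1 card_Un_le le_trans)
    finally show ?thesis using that(2) by linarith
  qed
  show thesis
  proof (rule that[of W1 W2 P1 P2 PH Rm1 Rm2 Rp1 Rp2])
    have blocks: "(A1 \<union> B1 \<union> R1 \<union> G1) \<inter> (A2 \<union> B2 \<union> R2 \<union> G2) = {}"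
      if "A1 \<inter> A2 = {}" "(A1 \<union> A2) \<inter> (B1 \<union> B2) = {}" "B1 \<inter> B2 = {}" "R1 \<inter> R2 = {}" "G1 \<inter> G2 = {}"
        "A1 \<union> A2 \<union> B1 \<union> B2 \<subseteq> S" "R1 \<union> R2 \<subseteq> T" "S \<inter> T = {}" "(G1 \<union> G2) \<inter> (S \<union> T) = {}"
      for A1 A2 B1 B2 R1 R2 G1 G2 S T :: "'a set"
      using that by blast
    have S: "core1 \<union> core2 \<union> (Zm1 \<union> Zp1) \<union> (Zm2 \<union> Zp2) \<subseteq> C \<union> PP" using core ZC by auto
    have T: "(C \<union> PP) \<inter> (RR - PP) = {}" using RRV by auto
    have G: "(F1 \<union> F2) \<inter> ((C \<union> PP) \<union> (RR - PP)) = {}" using Fs(2) by auto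
    have coreZ': "(core1 \<union> core2) \<inter> ((Zm1 \<union> Zp1) \<union> (Zm2 \<union> Zp2)) = {}" using coreZ by auto
    show disj: "W1 \<inter> W2 = {}"
      unfolding W1_def W2_def by (rule blocks[OF core12 coreZ' Z12 R12 Fs(1) S RRR T G])
    have sV: "core1 \<subseteq> V" "core2 \<subseteq> V" "Zm1 \<union> Zp1 \<subseteq> V" "Zm2 \<union> Zp2 \<subseteq> V" "R1 \<subseteq> V" "R2 \<subseteq> V" "F1 \<subseteq> V" "F2 \<subseteq> V"
      using S RRR RRV Fs(2) PPV CV(1) by auto
    show "W1 \<subseteq> V" "W2 \<subseteq> V" unfolding W1_def W2_def using sV by auto
    have "card R1 \<le> card C * (2 * k)" by (rule cR[OF R1_def]) (use Rm12 Rp12 in simp)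
    then show "card W1 \<le> card C + card (PP - C) + card C * (2 * k) + card F1"
      by (rule cW[rotated]) (use core(1) ZC sV in \<open>auto simp: W1_def\<close>)
    have "card R2 \<le> card C * (2 * k)" by (rule cR[OF R2_def]) (use Rm12 Rp12 in simp)
    then show "card W2 \<le> card C + card (PP - C) + card C * (2 * k) + card F2"
      by (rule cW[rotated]) (use core(2) ZC sV in \<open>auto simp: W2_def\<close>)
    show "\<forall>p\<in>PH. K p \<subseteq> W1 \<union> W2 \<and> alternates (\<lambda>x. x \<in> W1) p"
    proof
      fix p assume p: "p \<in> PH"
      have s: "x \<in> W1" if "x \<in> K p" "\<chi> p x" for x
        using p that unfolding W1_def core1_def by auto
      have s': "x \<in> W2" if "x \<in> K p" "\<not> \<chi> p x" for x
        using p that unfolding W2_def core2_def by auto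
      have eq: "\<chi> p x = (x \<in> W1)" if "x \<in> K p" for x
        using s[OF that] s'[OF that] disj by (metis disjoint_iff)
      have "p \<in> P" using p PHP(1) by (rule subsetD[rotated])
      from alternates_cong[OF this eq \<chi>[OF this]] have "alternates (\<lambda>x. x \<in> W1) p" .
      moreover have "K p \<subseteq> W1 \<union> W2" using s s' by (metis UnCI subsetI)
      ultimately show "K p \<subseteq> W1 \<union> W2 \<and> alternates (\<lambda>x. x \<in> W1) p" by simp
    qed
    have fW: "finite W1" "finite W2" using \<open>W1 \<subseteq> V\<close> \<open>W2 \<subseteq> V\<close> finV finite_subset by blast+
    show "7 * k + l \<le> card (Zm \<inter> W1)" unfolding Zm(4)[symmetric] using fW Zm(1) by (intro card_mono) (auto simp: W1_def)
    show "7 * k + l \<le> card (Zm \<inter> W2)" unfolding Zm(5)[symmetric] using fW Zm(2) by (intro card_mono) (auto simp: W2_def)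
    show "7 * k + l \<le> card (Zp \<inter> W1)" unfolding Zp(4)[symmetric] using fW Zp(1) by (intro card_mono) (auto simp: W1_def)
    show "7 * k + l \<le> card (Zp \<inter> W2)" unfolding Zp(5)[symmetric] using fW Zp(2) by (intro card_mono) (auto simp: W2_def)
    show "\<forall>p\<in>P1. K p \<subseteq> W1" "\<forall>p\<in>P2. K p \<subseteq> W2" unfolding W1_def W2_def core1_def core2_def by blast+
    show "F1 \<subseteq> W1" "F2 \<subseteq> W2" unfolding W1_def W2_def by blast+
    have RW: "Rm1 v \<subseteq> W1" "Rm2 v \<subseteq> W2" "Rp1 v \<subseteq> W1" "Rp2 v \<subseteq> W2" if "v \<in> C" for v
      using that unfolding W1_def W2_def R1_def R2_def by auto
    show "\<forall>v\<in>C. Rm1 v \<subseteq> Rm v \<inter> W1 \<and> Rm2 v \<subseteq> Rm v \<inter> W2 \<and> card (Rm1 v) = k \<and> card (Rm2 v) = k"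
    proof
      fix v assume v: "v \<in> C"
      have "Rm1 v \<subseteq> Rm v \<inter> W1" using Rm'(1)[OF v] RW(1)[OF v] by auto
      moreover have "Rm2 v \<subseteq> Rm v \<inter> W2" using Rm'(2)[OF v] RW(2)[OF v] by auto
      ultimately show "Rm1 v \<subseteq> Rm v \<inter> W1 \<and> Rm2 v \<subseteq> Rm v \<inter> W2 \<and> card (Rm1 v) = k \<and> card (Rm2 v) = k"
        using Rm12[OF v] by simp
    qed
    show "\<forall>v\<in>C. Rp1 v \<subseteq> Rp v \<inter> W1 \<and> Rp2 v \<subseteq> Rp v \<inter> W2 \<and> card (Rp1 v) = k \<and> card (Rp2 v) = k"
    proof
      fix v assume v: "v \<in> C"
      have "Rp1 v \<subseteq> Rp v \<inter> W1" using Rp'(1)[OF v] RW(3)[OF v] by auto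
      moreover have "Rp2 v \<subseteq> Rp v \<inter> W2" using Rp'(2)[OF v] RW(4)[OF v] by auto
      ultimately show "Rp1 v \<subseteq> Rp v \<inter> W1 \<and> Rp2 v \<subseteq> Rp v \<inter> W2 \<and> card (Rp1 v) = k \<and> card (Rp2 v) = k"
        using Rp12[OF v] by simp
    qed
  qed (use P1 P2 PH PHP in auto)
qed

end

section \<open>Enlarging the coloured sets to parts of the prescribed sizes\<close>

context configuration
begin

theorem ex_partition:
  assumes n: "n1 + n2 \<le> card V" "k + 1 \<le> n1" "k + 1 \<le> n2"
    and c: "card C + card (\<Union>(set ` P) - C) + card C * (2 * k) + card F1 \<le> n1"
      "card C + card (\<Union>(set ` P) - C) + card C * (2 * k) + card F2 \<le> n2"
  shows "\<exists>V1 V2. V1 \<subseteq> V \<and> V2 \<subseteq> V \<and> V1 \<inter> V2 = {} \<and> card V1 = n1 \<and> card V2 = n2 \<and>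
    strong k V1 E \<and> strong k V2 E \<and> strong k (V1 \<union> V2) (E \<inter> (V1 \<times> V2 \<union> V2 \<times> V1))"
proof -
  obtain W1 W2 PP1 PP2 PPH Rm1 Rm2 Rp1 Rp2 where W: "W1 \<subseteq> V" "W2 \<subseteq> V" "W1 \<inter> W2 = {}"
    "card W1 \<le> card C + card (PP - C) + card C * (2 * k) + card F1"
    "card W2 \<le> card C + card (PP - C) + card C * (2 * k) + card F2"
    and PP: "PP1 \<subseteq> P" "PP2 \<subseteq> P" "PPH \<subseteq> P" "card PP1 = k" "card PP2 = k" "card PPH = k"
    and K: "\<forall>p\<in>PP1. K p \<subseteq> W1" "\<forall>p\<in>PP2. K p \<subseteq> W2"
      "\<forall>p\<in>PPH. K p \<subseteq> W1 \<union> W2 \<and> alternates (\<lambda>x. x \<in> W1) p"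
    and Z: "7 * k + l \<le> card (Zm \<inter> W1)" "7 * k + l \<le> card (Zm \<inter> W2)"
      "7 * k + l \<le> card (Zp \<inter> W1)" "7 * k + l \<le> card (Zp \<inter> W2)"
    and FW: "F1 \<subseteq> W1" "F2 \<subseteq> W2"
    and R: "\<forall>v\<in>C. Rm1 v \<subseteq> Rm v \<inter> W1 \<and> Rm2 v \<subseteq> Rm v \<inter> W2 \<and> card (Rm1 v) = k \<and> card (Rm2 v) = k"
      "\<forall>v\<in>C. Rp1 v \<subseteq> Rp v \<inter> W1 \<and> Rp2 v \<subseteq> Rp v \<inter> W2 \<and> card (Rp1 v) = k \<and> card (Rp2 v) = k"
    by (rule ex_coloured_parts)
  have "card W1 \<le> n1" "card W2 \<le> n2" using W(4,5) c unfolding PP_def by linarith+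
  \<comment> \<open>The conditions on \<open>W1\<close> and \<open>W2\<close> ask for enough
    vertices in some set or concern vertices already coloured, so the others may be distributed
    arbitrarily.\<close>
  from two_disjoint_supersets[OF finV W(1-3) this n(1)] obtain V1 V2
    where V: "W1 \<subseteq> V1" "W2 \<subseteq> V2" "V1 \<subseteq> V" "V2 \<subseteq> V" "V1 \<inter> V2 = {}" "card V1 = n1" "card V2 = n2" .
  have fin: "finite V1" "finite V2" using V(3,4) finV finite_subset by auto
  have finP: "finite P" using P(1) by (simp add: linkage_def)
  let ?Um = "V - C - Xm" and ?Up = "V - C - Xp"
  have mono: "m \<le> card (A \<inter> B')" if "m \<le> card (A \<inter> B)" "B \<subseteq> B'" "finite B'" for m and A B B' :: "'a set"
    using that by (meson Int_mono card_mono finite_Int le_trans order_refl)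
  have hm: "V \<subseteq> robust_closure E k V1 V2 ?Um"
  proof (rule robust_closure_side[OF CV(6) CV(3) _ _ _ CV(1), where m = "6 * k"])
    fix v assume v: "v \<in> C"
    have a: "Rm1 v \<subseteq> Rm v \<inter> W1" "Rm2 v \<subseteq> Rm v \<inter> W2" "card (Rm1 v) = k" "card (Rm2 v) = k"
      using bspec[OF R(1) v] by simp_all
    have b: "Rm v \<subseteq> E\<inverse> `` {v} - C" "v \<in> Zm \<longrightarrow> Rm v \<inter> Xm = {}" using Rm[OF v] by simp_all
    show "\<exists>A1 A2. A1 \<subseteq> V1 \<and> A2 \<subseteq> V2 \<and> k \<le> card A1 \<and> k \<le> card A2 \<and>
        A1 \<union> A2 \<subseteq> E\<inverse> `` {v} - C \<and> (v \<in> Zm \<longrightarrow> (A1 \<union> A2) \<inter> Xm = {})"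
    proof (rule exI[of _ "Rm1 v"], rule exI[of _ "Rm2 v"], intro conjI)
      show "Rm1 v \<subseteq> V1" "Rm2 v \<subseteq> V2" using a(1,2) V(1,2) by auto
      show "Rm1 v \<union> Rm2 v \<subseteq> E\<inverse> `` {v} - C" using a(1,2) b(1) by blast
      show "v \<in> Zm \<longrightarrow> (Rm1 v \<union> Rm2 v) \<inter> Xm = {}" using a(1,2) b(2) by blast
    qed (use a in simp_all)
  next
    show "6 * k + l + k \<le> card (Zm \<inter> V1)" by (rule mono[OF _ V(1) fin(1)]) (use Z(1) in simp)
    show "6 * k + l + k \<le> card (Zm \<inter> V2)" by (rule mono[OF _ V(2) fin(2)]) (use Z(2) in simp)
    fix y assume "y \<in> Xm"
    from Qm[OF this] show "card (E `` {y} \<inter> Zm) < 6 * k \<or>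
      k \<le> card (E\<inverse> `` {y} \<inter> ?Um \<inter> V1) \<and> k \<le> card (E\<inverse> `` {y} \<inter> ?Um \<inter> V2)"
      using mono[OF _ subset_trans[OF FW(1) V(1)] fin(1), of k "E\<inverse> `` {y} \<inter> ?Um"]
        mono[OF _ subset_trans[OF FW(2) V(2)] fin(2), of k "E\<inverse> `` {y} \<inter> ?Um"] by auto
  qed
  interpret conv: near_semicomplete V "E\<inverse>" l by (rule converse)
  have hp: "V \<subseteq> robust_closure (E\<inverse>) k V1 V2 ?Up"
  proof (rule conv.robust_closure_side[OF CV(5) CV(2) _ _ _ CV(1), where m = "6 * k"], unfold converse_converse)
    fix v assume v: "v \<in> C"
    have a: "Rp1 v \<subseteq> Rp v \<inter> W1" "Rp2 v \<subseteq> Rp v \<inter> W2" "card (Rp1 v) = k" "card (Rp2 v) = k"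
      using bspec[OF R(2) v] by simp_all
    have b: "Rp v \<subseteq> E `` {v} - C" "v \<in> Zp \<longrightarrow> Rp v \<inter> Xp = {}" using Rp[OF v] by simp_all
    show "\<exists>A1 A2. A1 \<subseteq> V1 \<and> A2 \<subseteq> V2 \<and> k \<le> card A1 \<and> k \<le> card A2 \<and>
        A1 \<union> A2 \<subseteq> E `` {v} - C \<and> (v \<in> Zp \<longrightarrow> (A1 \<union> A2) \<inter> Xp = {})"
    proof (rule exI[of _ "Rp1 v"], rule exI[of _ "Rp2 v"], intro conjI)
      show "Rp1 v \<subseteq> V1" "Rp2 v \<subseteq> V2" using a(1,2) V(1,2) by auto
      show "Rp1 v \<union> Rp2 v \<subseteq> E `` {v} - C" using a(1,2) b(1) by blast
      show "v \<in> Zp \<longrightarrow> (Rp1 v \<union> Rp2 v) \<inter> Xp = {}" using a(1,2) b(2) by blast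
    qed (use a in simp_all)
  next
    show "6 * k + l + k \<le> card (Zp \<inter> V1)" by (rule mono[OF _ V(1) fin(1)]) (use Z(3) in simp)
    show "6 * k + l + k \<le> card (Zp \<inter> V2)" by (rule mono[OF _ V(2) fin(2)]) (use Z(4) in simp)
    fix y assume "y \<in> Xp"
    from Qp[OF this] show "card (E\<inverse> `` {y} \<inter> Zp) < 6 * k \<or>
      k \<le> card (E `` {y} \<inter> ?Up \<inter> V1) \<and> k \<le> card (E `` {y} \<inter> ?Up \<inter> V2)"
      using mono[OF _ subset_trans[OF FW(1) V(1)] fin(1), of k "E `` {y} \<inter> ?Up"]
        mono[OF _ subset_trans[OF FW(2) V(2)] fin(2), of k "E `` {y} \<inter> ?Up"] by auto
  qed
  have Kdis: "K p \<inter> K q = {}" if "Q \<subseteq> P" "p \<in> Q" "q \<in> Q" "p \<noteq> q" for p q Q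
    using K_disjoint that by (meson subsetD)
  have s1: "strong k V1 E"
  proof (rule strongI[OF fin(1) _ _ _ subset_trans[OF V(3) hm] subset_trans[OF V(3) hp] finite_subset[OF PP(1) finP], where C = K])
    show "contains_side E E V1 V1 V2" "contains_side (E\<inverse>) (E\<inverse>) V1 V1 V2" by (auto simp: contains_side_def)
    show "K p \<subseteq> V1 \<and> connector E (K p) (?Up \<inter> V1) (?Um \<inter> V1)" if "p \<in> PP1" for p
      using K(1) V(1) that connector_mono[OF subsetD[OF PP(1) that]] by auto
  qed (use n V PP Kdis[OF PP(1)] in auto)
  have s2: "strong k V2 E"
  proof (rule strongI[OF fin(2) _ _ _ subset_trans[OF V(4) hm] subset_trans[OF V(4) hp] finite_subset[OF PP(2) finP], where C = K])
    show "contains_side E E V2 V1 V2" "contains_side (E\<inverse>) (E\<inverse>) V2 V1 V2" by (auto simp: contains_side_def)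
    show "K p \<subseteq> V2 \<and> connector E (K p) (?Up \<inter> V2) (?Um \<inter> V2)" if "p \<in> PP2" for p
      using K(2) V(2) that connector_mono[OF subsetD[OF PP(2) that]] by auto
  qed (use n V PP Kdis[OF PP(2)] in auto)
  have V12: "V1 \<union> V2 \<subseteq> V" using V(3,4) by simp
  have cV: "k + 1 \<le> card (V1 \<union> V2)" using V(6) n(2) card_mono[of "V1 \<union> V2" V1] fin by simp
  let ?H = "E \<inter> (V1 \<times> V2 \<union> V2 \<times> V1)"
  have "strong k (V1 \<union> V2) ?H"
  proof (rule strongI[OF finite_UnI[OF fin] cV _ _ subset_trans[OF V12 hm] subset_trans[OF V12 hp]
        finite_subset[OF PP(3) finP], where C = K])
    show "contains_side E ?H (V1 \<union> V2) V1 V2" "contains_side (E\<inverse>) (?H\<inverse>) (V1 \<union> V2) V1 V2"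
      by (auto simp: contains_side_def)
    show "K p \<subseteq> V1 \<union> V2 \<and> connector ?H (K p) (?Up \<inter> (V1 \<union> V2)) (?Um \<inter> (V1 \<union> V2))" if "p \<in> PPH" for p
    proof
      have pP: "p \<in> P" using that PP(3) by blast
      have Kp: "K p \<subseteq> W1 \<union> W2" "alternates (\<lambda>x. x \<in> W1) p" using bspec[OF K(3) that] by simp_all
      show KV: "K p \<subseteq> V1 \<union> V2" using Kp(1) V(1,2) by blast
      have "(x \<in> W1) = (x \<in> V1)" if "x \<in> K p" for x
        using that Kp(1) V(1,2,5) by blast
      from alternates_cong[OF pP this Kp(2)] have "alternates (\<lambda>x. x \<in> V1) p" .
      from connector_alternating[OF pP KV V(5) this]
      show "connector ?H (K p) (?Up \<inter> (V1 \<union> V2)) (?Um \<inter> (V1 \<union> V2))" .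
    qed
  qed (use PP Kdis[OF PP(3)] in auto)
  then show ?thesis using V s1 s2 by blast
qed

end

section \<open>Existence of configurations\<close>

context near_semicomplete
begin

text \<open>The bound on exceptional vertices is stated for every \<open>W\<close> outside
  \<open>F\<close> and \<open>T\<close>, because it will be applied outside a larger core that also
  contains the gadgets of the other side.\<close>

lemma ex_gadget_side:
  assumes F: "F \<subseteq> V" "L \<subseteq> F" "2 * N + l \<le> card L" "\<And>v. v \<in> L \<Longrightarrow> card (E\<inverse> `` {v}) \<le> \<delta>"
    and deg: "\<And>v. v \<in> V \<Longrightarrow> card F + N * (2 * c + 1) < card (E\<inverse> `` {v})"
  obtains Z B B' T where "Z \<subseteq> V - F" "card Z = N" "T = (\<Union>z\<in>Z. insert z (B z \<union> B' z))" "T \<subseteq> V"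
    "T \<inter> F \<subseteq> L" "card (T - F) \<le> N * (2 * c + 1)" "\<forall>z\<in>Z. gadget E z (B z) (B' z)"
    "\<forall>z\<in>Z. \<forall>y\<in>Z. y \<noteq> z \<longrightarrow> insert z (B z \<union> B' z) \<inter> insert y (B y \<union> B' y) = {}"
    "\<forall>W. W \<subseteq> V - F - T \<longrightarrow>
      2 ^ c * card (\<Union>z\<in>Z. exceptional E W (B z) (B' z)) \<le> N * (2 * \<delta> + 2 ^ c * (6 * l * (c + 1)))"
proof -
  obtain M where M: "M \<subseteq> E \<inter> L \<times> L" "finite M" "card M = N"
    "\<forall>e\<in>M. \<forall>f\<in>M. e \<noteq> f \<longrightarrow> {fst e, snd e} \<inter> {fst f, snd f} = {}"
    using ex_matching[OF subset_trans[OF F(2,1)] F(3)] by (elim exE conjE)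
  have MF: "M \<subseteq> E \<inter> F \<times> F" using M(1) F(2) by blast
  have d: "card (E\<inverse> `` {fst e}) \<le> \<delta> \<and> card (E\<inverse> `` {snd e}) \<le> \<delta> \<and>
      card F + card M * (2 * c + 1) < card (E\<inverse> `` {fst e})" if "e \<in> M" for e
  proof -
    have "fst e \<in> L" "snd e \<in> L" using M(1) that by auto
    then show ?thesis using F(1,2,4) deg[of "fst e"] M(3) by auto
  qed
  obtain Z B B' T where Z: "Z \<subseteq> V - F" "card Z = card M" "T = (\<Union>z\<in>Z. insert z (B z \<union> B' z))" "T \<subseteq> V"
    "T \<inter> F \<subseteq> fst ` M \<union> snd ` M" "card (T - F) \<le> card M * (2 * c + 1)"
    "\<forall>z\<in>Z. gadget E z (B z) (B' z) \<and>
      2 ^ c * card (exceptional E (V - F - T) (B z) (B' z)) \<le> 2 * \<delta> + 2 ^ c * (6 * l * (c + 1))"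
    "\<forall>z\<in>Z. \<forall>y\<in>Z. y \<noteq> z \<longrightarrow> insert z (B z \<union> B' z) \<inter> insert y (B y \<union> B' y) = {}"
    using ex_gadgets[OF F(1) M(2) MF M(4) d] by - (drule meta_mp, assumption, elim exE conjE, rule that)
  have finZ: "finite Z" using Z(1) finV by (meson finite_Diff finite_subset)
  show thesis
  proof (rule that[OF Z(1) _ Z(3,4) _ _ _ Z(8)])
    have "fst ` M \<union> snd ` M \<subseteq> L" using M(1) by force
    then show "T \<inter> F \<subseteq> L" using Z(5) by blast
    show "\<forall>z\<in>Z. gadget E z (B z) (B' z)" using Z(7) by simp
    show "\<forall>W. W \<subseteq> V - F - T \<longrightarrow>
      2 ^ c * card (\<Union>z\<in>Z. exceptional E W (B z) (B' z)) \<le> N * (2 * \<delta> + 2 ^ c * (6 * l * (c + 1)))"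
    proof (intro allI impI)
      fix W assume W: "W \<subseteq> V - F - T"
      have "2 ^ c * card (\<Union>z\<in>Z. exceptional E W (B z) (B' z)) \<le> 2 ^ c * (\<Sum>z\<in>Z. card (exceptional E W (B z) (B' z)))"
        by (intro mult_le_mono2 card_UN_le finZ)
      also have "\<dots> = (\<Sum>z\<in>Z. 2 ^ c * card (exceptional E W (B z) (B' z)))" by (rule sum_distrib_left)
      also have "\<dots> \<le> (\<Sum>z\<in>Z. 2 * \<delta> + 2 ^ c * (6 * l * (c + 1)))"
      proof (rule sum_mono)
        fix z assume z: "z \<in> Z"
        have "finite (exceptional E (V - F - T) (B z) (B' z))"
        by (rule finite_subset[OF _ finV]) (auto simp: exceptional_def)
      moreover have "exceptional E W (B z) (B' z) \<subseteq> exceptional E (V - F - T) (B z) (B' z)"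
          using W by (auto simp: exceptional_def)
        ultimately have "2 ^ c * card (exceptional E W (B z) (B' z)) \<le> 2 ^ c * card (exceptional E (V - F - T) (B z) (B' z))"
          by (intro mult_le_mono2 card_mono)
        then show "2 ^ c * card (exceptional E W (B z) (B' z)) \<le> 2 * \<delta> + 2 ^ c * (6 * l * (c + 1))"
          using bspec[OF Z(7) z] by linarith
      qed
      finally show "2 ^ c * card (\<Union>z\<in>Z. exceptional E W (B z) (B' z)) \<le> N * (2 * \<delta> + 2 ^ c * (6 * l * (c + 1)))"
        using Z(2) M(3) by simp
    qed
  qed (use Z M in auto)
qed

text \<open>\<delta> is the largest in-degree in \<open>L\<close>: an upper bound where the gadgets
  start and a lower bound on \<open>W - L\<close>. Being attained, it inherits every lower bound on
  in-degrees.\<close>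

lemma ex_low_degree:
  assumes "W \<subseteq> V" "N \<le> card W" "N > 0"
  obtains L \<delta> where "L \<subseteq> W" "card L = N" "\<forall>v\<in>L. card (E\<inverse> `` {v}) \<le> \<delta>"
    "\<forall>v\<in>W - L. \<delta> \<le> card (E\<inverse> `` {v})" "\<exists>v\<in>L. \<delta> = card (E\<inverse> `` {v})"
proof -
  let ?f = "\<lambda>v. card (E\<inverse> `` {v})"
  have "finite W" using assms(1) finV finite_subset by blast
  from lowest_subset[OF this assms(2), of ?f] obtain L
    where L: "L \<subseteq> W" "card L = N" "\<And>x y. x \<in> L \<Longrightarrow> y \<in> W - L \<Longrightarrow> ?f x \<le> ?f y" by metis
  have fin: "finite (?f ` L)" "?f ` L \<noteq> {}"
    using L(2) assms(3) by (auto intro: card_ge_0_finite simp: card_gt_0_iff)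
  define \<delta> where "\<delta> = Max (?f ` L)"
  have "\<delta> \<in> ?f ` L" unfolding \<delta>_def using fin by (rule Max_in)
  then have ex: "\<exists>v\<in>L. \<delta> = ?f v" by (elim imageE) (rule bexI)
  show thesis
  proof (rule that[OF L(1,2) _ _ ex])
    show "\<forall>v\<in>L. ?f v \<le> \<delta>" unfolding \<delta>_def using fin by (intro ballI Max_ge) auto
    show "\<forall>v\<in>W - L. \<delta> \<le> ?f v"
    proof
      fix v assume v: "v \<in> W - L"
      from ex obtain x where "x \<in> L" "\<delta> = ?f x" by (elim bexE)
      then show "\<delta> \<le> ?f v" using L(3)[OF _ v] by simp
    qed
  qed
qed

end

section \<open>Linkages from connectivity, and the numerical estimates\<close>

lemma rtrancl_walk:
  assumes "(x, y) \<in> E\<^sup>*"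
  shows "\<exists>p. p \<noteq> [] \<and> walk E p \<and> hd p = x \<and> last p = y"
  using assms
proof (induction rule: rtrancl_induct)
  case base
  show ?case by (intro exI[of _ "[x]"]) simp
next
  case (step y z)
  then obtain p where "p \<noteq> []" "walk E p" "hd p = x" "last p = y" by blast
  then show ?case using step.hyps(2) by (intro exI[of _ "p @ [z]"]) (simp add: walk_append1)
qed

lemma walk_subset:
  assumes "walk (E \<inter> G \<times> G) p" "p \<noteq> []" "hd p \<in> G"
  shows "set p \<subseteq> G"
  using assms by (induction p rule: induct_list012) auto

text \<open>A separator inside \<open>G\<close> with fewer than \<open>N\<close> vertices contains
  neither \<open>A\<close> nor \<open>B\<close>, and together with \<open>V - G\<close> it has fewer
  than \<kappa> vertices; so deleting both cannot disconnect the rest.\<close>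

lemma linkage_between:
  assumes V: "finite V" and A: "A \<subseteq> G" "B \<subseteq> G" "G \<subseteq> V" "N \<le> card A" "N \<le> card B"
    and conn: "\<And>S x y. S \<subseteq> V \<Longrightarrow> card S < \<kappa> \<Longrightarrow> x \<in> V - S \<Longrightarrow> y \<in> V - S \<Longrightarrow> (x, y) \<in> (E \<inter> (V - S) \<times> (V - S))\<^sup>*"
    and small: "card (V - G) + N \<le> \<kappa>"
  obtains P where "linkage E A B P" "card P = N" "\<Union>(set ` P) \<subseteq> G"
proof -
  let ?E = "E \<inter> G \<times> G"
  have fin: "finite G" "finite A" "finite B" using A V by (meson finite_subset)+
  have "N \<le> card S" if S: "finite S" "separates ?E A B S" for S
  proof (rule ccontr)
    assume less: "\<not> N \<le> card S"
    have "\<not> A \<subseteq> S" "\<not> B \<subseteq> S" using less A(4,5) card_mono[OF S(1)] by (meson le_trans)+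
    then obtain x y where xy: "x \<in> A" "x \<notin> S" "y \<in> B" "y \<notin> S" by blast
    define S' where "S' = (V - G) \<union> (S \<inter> V)"
    have "card S' \<le> card (V - G) + card (S \<inter> V)" unfolding S'_def by (rule card_Un_le)
    also have "card (S \<inter> V) \<le> card S" using S(1) by (intro card_mono) auto
    finally have cS: "card S' < \<kappa>" using small less by linarith
    have "(x, y) \<in> (E \<inter> (V - S') \<times> (V - S'))\<^sup>*"
      using xy A by (intro conn cS) (auto simp: S'_def)
    from rtrancl_walk[OF this] obtain p
      where p: "p \<noteq> []" "walk (E \<inter> (V - S') \<times> (V - S')) p" "hd p = x" "last p = y"
      by (elim exE conjE)
    have "set p \<subseteq> V - S'" using walk_subset[OF p(2,1)] xy A p(3) by (auto simp: S'_def)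
    moreover have "walk ?E p" by (rule walk_mono[OF p(2)]) (auto simp: S'_def)
    ultimately show False using separatesD[OF S(2) p(1)] p(3,4) xy by (auto simp: S'_def)
  qed
  then obtain P where P: "linkage ?E A B P" "card P = N"
    using menger[of ?E A B N] fin by blast
  have "set p \<subseteq> G" if "p \<in> P" for p
    using linkage_path[OF P(1) that] A(1) walk_subset[of E G p] by (auto simp: path_def)
  then show thesis using that[OF linkage_mono[OF P(1)] P(2)] by blast
qed

text \<open>The factor is \<open>2 * 13 * 20 * 127\<close> from
  \<open>hitting_failure_small\<close>, where \<open>v\<close> is at least 1900.\<close>

lemma pow4_less_exp: "64 \<le> v \<Longrightarrow> 66040 * v ^ 4 < (2::nat) ^ v"
proof (induction v rule: dec_induct)
  case base
  show ?case by simp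
next
  case (step v)
  have "v ^ 4 + 15 * v ^ 3 \<le> 2 * v ^ 4"
  proof -
    have "15 * v ^ 3 \<le> v * v ^ 3" using step.hyps by (intro mult_le_mono1) simp
    then show ?thesis by (simp add: power_numeral_reduce)
  qed
  moreover have "Suc v ^ 4 \<le> v ^ 4 + 15 * v ^ 3"
  proof -
    have "Suc v ^ 4 = v ^ 4 + 4 * v ^ 3 + 6 * v ^ 2 + 4 * v + 1"
      by (simp add: power_numeral_reduce algebra_simps)
    moreover have "1 \<le> v" using step.hyps by simp
    then have "v ^ 2 \<le> v ^ 3" "v \<le> v ^ 3" "1 \<le> v ^ 3"
      by (auto intro: power_increasing simp: self_le_power)
    ultimately show ?thesis by linarith
  qed
  ultimately show ?case using step.IH by simp
qed

text \<open>An exceptional vertex keeps \<open>\<delta> div (20 * k)\<close> neighbours, less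
  \<open>24 * k\<close> lost to the paths. Divided into \<open>k\<close> pieces these give the size
  \<open>\<delta> div (20 * k\<^sup>2) - 24\<close>, and the left side is the expected number of
  pairs of a piece and one of 128 colours missing in it. The bound is \<open>1 / 2\<close> because
  in- and out-neighbours share the budget 1.\<close>

lemma hitting_failure_small:
  assumes k: "k \<ge> 1" and \<delta>: "5000000 * k * (k + 1)\<^sup>2 \<le> \<delta>" and Y: "20 * Y \<le> \<delta>"
  shows "real 128 * (real Y * (real k * (1 - 1 / real 128) ^ (\<delta> div (20 * k\<^sup>2) - 24))) < 1 / 2"
proof -
  define s where "s = \<delta> div (20 * k\<^sup>2) - 24"
  define v where "v = s div 127"
  have kk: "20 * k\<^sup>2 > 0" using k by simp
  have big: "250000 * k \<le> \<delta> div (20 * k\<^sup>2)"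
  proof (subst less_eq_div_iff_mult_less_eq[OF kk])
    have "250000 * k * (20 * k\<^sup>2) \<le> 5000000 * k * (k + 1)\<^sup>2" by (simp add: power2_eq_square algebra_simps)
    then show "250000 * k * (20 * k\<^sup>2) \<le> \<delta>" using \<delta> by linarith
  qed
  then have "127 * (1900 * k) \<le> s" unfolding s_def using k by linarith
  then have v: "1900 * k \<le> v" unfolding v_def by (simp add: less_eq_div_iff_mult_less_eq mult.commute)
  have "\<delta> < 20 * k\<^sup>2 * (\<delta> div (20 * k\<^sup>2) + 1)"
    using dividend_less_div_times[OF kk, of \<delta>] by (simp add: algebra_simps)
  also have "\<delta> div (20 * k\<^sup>2) + 1 \<le> 127 * (v + 2)"
  proof -
    have "s < 127 * (v + 1)" using dividend_less_div_times[of 127 s] unfolding v_def by simp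
    then have "\<delta> div (20 * k\<^sup>2) < 127 * (v + 1) + 24" unfolding s_def by simp
    then show ?thesis by simp
  qed
  finally have d1: "\<delta> < 20 * k\<^sup>2 * (127 * (v + 2))" by (simp add: mult_le_mono2 order_less_le_trans)
  \<comment> \<open>13 exceeds \<open>2 * 128 / 20\<close>, which collects the 128 colours, the
    bound \<open>1 / 2\<close> and \<open>20 * Y \<le> \<delta>\<close>.\<close>
  have "13 * k * \<delta> \<le> 13 * k * (20 * k\<^sup>2 * (127 * (v + 2)))" using d1 by (intro mult_le_mono2) simp
  also have "\<dots> = 33020 * (k ^ 3 * (v + 2))" by (simp add: power2_eq_square power3_eq_cube algebra_simps)
  also have "\<dots> \<le> 33020 * (v ^ 3 * (2 * v))"
    using v k by (intro mult_le_mono2 mult_le_mono power_mono) auto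
  also have "\<dots> = 66040 * v ^ 4" by (simp add: power_numeral_reduce)
  also have "\<dots> < 2 ^ v" using v k by (intro pow4_less_exp) simp
  finally have *: "13 * k * \<delta> < 2 ^ v" .
  \<comment> \<open>127 points halve the probability of missing a colour, so a piece with
    \<open>127 * v\<close> points contributes at most \<open>1 / 2 ^ v\<close>.\<close>
  have "(2::real) \<le> (1 + 1 / 127) ^ 127"
    using Bernoulli_inequality[of "1 / 127 :: real" 127] by simp
  then have "inverse ((1 + 1 / 127) ^ 127) \<le> inverse (2 :: real)" by (intro le_imp_inverse_le) auto
  moreover have "inverse ((1 + 1 / 127) ^ 127) = (1 - 1 / 128 :: real) ^ 127"
    unfolding power_inverse[symmetric] by simp
  ultimately have half: "(1 - 1 / 128 :: real) ^ 127 \<le> 1 / 2" by simp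
  have "(1 - 1 / 128 :: real) ^ s \<le> (1 - 1 / 128) ^ (127 * v)"
    unfolding v_def by (intro power_decreasing) auto
  also have "\<dots> = ((1 - 1 / 128) ^ 127) ^ v" by (rule power_mult)
  also have "\<dots> \<le> (1 / 2) ^ v" using half by (intro power_mono) auto
  finally have r: "(1 - 1 / 128 :: real) ^ s \<le> 1 / 2 ^ v" by (simp add: power_one_over)
  have "real 128 * (real Y * (real k * (1 - 1 / real 128) ^ s)) \<le> real 128 * (real Y * (real k * (1 / 2 ^ v)))"
    using r by (intro mult_left_mono) auto
  also have "\<dots> = real (128 * Y * k) / 2 ^ v" by simp
  also have "\<dots> < 1 / 2"
  proof -
    have "128 * Y * k * 2 \<le> 13 * k * \<delta>"
    proof -
      have "256 * Y \<le> 13 * \<delta>" using Y by linarith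
      then have "256 * Y * k \<le> 13 * \<delta> * k" by (rule mult_le_mono1)
      then show ?thesis by (simp add: algebra_simps)
    qed
    then have "128 * Y * k * 2 < 2 ^ v" using * by linarith
    then have "real (128 * Y * k * 2) < real (2 ^ v)" by (simp only: of_nat_less_iff)
    then show ?thesis by (simp add: field_simps)
  qed
  finally show ?thesis unfolding s_def .
qed

text \<open>Of the \<open>15 + g\<close> halvings, \<open>g\<close> pay for the factor
  \<open>k + l \<le> 2 ^ g\<close> and 15 for the constant 1200; the additive loss is at most
  \<open>61200 / 5000000\<close> of \<kappa>. Altogether
  \<open>1200 / 32768 + 61200 / 5000000 < 1 / 20\<close>.\<close>

lemma exceptional_bound:
  fixes k l g N \<kappa> \<delta> c X :: nat
  assumes k: "k \<ge> 1" "l \<ge> 1" "g \<ge> 1" "2 * k * l \<le> 2 ^ g" and \<kappa>: "\<kappa> = 5000000 * k * (k + l)\<^sup>2 * g" "\<kappa> \<le> \<delta>"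
    and c: "c = 15 + g" and N: "N = 600 * (k + l)"
    and X: "2 ^ c * X \<le> N * (2 * \<delta> + 2 ^ c * (6 * l * (c + 1)))"
  shows "20 * X \<le> \<delta>"
proof -
  define Y where "Y = N * (6 * l * (c + 1))"
  have "k + l \<le> 2 * k * l"
    using k(1,2) by (cases k; cases l) auto
  then have "k + l \<le> 2 ^ g" using k(4) by linarith
  then have "N * (2 * \<delta>) \<le> 2 ^ g * (1200 * \<delta>)" unfolding N by simp
  moreover have "2 ^ c = 2 ^ g * (32768 :: nat)" unfolding c by (simp add: power_add)
  moreover have "N * (2 * \<delta> + 2 ^ c * (6 * l * (c + 1))) = N * (2 * \<delta>) + 2 ^ c * Y"
    unfolding Y_def by (simp add: distrib_left mult.left_commute)
  ultimately have "2 ^ g * 32768 * X \<le> 2 ^ g * (1200 * \<delta>) + 2 ^ g * 32768 * Y"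
    using X by (metis add_le_mono1 le_trans)
  then have "2 ^ g * (32768 * X) \<le> 2 ^ g * (1200 * \<delta> + 32768 * Y)"
    by (simp add: distrib_left mult.assoc)
  then have 1: "32768 * X \<le> 1200 * \<delta> + 32768 * Y" by simp
  have "Y = 3600 * ((k + l) * l * (16 + g))" unfolding Y_def N c by (simp add: algebra_simps)
  also have "\<dots> \<le> 3600 * ((k + l) * (k + l) * (17 * g))" using k by (intro mult_le_mono2 mult_le_mono) auto
  also have "\<dots> = 61200 * (1 * (k + l)\<^sup>2 * g)" by (simp add: power2_eq_square)
  also have "\<dots> \<le> 61200 * (k * (k + l)\<^sup>2 * g)" using k by (intro mult_le_mono2 mult_le_mono1) auto
  finally have "5000000 * Y \<le> 61200 * \<kappa>" unfolding \<kappa>(1) by (simp add: ac_simps)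
  then show ?thesis using 1 \<kappa>(2) by linarith
qed

section \<open>Assembling a configuration in a highly connected digraph\<close>

context near_semicomplete
begin

text \<open>Deleting fewer than \<kappa> in-neighbours would otherwise make \<open>v\<close>
  unreachable from another remaining vertex.\<close>

lemma in_degree_ge:
  assumes "\<kappa> < card V" "v \<in> V"
    and conn: "\<And>S x y. S \<subseteq> V \<Longrightarrow> card S < \<kappa> \<Longrightarrow> x \<in> V - S \<Longrightarrow> y \<in> V - S \<Longrightarrow> (x, y) \<in> (E \<inter> (V - S) \<times> (V - S))\<^sup>*"
  shows "\<kappa> \<le> card (E\<inverse> `` {v})"
proof (rule ccontr)
  let ?S = "E\<inverse> `` {v}"
  assume "\<not> ?thesis"
  then have less: "card ?S < \<kappa>" by simp
  have S: "?S \<subseteq> V" "finite ?S" using EV finV finite_subset[of ?S V] by auto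
  have "card (insert v ?S) < card V" using S less assms(1) by (simp add: card_insert_if)
  then have "\<not> V \<subseteq> insert v ?S" using S card_mono[of "insert v ?S" V] by auto
  then obtain u where u: "u \<in> V" "u \<noteq> v" "u \<notin> ?S" by blast
  have "v \<notin> ?S" using irr by auto
  then have "(u, v) \<in> (E \<inter> (V - ?S) \<times> (V - ?S))\<^sup>*" using conn[OF S(1) less] u assms(2) by blast
  then obtain w where "(w, v) \<in> E \<inter> (V - ?S) \<times> (V - ?S)" using u(2) by (metis rtranclE)
  then show False by blast
qed

theorem ex_strong_partition:
  assumes k: "k \<ge> 1" and l: "l \<ge> 1" and g: "g \<ge> 1" "2 * k * l \<le> 2 ^ g"
    and \<kappa>: "\<kappa> = 5000000 * k * (k + l)\<^sup>2 * g" "\<kappa> < card V"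
    and conn: "\<And>S x y. S \<subseteq> V \<Longrightarrow> card S < \<kappa> \<Longrightarrow> x \<in> V - S \<Longrightarrow> y \<in> V - S \<Longrightarrow> (x, y) \<in> (E \<inter> (V - S) \<times> (V - S))\<^sup>*"
    and n: "n1 + n2 \<le> card V" "card V \<le> 20 * n1" "card V \<le> 20 * n2"
  shows "\<exists>V1 V2. V1 \<subseteq> V \<and> V2 \<subseteq> V \<and> V1 \<inter> V2 = {} \<and> card V1 = n1 \<and> card V2 = n2 \<and>
    strong k V1 E \<and> strong k V2 E \<and> strong k (V1 \<union> V2) (E \<inter> (V1 \<times> V2 \<union> V2 \<times> V1))"
proof -
  interpret conv: near_semicomplete V "E\<inverse>" l by (rule converse)
  \<comment> \<open>All sizes are compared through \<open>u\<close>, the order of the gadgets, and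
    \<open>q\<close>, the order of their reserves; as \<open>s \<ge> 2\<close>, \<kappa> is at least
    \<open>10000000 * q\<close>.\<close>
  define s where "s = k + l"
  define u where "u = s * g"
  define q where "q = k * u"
  define c where "c = 15 + g"
  \<comment> \<open>Since \<open>N \<ge> 50 * (12 * k)\<close>, the \<open>12 * k\<close> shortest
    of \<open>N\<close> disjoint paths occupy at most a fiftieth of \<open>V\<close>.\<close>
  define N where "N = 600 * s"
  have su: "2 \<le> s" "s \<le> u" "k \<le> s" "l \<le> s" using k l g unfolding s_def u_def by auto
  have uq: "u \<le> q" "k \<le> q" "1 \<le> u"
  proof -
    show "u \<le> q" using k unfolding q_def by simp
    show "1 \<le> u" using su by linarith
    then show "k \<le> q" unfolding q_def by simp
  qed
  have "\<kappa> = 5000000 * (q * s)" unfolding \<kappa>(1) q_def u_def s_def by (simp add: power2_eq_square algebra_simps)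
  moreover have "q * 2 \<le> q * s" using su by (intro mult_le_mono2)
  ultimately have \<kappa>q: "10000000 * q \<le> \<kappa>" by linarith
  have indeg: "\<kappa> \<le> card (E\<inverse> `` {v})" if "v \<in> V" for v by (rule in_degree_ge[OF \<kappa>(2) that conn])
  have outdeg: "\<kappa> \<le> card (E `` {v})" if "v \<in> V" for v
  proof -
    have "(x, y) \<in> (E\<inverse> \<inter> (V - S) \<times> (V - S))\<^sup>*" if "S \<subseteq> V" "card S < \<kappa>" "x \<in> V - S" "y \<in> V - S" for S x y
    proof -
      have "(y, x) \<in> (E \<inter> (V - S) \<times> (V - S))\<^sup>*" using conn that by blast
      then have "(x, y) \<in> ((E \<inter> (V - S) \<times> (V - S))\<inverse>)\<^sup>*" by (rule rtrancl_converseI)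
      then show ?thesis by (simp add: converse_Int converse_Times)
    qed
    from conv.in_degree_ge[OF \<kappa>(2) that this] show ?thesis by simp
  qed
  have inV: "E\<inverse> `` {v} \<subseteq> V" "E `` {v} \<subseteq> V" for v using EV by auto
  have finE: "finite (E\<inverse> `` {v})" "finite (E `` {v})" for v using inV finV by (meson finite_subset)+
  have cs: "2 * N + l \<le> 1201 * u" using su unfolding N_def by linarith
  have NV: "2 * N + l \<le> card V" using cs uq \<kappa>q \<kappa>(2) by linarith
  have N0: "2 * N + l > 0" using l by simp
  from ex_low_degree[OF subset_refl NV N0] obtain Lm \<delta>m where Lm: "Lm \<subseteq> V" "card Lm = 2 * N + l" "\<forall>v\<in>Lm. card (E\<inverse> `` {v}) \<le> \<delta>m"
    "\<forall>v\<in>V - Lm. \<delta>m \<le> card (E\<inverse> `` {v})" "\<exists>v\<in>Lm. \<delta>m = card (E\<inverse> `` {v})" .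
  have finLm: "finite Lm" using Lm(1) finV finite_subset by blast
  have "card (V - Lm) = card V - (2 * N + l)" using Lm(1,2) finLm by (simp add: card_Diff_subset)
  then have "2 * N + l \<le> card (V - Lm)" using cs uq \<kappa>q \<kappa>(2) by linarith
  \<comment> \<open>Choosing \<open>Lp\<close> outside \<open>Lm\<close> keeps the starting arcs of
    the two sides disjoint. The lower bound on out-degrees then holds only outside both sets, which
    suffices because both are put into \<open>C\<close>.\<close>
  from conv.ex_low_degree[OF Diff_subset this N0, unfolded converse_converse]
  obtain Lp \<delta>p where Lp: "Lp \<subseteq> V - Lm" "card Lp = 2 * N + l" "\<forall>v\<in>Lp. card (E `` {v}) \<le> \<delta>p"
    "\<forall>v\<in>V - Lm - Lp. \<delta>p \<le> card (E `` {v})" "\<exists>v\<in>Lp. \<delta>p = card (E `` {v})" .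
  have \<delta>: "\<kappa> \<le> \<delta>m" "\<kappa> \<le> \<delta>p" using Lm(1,5) Lp(1,5) indeg outdeg by auto
  have cN: "N * (2 * c + 1) \<le> 19800 * u"
  proof -
    have "2 * c + 1 \<le> 33 * g" using g(1) unfolding c_def by simp
    then have "N * (2 * c + 1) \<le> N * (33 * g)" by (rule mult_le_mono2)
    then show ?thesis unfolding N_def u_def by (simp add: algebra_simps)
  qed
  define F where "F = Lm \<union> Lp"
  have F: "F \<subseteq> V" "Lm \<subseteq> F" "Lp \<subseteq> F" using Lm(1) Lp(1) unfolding F_def by auto
  have cF: "card F \<le> 2402 * u"
    using card_Un_le[of Lm Lp] Lm(2) Lp(2) cs unfolding F_def by linarith
  have degm: "card F + N * (2 * c + 1) < card (E\<inverse> `` {v})" if "v \<in> V" for v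
    using indeg[OF that] cF cN uq \<kappa>q by linarith
  have Lm': "card (E\<inverse> `` {v}) \<le> \<delta>m" if "v \<in> Lm" for v using Lm(3) that by (rule bspec)
  from ex_gadget_side[OF F(1,2) eq_imp_le[OF Lm(2)[symmetric]] Lm' degm]
  obtain Zm Bm Bm' Tm where Zm: "Zm \<subseteq> V - F" "card Zm = N" "Tm = (\<Union>z\<in>Zm. insert z (Bm z \<union> Bm' z))" "Tm \<subseteq> V"
    "Tm \<inter> F \<subseteq> Lm" "card (Tm - F) \<le> N * (2 * c + 1)" "\<forall>z\<in>Zm. gadget E z (Bm z) (Bm' z)"
    "\<forall>z\<in>Zm. \<forall>y\<in>Zm. y \<noteq> z \<longrightarrow> insert z (Bm z \<union> Bm' z) \<inter> insert y (Bm y \<union> Bm' y) = {}"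
    "\<forall>W. W \<subseteq> V - F - Tm \<longrightarrow>
      2 ^ c * card (\<Union>z\<in>Zm. exceptional E W (Bm z) (Bm' z)) \<le> N * (2 * \<delta>m + 2 ^ c * (6 * l * (c + 1)))" .
  \<comment> \<open>Forbidding \<open>F'\<close> makes the gadgets of the out-degree side disjoint
    from those built before.\<close>
  define F' where "F' = F \<union> Tm"
  have F': "F' \<subseteq> V" "Lp \<subseteq> F'" using F Zm(4) unfolding F'_def by auto
  have finF: "finite F" "finite F'" "finite Tm" using F F' Zm(4) finV finite_subset by blast+
  have cF': "card F' \<le> 2402 * u + 19800 * u"
  proof -
    have "F' = F \<union> (Tm - F)" unfolding F'_def by blast
    then show ?thesis using card_Un_le[of F "Tm - F"] cF Zm(6) cN by simp
  qed
  have degp: "card F' + N * (2 * c + 1) < card ((E\<inverse>)\<inverse> `` {v})" if "v \<in> V" for v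
    using outdeg[OF that] cF' cN uq \<kappa>q by simp
  have Lp': "card ((E\<inverse>)\<inverse> `` {v}) \<le> \<delta>p" if "v \<in> Lp" for v using Lp(3) that by simp
  from conv.ex_gadget_side[OF F'(1,2) eq_imp_le[OF Lp(2)[symmetric]] Lp' degp]
  obtain Zp Bp Bp' Tp where Zp: "Zp \<subseteq> V - F'" "card Zp = N" "Tp = (\<Union>z\<in>Zp. insert z (Bp z \<union> Bp' z))" "Tp \<subseteq> V"
    "Tp \<inter> F' \<subseteq> Lp" "card (Tp - F') \<le> N * (2 * c + 1)" "\<forall>z\<in>Zp. gadget (E\<inverse>) z (Bp z) (Bp' z)"
    "\<forall>z\<in>Zp. \<forall>y\<in>Zp. y \<noteq> z \<longrightarrow> insert z (Bp z \<union> Bp' z) \<inter> insert y (Bp y \<union> Bp' y) = {}"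
    "\<forall>W. W \<subseteq> V - F' - Tp \<longrightarrow>
      2 ^ c * card (\<Union>z\<in>Zp. exceptional (E\<inverse>) W (Bp z) (Bp' z)) \<le> N * (2 * \<delta>p + 2 ^ c * (6 * l * (c + 1)))" .
  define C where "C = F' \<union> Tp"
  have C: "C \<subseteq> V" "Tm \<subseteq> C" "Tp \<subseteq> C" "F \<subseteq> C" "F' \<subseteq> C"
    using F' Zp(4) unfolding C_def F'_def by auto
  have finC: "finite C" using C(1) finV finite_subset by blast
  have cC: "card C \<le> 45000 * u"
  proof -
    have "C = F' \<union> (Tp - F')" unfolding C_def by blast
    then show ?thesis using card_Un_le[of F' "Tp - F'"] cF' Zp(6) cN by simp
  qed
  have ZT: "Zm \<subseteq> Tm" "Zp \<subseteq> Tp" unfolding Zm(3) Zp(3) by auto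
  have Zdis: "Zp \<inter> Zm = {}" using ZT(1) Zp(1) unfolding F'_def by blast
  have Tdis: "Tp \<inter> Tm = {}"
  proof -
    have "Tm \<inter> Lp = {}" using Zm(5) Lp(1) F(3) by blast
    then show ?thesis using Zp(5) unfolding F'_def by blast
  qed
  define Xm where "Xm = (\<Union>z\<in>Zm. exceptional E (V - C) (Bm z) (Bm' z))"
  define Xp where "Xp = (\<Union>z\<in>Zp. exceptional (E\<inverse>) (V - C) (Bp z) (Bp' z))"
  have XV: "Xm \<subseteq> V - C" "Xp \<subseteq> V - C" unfolding Xm_def Xp_def exceptional_def by auto
  have finX: "finite Xm" "finite Xp" using XV finV by (meson finite_Diff finite_subset)+
  have cXm: "20 * card Xm \<le> \<delta>m"
  proof (rule exceptional_bound[OF k l g \<kappa>(1) \<delta>(1) c_def N_def[unfolded s_def]])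
    have "V - C \<subseteq> V - F - Tm" using C(2,4) by blast
    then show "2 ^ c * card Xm \<le> N * (2 * \<delta>m + 2 ^ c * (6 * l * (c + 1)))"
      using Zm(9) unfolding Xm_def by simp
  qed
  have cXp: "20 * card Xp \<le> \<delta>p"
  proof (rule exceptional_bound[OF k l g \<kappa>(1) \<delta>(2) c_def N_def[unfolded s_def]])
    have "V - C \<subseteq> V - F' - Tp" using C(3,5) by blast
    then show "2 ^ c * card Xp \<le> N * (2 * \<delta>p + 2 ^ c * (6 * l * (c + 1)))"
      using Zp(9) unfolding Xp_def by simp
  qed
  \<comment> \<open>Vertices of \<open>Zm\<close> lie outside \<open>Lm\<close>, so their in-degree
    far exceeds \<open>card Xm\<close> and their reserves can avoid \<open>Xm\<close>. Other
    vertices of \<open>C\<close> may have in-degree below \<open>card Xm\<close>, which is why no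
    such demand is made of them.\<close>
  have dm: "\<delta>m \<le> card (E\<inverse> `` {v})" if "v \<in> (V - C) \<union> Zm" for v
  proof -
    have "v \<in> V - Lm" using that C(1,4) F(2) Zm(1) by blast
    then show ?thesis using Lm(4) by simp
  qed
  have dp: "\<delta>p \<le> card (E `` {v})" if "v \<in> (V - C) \<union> Zp" for v
  proof -
    have "v \<in> V - Lm - Lp" using that C(1,4) F(2,3) Zp(1) unfolding F'_def by blast
    then show ?thesis using Lp(4) by simp
  qed
  \<comment> \<open>Each vertex of \<open>C\<close> needs a reserve of \<open>26 * k\<close>
    vertices in each of the two directions; the product is also the size that
    \<open>disjoint_subsets\<close> asks of every candidate set.\<close>
  have kC: "card C * 2 * (26 * k) \<le> 2340000 * q"
  proof -
    have "52 * k * card C \<le> 52 * k * (45000 * u)" using cC by (rule mult_le_mono2)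
    then show ?thesis unfolding q_def by (simp add: algebra_simps)
  qed
  have diff: "card A \<le> card (A - B) + card B" if "finite B" for A B :: "'a set"
    using diff_card_le_card_Diff[OF that, of A] by linarith
  \<comment> \<open>The Boolean selects the direction, \<open>True\<close> for in-neighbours;
    indexing both by one set makes all reserves disjoint at once.\<close>
  define cand where "cand p = (if snd p then (if fst p \<in> Zm then E\<inverse> `` {fst p} - C - Xm else E\<inverse> `` {fst p} - C)
    else (if fst p \<in> Zp then E `` {fst p} - C - Xp else E `` {fst p} - C))" for p :: "'a \<times> bool"
  have cand: "finite (cand p) \<and> card (C \<times> (UNIV :: bool set)) * (26 * k) \<le> card (cand p)" if p: "p \<in> C \<times> UNIV" for p
  proof
    show "finite (cand p)" using finE unfolding cand_def by simp
    have v: "fst p \<in> V" using p C(1) by auto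
    have 1: "card (E\<inverse> `` {fst p}) \<le> card (E\<inverse> `` {fst p} - C) + card C"
      and 2: "card (E `` {fst p}) \<le> card (E `` {fst p} - C) + card C"
      and 3: "card (E\<inverse> `` {fst p} - C) \<le> card (E\<inverse> `` {fst p} - C - Xm) + card Xm"
      and 4: "card (E `` {fst p} - C) \<le> card (E `` {fst p} - C - Xp) + card Xp"
      using finC finX by (intro diff; simp)+
    have "card (C \<times> (UNIV :: bool set)) * (26 * k) \<le> 2340000 * q" using kC by (simp add: card_cartesian_product)
    also have "\<dots> \<le> card (cand p)"
    proof (cases "snd p")
      case True
      show ?thesis
      proof (cases "fst p \<in> Zm")
        case zm: True
        have "\<delta>m \<le> card (E\<inverse> `` {fst p})" using dm zm by blast
        then have "2340000 * q \<le> card (E\<inverse> `` {fst p} - C - Xm)" using 1 3 cXm cC uq \<kappa>q \<delta> by linarith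
        then show ?thesis using True zm unfolding cand_def by simp
      next
        case False
        have "2340000 * q \<le> card (E\<inverse> `` {fst p} - C)" using 1 indeg[OF v] cC uq \<kappa>q by linarith
        then show ?thesis using True False unfolding cand_def by simp
      qed
    next
      case False
      show ?thesis
      proof (cases "fst p \<in> Zp")
        case zp: True
        have "\<delta>p \<le> card (E `` {fst p})" using dp zp by blast
        then have "2340000 * q \<le> card (E `` {fst p} - C - Xp)" using 2 4 cXp cC uq \<kappa>q \<delta> by linarith
        then show ?thesis using False zp unfolding cand_def by simp
      next
        case zp: False
        have "2340000 * q \<le> card (E `` {fst p} - C)" using 2 outdeg[OF v] cC uq \<kappa>q by linarith
        then show ?thesis using False zp unfolding cand_def by simp
      qed
    qed
    finally show "card (C \<times> (UNIV :: bool set)) * (26 * k) \<le> card (cand p)" .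
  qed
  have "finite (C \<times> (UNIV :: bool set))" using finC by simp
  from disjoint_subsets[OF this cand] obtain R where R: "\<forall>p\<in>C \<times> UNIV. R p \<subseteq> cand p \<and> card (R p) = 26 * k"
    "\<forall>i\<in>C \<times> UNIV. \<forall>j\<in>C \<times> UNIV. i \<noteq> j \<longrightarrow> R i \<inter> R j = {}" .
  define Rm where "Rm v = R (v, True)" for v
  define Rp where "Rp v = R (v, False)" for v
  have Rm: "Rm v \<subseteq> E\<inverse> `` {v} - C \<and> card (Rm v) = 26 * k \<and> (v \<in> Zm \<longrightarrow> Rm v \<inter> Xm = {})" if "v \<in> C" for v
  proof -
    have "R (v, True) \<subseteq> cand (v, True)" "card (R (v, True)) = 26 * k" using R(1) that by auto
    then show ?thesis unfolding Rm_def cand_def by (auto split: if_splits)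
  qed
  have Rp: "Rp v \<subseteq> E `` {v} - C \<and> card (Rp v) = 26 * k \<and> (v \<in> Zp \<longrightarrow> Rp v \<inter> Xp = {})" if "v \<in> C" for v
  proof -
    have "R (v, False) \<subseteq> cand (v, False)" "card (R (v, False)) = 26 * k" using R(1) that by auto
    then show ?thesis unfolding Rp_def cand_def by (auto split: if_splits)
  qed
  have Rdis: "Rm v \<inter> Rm w = {} \<and> Rp v \<inter> Rp w = {}" if "v \<in> C" "w \<in> C" "v \<noteq> w" for v w
    unfolding Rm_def Rp_def using R(2) that by simp
  have Rdis': "Rp v \<inter> Rm w = {}" if "v \<in> C" "w \<in> C" for v w
    unfolding Rm_def Rp_def using R(2) that by simp
  define RR where "RR = (\<Union>v\<in>C. Rp v \<union> Rm v)"
  have RRV: "RR \<subseteq> V - C"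
  proof -
    have "Rp v \<union> Rm v \<subseteq> V - C" if "v \<in> C" for v using Rm[OF that] Rp[OF that] inV[of v] by blast
    then show ?thesis unfolding RR_def by auto
  qed
  have finRR: "finite RR" using RRV finV by (meson finite_Diff finite_subset)
  have cRR: "card RR \<le> 2340000 * q"
  proof -
    have "card RR \<le> (\<Sum>v\<in>C. card (Rp v \<union> Rm v))" unfolding RR_def by (rule card_UN_le[OF finC])
    also have "\<dots> \<le> (\<Sum>v\<in>C. 2 * (26 * k))"
    proof (rule sum_mono)
      fix v assume "v \<in> C"
      then show "card (Rp v \<union> Rm v) \<le> 2 * (26 * k)" using Rm[of v] Rp[of v] card_Un_le[of "Rp v" "Rm v"] by simp
    qed
    also have "\<dots> = card C * 2 * (26 * k)" by simp
    finally show ?thesis using kC by linarith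
  qed
  \<comment> \<open>Gadgets and reserves are closed to the paths, except for the possible ends. As
    \<open>C\<close>, \<open>RR\<close> and \<open>N\<close> together stay below \<kappa>,
    connectivity still provides \<open>N\<close> disjoint paths.\<close>
  define G where "G = (V - C - RR) \<union> Zp \<union> Zm"
  have ZC: "Zp \<subseteq> C" "Zm \<subseteq> C" using ZT C(2,3) by auto
  have G: "Zp \<subseteq> G" "Zm \<subseteq> G" "G \<subseteq> V" using ZC C(1) unfolding G_def by auto
  have small: "card (V - G) + N \<le> \<kappa>"
  proof -
    have "card (V - G) \<le> card (C \<union> RR)" using finC finRR by (intro card_mono) (auto simp: G_def)
    also have "\<dots> \<le> card C + card RR" by (rule card_Un_le)
    finally show ?thesis using cC cRR cs uq \<kappa>q by linarith
  qed
  from linkage_between[OF finV G eq_imp_le[OF Zp(2)[symmetric]] eq_imp_le[OF Zm(2)[symmetric]] conn small]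
  obtain P0 where P0: "linkage E Zp Zm P0" "card P0 = N" "\<Union>(set ` P0) \<subseteq> G" .
  \<comment> \<open>\<open>2 * (3 * k)\<close> is what \<open>path_system\<close> needs for
    \<open>M = 3 * k\<close>. A vertex outside \<open>C\<close> and \<open>Qm\<close> is dominated
    by most of \<open>Zm\<close> instead.\<close>
  define Qm where "Qm = {y \<in> V - C. 2 * (3 * k) \<le> card (E `` {y} \<inter> Zm)}"
  define Qp where "Qp = {y \<in> V - C. 2 * (3 * k) \<le> card (E\<inverse> `` {y} \<inter> Zp)}"
  define Ym where "Ym y = E\<inverse> `` {y} \<inter> (V - C - Xm) - RR" for y
  define Yp where "Yp y = E `` {y} \<inter> (V - C - Xp) - RR" for y
  \<comment> \<open>With \<open>M = 3 * k\<close> the redirection needs at most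
    \<open>13 * k * hm\<close> in-neighbours, that is \<open>13 / 20\<close> of
    \<open>\<delta>m\<close>; removing \<open>C\<close>, \<open>Xm\<close> and \<open>RR\<close>
    leaves this many.\<close>
  define hm where "hm = \<delta>m div (20 * k)"
  define hp where "hp = \<delta>p div (20 * k)"
  have hk: "(4 * (3 * k) + 1) * (d div (20 * k)) \<le> y" if "13 * d \<le> 20 * y" for d y
  proof -
    have "20 * ((4 * (3 * k) + 1) * (d div (20 * k))) \<le> 20 * (13 * k * (d div (20 * k)))"
      using k by (intro mult_le_mono2 mult_le_mono1) simp
    also have "\<dots> = 13 * (d div (20 * k) * (20 * k))" by (simp add: ac_simps)
    also have "\<dots> \<le> 13 * d" by (intro mult_le_mono2 div_times_less_eq_dividend)
    finally show ?thesis using that by linarith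
  qed
  have cYm: "(4 * (3 * k) + 1) * hm \<le> card (Ym y)" if "y \<in> V - C" for y
    unfolding hm_def
  proof (rule hk)
    have "E\<inverse> `` {y} - C - Xm - RR = Ym y" using inV unfolding Ym_def by blast
    then have "card (E\<inverse> `` {y}) \<le> card (Ym y) + card C + card Xm + card RR"
      using diff[OF finC, of "E\<inverse> `` {y}"] diff[OF finX(1), of "E\<inverse> `` {y} - C"]
        diff[OF finRR, of "E\<inverse> `` {y} - C - Xm"] by simp
    moreover have "\<delta>m \<le> card (E\<inverse> `` {y})" using dm that by blast
    ultimately show "13 * \<delta>m \<le> 20 * card (Ym y)" using cC cRR cXm uq \<kappa>q \<delta> by linarith
  qed
  have cYp: "(4 * (3 * k) + 1) * hp \<le> card (Yp y)" if "y \<in> V - C" for y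
    unfolding hp_def
  proof (rule hk)
    have "E `` {y} - C - Xp - RR = Yp y" using inV unfolding Yp_def by blast
    then have "card (E `` {y}) \<le> card (Yp y) + card C + card Xp + card RR"
      using diff[OF finC, of "E `` {y}"] diff[OF finX(2), of "E `` {y} - C"]
        diff[OF finRR, of "E `` {y} - C - Xp"] by simp
    moreover have "\<delta>p \<le> card (E `` {y})" using dp that by blast
    ultimately show "13 * \<delta>p \<le> 20 * card (Yp y)" using cC cRR cXp uq \<kappa>q \<delta> by linarith
  qed
  have h1: "1 \<le> hm" "1 \<le> hp"
    unfolding hm_def hp_def using k \<delta> \<kappa>q uq by (simp_all add: less_eq_div_iff_mult_less_eq)
  have QV: "Qp \<subseteq> V - C" "Qm \<subseteq> V - C" unfolding Qp_def Qm_def by auto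
  have RRC: "RR \<inter> C = {}" using RRV by blast
  have M4: "4 * (3 * k) \<le> N" unfolding N_def using su by linarith
  have YmA: "Ym y \<subseteq> E\<inverse> `` {y} \<and> Ym y \<subseteq> V - C \<and> (4 * (3 * k) + 1) * hm \<le> card (Ym y)" if "y \<in> Qm" for y
    using cYm[of y] QV(2) that unfolding Ym_def by blast
  have YpA: "Yp y \<subseteq> E `` {y} \<and> Yp y \<subseteq> V - C \<and> (4 * (3 * k) + 1) * hp \<le> card (Yp y)" if "y \<in> Qp" for y
    using cYp[of y] QV(1) that unfolding Yp_def by blast
  have QmA: "2 * (3 * k) \<le> card (E `` {y} \<inter> Zm)" if "y \<in> Qm" for y using that unfolding Qm_def by simp
  have QpA: "2 * (3 * k) \<le> card (E\<inverse> `` {y} \<inter> Zp)" if "y \<in> Qp" for y using that unfolding Qp_def by simp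
  from path_system[OF finV ZC Zdis C(1) QV RRC P0(1,2) M4 P0(3)[unfolded G_def] YmA YpA QmA QpA h1]
  obtain P where P: "linkage E Zp Zm P" "card P = 3 * k" "\<forall>p\<in>P. set p \<inter> C \<subseteq> {hd p, last p}"
    "\<Union>(set ` P) \<subseteq> V" "N * card (\<Union>(set ` P) - C) \<le> 4 * (3 * k) * card V + N * (8 * (3 * k))"
    "card (\<Union>(set ` P) \<inter> RR) \<le> 8 * (3 * k)"
    "\<forall>y\<in>Qm. hm \<le> card (Ym y - \<Union>(set ` P)) + 8 * (3 * k)"
    "\<forall>y\<in>Qp. hp \<le> card (Yp y - \<Union>(set ` P)) + 8 * (3 * k)" .
  define PP where "PP = \<Union>(set ` P)"
  define U where "U = V - C - RR - PP"
  have finU: "finite U" using finV unfolding U_def by simp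
  \<comment> \<open>Both directions must be hit by the same pair of sets, so the union bound runs
    over the disjoint sum.\<close>
  define I where "I = (Xm \<inter> Qm) <+> (Xp \<inter> Qp)"
  define X where "X = case_sum (\<lambda>y. Ym y - PP) (\<lambda>y. Yp y - PP)"
  define t where "t = case_sum (\<lambda>_ :: 'a. \<delta>m div (20 * k\<^sup>2) - 24) (\<lambda>_ :: 'a. \<delta>p div (20 * k\<^sup>2) - 24)"
  have tk: "k * (d div (20 * k\<^sup>2) - 24) \<le> x" if "d div (20 * k) \<le> x + 24 * k" for d x :: nat
  proof -
    have "d div (20 * k\<^sup>2) = d div (20 * k) div k"
      by (simp add: div_mult2_eq[symmetric] power2_eq_square mult.assoc)
    then have "k * (d div (20 * k\<^sup>2) - 24) = k * (d div (20 * k) div k) - k * 24"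
      by (simp only: right_diff_distrib')
    also have "\<dots> \<le> d div (20 * k) - 24 * k"
      unfolding mult.commute[of k 24] by (intro diff_le_mono times_div_less_eq_dividend)
    also have "\<dots> \<le> x" using that by simp
    finally show ?thesis .
  qed
  have finI: "finite I" using finX unfolding I_def by simp
  have XI: "X i \<subseteq> U \<and> k * t i \<le> card (X i)" if i: "i \<in> I" for i
  proof (cases i)
    case (Inl y)
    then have "y \<in> Qm" using i unfolding I_def by auto
    then have "\<delta>m div (20 * k) \<le> card (Ym y - PP) + 24 * k" using P(7) unfolding PP_def hm_def by simp
    then show ?thesis using tk unfolding Inl X_def t_def U_def Ym_def by auto
  next
    case (Inr y)
    then have "y \<in> Qp" using i unfolding I_def by auto
    then have "\<delta>p div (20 * k) \<le> card (Yp y - PP) + 24 * k" using P(8) unfolding PP_def hp_def by simp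
    then show ?thesis using tk unfolding Inr X_def t_def U_def Yp_def by auto
  qed
  have \<kappa>5: "5000000 * k * (k + 1)\<^sup>2 \<le> \<kappa>"
  proof -
    have "5000000 * k * (k + 1)\<^sup>2 * 1 \<le> 5000000 * k * (k + l)\<^sup>2 * g"
      using l g(1) by (intro mult_le_mono mult_le_mono2 power_mono) auto
    then show ?thesis unfolding \<kappa>(1) by simp
  qed
  have "real 128 * (\<Sum>i\<in>I. real k * (1 - 1 / real 128) ^ t i) < 1"
  proof -
    have "card (Xm \<inter> Qm) \<le> card Xm" "card (Xp \<inter> Qp) \<le> card Xp" using finX by (auto intro: card_mono)
    then have c: "20 * card (Xm \<inter> Qm) \<le> \<delta>m" "20 * card (Xp \<inter> Qp) \<le> \<delta>p" using cXm cXp by linarith+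
    have "(\<Sum>i\<in>I. real k * (1 - 1 / real 128) ^ t i) =
      real (card (Xm \<inter> Qm)) * (real k * (1 - 1 / real 128) ^ (\<delta>m div (20 * k\<^sup>2) - 24)) +
      real (card (Xp \<inter> Qp)) * (real k * (1 - 1 / real 128) ^ (\<delta>p div (20 * k\<^sup>2) - 24))"
      unfolding I_def using finX by (subst sum.Plus) (simp_all add: t_def)
    moreover note hitting_failure_small[OF k le_trans[OF \<kappa>5 \<delta>(1)] c(1)]
      hitting_failure_small[OF k le_trans[OF \<kappa>5 \<delta>(2)] c(2)]
    ultimately show ?thesis by (simp only: distrib_left)
  qed
  \<comment> \<open>With 128 colours, two classes have size at most \<open>card U / 127\<close>,
    little enough compared with the guaranteed twentieth of \<open>V\<close> in each part.\<close>
  then have w: "real (126 + 2) * (\<Sum>i\<in>I. real k * (1 - 1 / real (126 + 2)) ^ t i) < 1" by simp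
  from two_multiply_hitting_sets[OF finU finI XI w] obtain F1 F2
    where FF: "F1 \<subseteq> U" "F2 \<subseteq> U" "F1 \<inter> F2 = {}" "(126 + 1) * card F1 \<le> card U" "(126 + 1) * card F2 \<le> card U"
      "\<forall>i\<in>I. k \<le> card (X i \<inter> F1) \<and> k \<le> card (X i \<inter> F2)" .
  have finF12: "finite F1" "finite F2" using FF(1,2) finU finite_subset by auto
  have cmono: "k \<le> card (A \<inter> H)" if "k \<le> card (B \<inter> H)" "B \<subseteq> A" "finite H" for A B H :: "'a set"
    using that by (meson Int_mono card_mono finite_Int le_trans order_refl)
  interpret conf: configuration V E l k C Zp Zm Xp Xm F1 F2 Bp Bp' Bm Bm' Rp Rm P
  proof
    show "C \<subseteq> V" "Zp \<subseteq> C" "Zm \<subseteq> C" "Zp \<inter> Zm = {}" "Xp \<subseteq> V - C" "Xm \<subseteq> V - C" by fact+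
    show "gadget E z (Bm z) (Bm' z) \<and> Bm z \<union> Bm' z \<subseteq> C" if "z \<in> Zm" for z
    proof
      show "gadget E z (Bm z) (Bm' z)" using Zm(7) that by simp
      have "Bm z \<union> Bm' z \<subseteq> Tm" using that unfolding Zm(3) by auto
      then show "Bm z \<union> Bm' z \<subseteq> C" using C(2) by (rule subset_trans)
    qed
    show "gadget (E\<inverse>) z (Bp z) (Bp' z) \<and> Bp z \<union> Bp' z \<subseteq> C" if "z \<in> Zp" for z
    proof
      show "gadget (E\<inverse>) z (Bp z) (Bp' z)" using Zp(7) that by simp
      have "Bp z \<union> Bp' z \<subseteq> Tp" using that unfolding Zp(3) by auto
      then show "Bp z \<union> Bp' z \<subseteq> C" using C(3) by (rule subset_trans)
    qed
    show "(\<exists>b\<in>Bm z. (b, y) \<in> E) \<and> (\<exists>b\<in>Bm' z. (b, y) \<in> E)" if "z \<in> Zm" "y \<in> V - C - Xm" for z y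
      using that unfolding Xm_def exceptional_def by auto
    show "(\<exists>b\<in>Bp z. (y, b) \<in> E) \<and> (\<exists>b\<in>Bp' z. (y, b) \<in> E)" if "z \<in> Zp" "y \<in> V - C - Xp" for z y
      using that unfolding Xp_def exceptional_def by auto
    show "insert y (Bm y \<union> Bm' y) \<inter> insert z (Bm z \<union> Bm' z) = {}" if "y \<in> Zm" "z \<in> Zm" "y \<noteq> z" for y z
      by (rule Zm(8)[rule_format]) (use that in auto)
    show "insert y (Bp y \<union> Bp' y) \<inter> insert z (Bp z \<union> Bp' z) = {}" if "y \<in> Zp" "z \<in> Zp" "y \<noteq> z" for y z
      by (rule Zp(8)[rule_format]) (use that in auto)
    show "insert y (Bp y \<union> Bp' y) \<inter> insert z (Bm z \<union> Bm' z) = {}" if "y \<in> Zp" "z \<in> Zm" for y z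
    proof -
      have "insert y (Bp y \<union> Bp' y) \<subseteq> Tp" "insert z (Bm z \<union> Bm' z) \<subseteq> Tm"
        using that unfolding Zp(3) Zm(3) by auto
      then show ?thesis using Tdis by blast
    qed
    have "17 * k + 2 * l \<le> N" unfolding N_def using su by linarith
    then show "17 * k + 2 * l \<le> card Zp" "17 * k + 2 * l \<le> card Zm" using Zp(2) Zm(2) by simp_all
    show "Rm v \<subseteq> E\<inverse> `` {v} - C \<and> card (Rm v) = 26 * k \<and> (v \<in> Zm \<longrightarrow> Rm v \<inter> Xm = {})" if "v \<in> C" for v
      by (rule Rm[OF that])
    show "Rp v \<subseteq> E `` {v} - C \<and> card (Rp v) = 26 * k \<and> (v \<in> Zp \<longrightarrow> Rp v \<inter> Xp = {})" if "v \<in> C" for v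
      by (rule Rp[OF that])
    show "Rm v \<inter> Rm w = {} \<and> Rp v \<inter> Rp w = {}" if "v \<in> C" "w \<in> C" "v \<noteq> w" for v w by (rule Rdis[OF that])
    show "Rp v \<inter> Rm w = {}" if "v \<in> C" "w \<in> C" for v w by (rule Rdis'[OF that])
    show "linkage E Zp Zm P" "card P = 3 * k" "\<Union>(set ` P) \<subseteq> V" by fact+
    show "set p \<inter> C \<subseteq> {hd p, last p}" if "p \<in> P" for p using P(3) that by (rule bspec)
    show "card (\<Union>(set ` P) \<inter> (\<Union>v\<in>C. Rp v \<union> Rm v)) \<le> 24 * k" using P(6) unfolding RR_def by simp
    show "F1 \<inter> F2 = {}" by fact
    show "F1 \<union> F2 \<subseteq> V - C - (\<Union>v\<in>C. Rp v \<union> Rm v) - \<Union>(set ` P)"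
      using FF(1,2) unfolding U_def RR_def PP_def by simp
    show "card (E `` {y} \<inter> Zm) < 6 * k \<or>
      k \<le> card (E\<inverse> `` {y} \<inter> (V - C - Xm) \<inter> F1) \<and> k \<le> card (E\<inverse> `` {y} \<inter> (V - C - Xm) \<inter> F2)"
      if y: "y \<in> Xm" for y
    proof (cases "y \<in> Qm")
      case True
      then have "Inl y \<in> I" using y unfolding I_def by auto
      from bspec[OF FF(6) this] have "k \<le> card ((Ym y - PP) \<inter> F1)" "k \<le> card ((Ym y - PP) \<inter> F2)"
        unfolding X_def by auto
      moreover have "Ym y - PP \<subseteq> E\<inverse> `` {y} \<inter> (V - C - Xm)" unfolding Ym_def by blast
      ultimately show ?thesis using cmono finF12 by blast
    next
      case False
      then show ?thesis using y XV(1) unfolding Qm_def by auto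
    qed
    show "card (E\<inverse> `` {y} \<inter> Zp) < 6 * k \<or>
      k \<le> card (E `` {y} \<inter> (V - C - Xp) \<inter> F1) \<and> k \<le> card (E `` {y} \<inter> (V - C - Xp) \<inter> F2)"
      if y: "y \<in> Xp" for y
    proof (cases "y \<in> Qp")
      case True
      then have "Inr y \<in> I" using y unfolding I_def by auto
      from bspec[OF FF(6) this] have "k \<le> card ((Yp y - PP) \<inter> F1)" "k \<le> card ((Yp y - PP) \<inter> F2)"
        unfolding X_def by auto
      moreover have "Yp y - PP \<subseteq> E `` {y} \<inter> (V - C - Xp)" unfolding Yp_def by blast
      ultimately show ?thesis using cmono finF12 by blast
    next
      case False
      then show ?thesis using y XV(2) unfolding Qp_def by auto
    qed
    show "k > 0" using k by simp
  qed
  have cP: "50 * card (PP - C) \<le> card V + 1200 * k"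
  proof -
    have "N * (50 * card (PP - C)) \<le> 50 * (12 * k * card V + N * (24 * k))"
      using mult_le_mono2[OF P(5), of 50] unfolding PP_def by (simp add: ac_simps)
    also have "\<dots> = 600 * k * card V + N * (1200 * k)" by (simp add: algebra_simps)
    also have "\<dots> \<le> N * card V + N * (1200 * k)"
      using su unfolding N_def by (intro add_le_mono1 mult_le_mono1) simp
    also have "\<dots> = N * (card V + 1200 * k)" by (simp add: distrib_left)
    finally show ?thesis using su unfolding N_def by simp
  qed
  have UV: "card U \<le> card V" unfolding U_def using finV by (intro card_mono) auto
  \<comment> \<open>\<open>1 / 50\<close> for the paths and \<open>1 / 127\<close> for
    \<open>F\<close> make less than \<open>1 / 35\<close> of \<open>V\<close>; the remaining terms
    are multiples of \<open>q\<close> and are paid for by \<open>\<kappa> < card V\<close>.\<close>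
  have total: "20 * (card C + card (PP - C) + card C * (2 * k) + card F) \<le> card V" if "(126 + 1) * card F \<le> card U" for F
  proof -
    define a where "a = card C * (2 * k)"
    have "a \<le> 90000 * q" using mult_le_mono2[OF cC, of "2 * k"] unfolding a_def q_def by (simp add: ac_simps)
    moreover have "127 * card F \<le> card V" using that UV by simp
    ultimately have "20 * card C + 20 * card (PP - C) + 20 * a + 20 * card F \<le> card V"
      using cP cC uq \<kappa>q \<kappa>(2) by linarith
    then show ?thesis unfolding a_def by (simp add: distrib_left)
  qed
  have tot1: "card C + card (PP - C) + card C * (2 * k) + card F1 \<le> n1" 
    using le_trans[OF total[OF FF(4)] n(2)] by (simp only: nat_mult_le_cancel_disj)
  have tot2: "card C + card (PP - C) + card C * (2 * k) + card F2 \<le> n2" 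
    using le_trans[OF total[OF FF(5)] n(3)] by (simp only: nat_mult_le_cancel_disj)
  have kn: "k + 1 \<le> n1" "k + 1 \<le> n2" using n(2,3) uq \<kappa>q \<kappa>(2) by linarith+
  show ?thesis by (rule conf.ex_partition[OF n(1) kn tot1[unfolded PP_def] tot2[unfolded PP_def]])
qed

end

section \<open>The theorem for digraphs\<close>

lemma rtrancl_on_iff: "(u, v) \<in> rtrancl_on U r \<longleftrightarrow> u \<in> U \<and> (u, v) \<in> (r \<inter> U \<times> U)\<^sup>*"
proof (intro iffI conjI)
  assume "(u, v) \<in> rtrancl_on U r"
  then show "(u, v) \<in> (r \<inter> U \<times> U)\<^sup>*" "u \<in> U"
    by (induction rule: rtrancl_on_induct) (auto intro: rtrancl_into_rtrancl dest: in_rtrancl_on_in_F)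
next
  assume "u \<in> U \<and> (u, v) \<in> (r \<inter> U \<times> U)\<^sup>*"
  then have "(u, v) \<in> (r \<inter> U \<times> U)\<^sup>*" "u \<in> U" by auto
  then show "(u, v) \<in> rtrancl_on U r"
    by (induction rule: rtrancl_induct) (auto intro: rtrancl_on_into_rtrancl_on)
qed

lemma arcs_ends_induce_subgraph: "arcs_ends (G \<restriction> U) = arcs_ends G \<inter> U \<times> U"
  by (auto simp: arcs_ends_def arc_to_ends_def)

lemma strongly_connected_induce_subgraph_iff:
  "strongly_connected (G \<restriction> U) \<longleftrightarrow> U \<noteq> {} \<and> (\<forall>u\<in>U. \<forall>v\<in>U. (u, v) \<in> (arcs_ends G \<inter> U \<times> U)\<^sup>*)"
  by (simp add: strongly_connected_def reachable_def rtrancl_on_iff arcs_ends_induce_subgraph Int_assoc)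

lemma strongly_k_connectedI:
  assumes "strong k W H" "verts G = W" "arcs_ends G = H \<inter> W \<times> W" "k > 0"
  shows "strongly_k_connected (real k) G"
  unfolding strongly_k_connected_def
proof (intro conjI allI impI)
  have W: "k + 1 \<le> card W" using assms(1) by (simp add: strong_def)
  then show "real k + 1 \<le> real (card (verts G))" unfolding assms(2) by linarith
  fix S assume S: "S \<subseteq> verts G" "real (card S) \<le> real k - 1"
  then have cS: "card S < k" using assms(4) by linarith
  have "finite W" using W card.infinite by fastforce
  then have "finite S" using S(1) assms(2) finite_subset by blast
  then have "\<not> W \<subseteq> S" using W cS card_mono[of S W] by linarith
  moreover have "arcs_ends G \<inter> (W - S) \<times> (W - S) = H \<inter> (W - S) \<times> (W - S)" unfolding assms(3) by blast
  moreover have "S \<subseteq> W" using S(1) assms(2) by simp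
  ultimately show "strongly_connected (G \<restriction> (verts G - S))"
    using assms(1) cS unfolding strongly_connected_induce_subgraph_iff assms(2) strong_def by simp
qed

lemma near_semicomplete_arcs_ends:
  assumes "digraph D" "card (verts D) = n" "n > 0" "real (min_neighbors D) \<ge> real n - real l"
  shows "near_semicomplete (verts D) (arcs_ends D) l"
proof -
  interpret digraph D by fact
  show ?thesis
  proof
    show "finite (verts D)" by simp
    show "arcs_ends D \<subseteq> verts D \<times> verts D" by (auto simp: arcs_ends_def arc_to_ends_def)
    show "(v, v) \<notin> arcs_ends D" for v using no_loops by (auto simp: arcs_ends_def arc_to_ends_def)
    fix v assume v: "v \<in> verts D"
    let ?A = "out_neighbors D v \<union> in_neighbors D v"
    have "min_neighbors D \<le> card ?A" unfolding min_neighbors_def using v by (intro Min_le) auto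
    then have "n \<le> card ?A + l" using assms(4) by linarith
    moreover have A: "?A \<subseteq> verts D" by (auto simp: out_neighbors_def in_neighbors_def)
    then have "card (verts D - ?A) = n - card ?A"
      using assms(2) finite_subset[OF A] by (simp add: card_Diff_subset)
    moreover have "{w \<in> verts D. (v, w) \<notin> arcs_ends D \<and> (w, v) \<notin> arcs_ends D} = verts D - ?A"
      by (auto simp: out_neighbors_def in_neighbors_def)
    ultimately show "card {w \<in> verts D. (v, w) \<notin> arcs_ends D \<and> (w, v) \<notin> arcs_ends D} \<le> l" by simp
  qed
qed

theorem theorem1p3:
  fixes D :: "('a, 'b) pre_digraph" and k l n n1 n2 :: nat
  assumes "k > 0" and "l > 0" and "n > 0" and "n1 > 0" and "n2 > 0"
    and "n1 + n2 \<le> n"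
    and "real n1 \<ge> real n / 20" and "real n2 \<ge> real n / 20"
    and "digraph D" and "card (verts D) = n"
    and "strongly_k_connected
           (10 ^ 7 * real k * (real k + real l)\<^sup>2 * log 2 (2 * real k * real l)) D"
    and "real (min_neighbors D) \<ge> real n - real l"
  shows "\<exists>V1 V2. V1 \<subseteq> verts D \<and> V2 \<subseteq> verts D \<and> V1 \<inter> V2 = {} \<and>
           card V1 = n1 \<and> card V2 = n2 \<and>
           strongly_k_connected (real k) (D \<restriction> V1) \<and>
           strongly_k_connected (real k) (D \<restriction> V2) \<and>
           strongly_k_connected (real k) (between_subgraph D V1 V2) \<and>
           (n1 + n2 = n \<longrightarrow> partition_on (verts D) {V1, V2})"
proof -
  let ?V = "verts D" and ?E = "arcs_ends D"
  let ?K = "10 ^ 7 * real k * (real k + real l)\<^sup>2 * log 2 (2 * real k * real l)"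
  interpret digraph D by fact
  interpret near_semicomplete ?V ?E l
    using assms(3,9,10,12) by (intro near_semicomplete_arcs_ends)
  define \<mu> where "\<mu> = log 2 (2 * real k * real l)"
  have kl: "1 \<le> real k" "1 \<le> real l" using assms(1,2) by auto
  have "1 * 1 \<le> real k * real l" using kl by (intro mult_mono) auto
  then have "log 2 2 \<le> \<mu>" unfolding \<mu>_def by (subst log_le_cancel_iff) auto
  then have \<mu>: "1 \<le> \<mu>" by simp
  \<comment> \<open>Rounding up gives an integral number of halvings. As
    \<open>\<mu> \<ge> 1\<close>, this at most doubles \<mu>, which turns 5000000 into the factor
    \<open>10 ^ 7\<close>.\<close>
  define g where "g = nat \<lceil>\<mu>\<rceil>"
  have g: "\<mu> \<le> real g" "real g \<le> 2 * \<mu>" "1 \<le> g" unfolding g_def using \<mu> by linarith+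
  have "2 * real k * real l = 2 powr \<mu>" unfolding \<mu>_def using kl by simp
  also have "\<dots> \<le> 2 powr real g" using g(1) by simp
  also have "\<dots> = real (2 ^ g)" by (simp add: powr_realpow)
  finally have "real (2 * k * l) \<le> real (2 ^ g)" by simp
  then have kl2: "2 * k * l \<le> 2 ^ g" by (simp only: of_nat_le_iff)
  define \<kappa> where "\<kappa> = 5000000 * k * (k + l)\<^sup>2 * g"
  have "real \<kappa> = 5000000 * real k * (real k + real l)\<^sup>2 * real g" by (simp add: \<kappa>_def)
  also have "\<dots> \<le> 5000000 * real k * (real k + real l)\<^sup>2 * (2 * \<mu>)"
    using g(2) by (intro mult_left_mono) auto
  finally have \<kappa>K: "real \<kappa> \<le> ?K" unfolding \<mu>_def by simp
  have \<kappa>V: "\<kappa> < card ?V" using assms(11) \<kappa>K unfolding strongly_k_connected_def by linarith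
  have conn: "(x, y) \<in> (?E \<inter> (?V - S) \<times> (?V - S))\<^sup>*"
    if "S \<subseteq> ?V" "card S < \<kappa>" "x \<in> ?V - S" "y \<in> ?V - S" for S x y
  proof -
    have "real (card S) \<le> ?K - 1" using that(2) \<kappa>K by linarith
    then have "strongly_connected (D \<restriction> (?V - S))"
      using assms(11) that(1) unfolding strongly_k_connected_def by blast
    then show ?thesis using that(3,4) unfolding strongly_connected_induce_subgraph_iff by blast
  qed
  have n: "n1 + n2 \<le> card ?V" "card ?V \<le> 20 * n1" "card ?V \<le> 20 * n2"
    using assms(6,7,8,10) by linarith+
  have "1 \<le> k" "1 \<le> l" using assms(1,2) by auto
  from ex_strong_partition[OF this g(3) kl2 \<kappa>_def \<kappa>V _ n] conn
  have "\<exists>V1 V2. V1 \<subseteq> ?V \<and> V2 \<subseteq> ?V \<and> V1 \<inter> V2 = {} \<and> card V1 = n1 \<and> card V2 = n2 \<and>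
    strong k V1 ?E \<and> strong k V2 ?E \<and> strong k (V1 \<union> V2) (?E \<inter> (V1 \<times> V2 \<union> V2 \<times> V1))"
    by simp
  then obtain V1 V2 where V: "V1 \<subseteq> ?V" "V2 \<subseteq> ?V" "V1 \<inter> V2 = {}" "card V1 = n1" "card V2 = n2"
    and s: "strong k V1 ?E" "strong k V2 ?E" "strong k (V1 \<union> V2) (?E \<inter> (V1 \<times> V2 \<union> V2 \<times> V1))"
    by (elim exE conjE)
  have "strongly_k_connected (real k) (D \<restriction> V1)" "strongly_k_connected (real k) (D \<restriction> V2)"
    by (rule strongly_k_connectedI[OF s(1) _ _ assms(1)] strongly_k_connectedI[OF s(2) _ _ assms(1)],
        simp, simp add: arcs_ends_induce_subgraph)+
  moreover have "arcs_ends (between_subgraph D V1 V2) = ?E \<inter> (V1 \<times> V2 \<union> V2 \<times> V1)"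
    by (auto simp: arcs_ends_def arc_to_ends_def between_subgraph_def)
  then have "strongly_k_connected (real k) (between_subgraph D V1 V2)"
    by (intro strongly_k_connectedI[OF s(3) _ _ assms(1)]) (auto simp: between_subgraph_def)
  moreover have "partition_on ?V {V1, V2}" if "n1 + n2 = n"
  proof -
    have "card (V1 \<union> V2) = card V1 + card V2"
      using V(1-3) by (intro card_Un_disjoint) (auto intro: finite_subset)
    then have "V1 \<union> V2 = ?V"
      using V assms(10) that by (intro card_subset_eq) auto
    \<comment> \<open>The blocks of a partition must be nonempty, which follows from their positive
      sizes.\<close>
    then show ?thesis
      using V(3-5) assms(4,5) by (auto simp: partition_on_def disjoint_def)
  qed
  ultimately show ?thesis using V by blast
qed

end
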